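(* Let $n\ge 2$, let $\mathcal{S}\subset\mathbb{R}^{n+1}$ be a compact topological hypersurface bounding a Jordan domain $\Omega^{+}$, with unbounded complement $\Omega^{-}$, and suppose that $\mathcal{S}$ is fractal (in the sense given in the context). Let $k\ge 1$ be an integer, $0<\nu\le 1$, and let $f\in \mathrm{Lip}(\mathcal{S},k-1+\nu)$ be $\mathcal{C}\ell(n)$-valued, $f$ being understood as a collection $\{f^{(j)}:\mathcal{S}\to\mathcal{C}\ell(n),\ |j|\le k-1\}$, with associated functions $\mathbf{f}^{(i)}$, $0\le i\le k-1$. If $$\nu>1-\frac{\mathfrak{m}(\mathcal{S})}{n+1}\qquad\text{and}\qquad k<n+1,$$ then the following boundary value problem is solvable: find a polymonogenic function $\Phi$ of order $k$ on $\mathbb{R}^{n+1}\setminus\mathcal{S}$ such that, for $0\le i\le k-1$, $\mathcal{D}^{i}\Phi$ is continuously extendable from $\Omega^{+}$ and from $\Omega^{-}$ to $\mathcal{S}$, with boundary values $(\mathcal{D}^{i}\Phi)^{+}$ and $(\mathcal{D}^{i}\Phi)^{-}$ respectively, and $$(\mathcal{D}^{i}\Phi(x))^{+}-(\mathcal{D}^{i}\Phi(x))^{-}=\mathbf{f}^{(i)}(x),\quad x\in\mathcal{S},\ 0\le i\le k-1,$$ $$(\mathcal{D}^{i}\Phi(\infty))^{-}=0,\quad 0\le i\le k-1.$$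
   Context: Clifford algebra: $\mathcal{C}\ell(n)$ is the real unital associative algebra generated by the standard basis $e_1,\dots,e_n$ of $\mathbb{R}^n$ subject to $e_ie_j+e_je_i=-2\delta_{ij}$; $e_0=1$. It has the basis $e_A=e_{\beta_1}\cdots e_{\beta_m}$, $A=\{\beta_1<\dots<\beta_m\}\subseteq\{1,\dots,n\}$, $e_\emptyset=1$, and the norm $|\sum_A a_Ae_A|=(\sum_A a_A^2)^{1/2}$. Points of $\mathbb{R}^{n+1}$ are written $x=(x_0,x_1,\dots,x_n)$. Continuity, differentiability, etc. of $\mathcal{C}\ell(n)$-valued functions are understood component-wise. Polymonogenic functions: $\mathcal{D}=\sum_{j=0}^n e_j\frac{\partial}{\partial x_j}$ is the generalized Cauchy-Riemann operator, acting from the left. A $\mathcal{C}\ell(n)$-valued function $\Phi\in C^k(\Omega)$ on an open set $\Omega\subset\mathbb{R}^{n+1}$ is polymonogenic of order $k$ if $\mathcal{D}^k\Phi=0$ in $\Omega$. Domains: $\mathcal{S}$ is a compact topological hypersurface in $\mathbb{R}^{n+1}$ which is the boundary of a Jordan domain $\Omega^+$, i.e. $\Omega^+$ and $\Omega^-$ are the bounded and the unbounded component of $\mathbb{R}^{n+1}\setminus\mathcal{S}=\Omega^+\cup\Omega^-$. $\mathcal{S}$ is fractal: it has infinite $n$-dimensional Hausdorff measure, $\mathcal{H}^n(\mathcal{S})=\infty$ (in particular this covers the case $\dim_H\mathcal{S}>n$). The condition $(\mathcal{D}^i\Phi(\infty))^-=0$ means $\mathcal{D}^i\Phi(x)\to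 0$ as $|x|\to\infty$. Higher order Lipschitz classes: let $\mathbf{E}\subset\mathbb{R}^{n+1}$ be closed, $m\ge 0$ an integer and $0<\nu\le1$. For multi-indices $j=(j_0,\dots,j_n)$ of non-negative integers put $|j|=j_0+\dots+j_n$, $j!=j_0!\cdots j_n!$, $x^j=x_0^{j_0}\cdots x_n^{j_n}$. A real-valued function $f$ on $\mathbf{E}$ belongs to $\mathrm{Lip}(\mathbf{E},m+\nu)$ if there are real-valued bounded functions $f^{(j)}$, $0<|j|\le m$, on $\mathbf{E}$, with $f^{(0)}=f$, such that $$f^{(j)}(x)=\sum_{|j+l|\le m}\frac{f^{(j+l)}(y)}{l!}(x-y)^l+R_j(x,y),\qquad x,y\in\mathbf{E},$$ where, for some constant $M>0$, $|f^{(j)}(x)|\le M$ and $|R_j(x,y)|\le M|x-y|^{m+\nu-|j|}$ for all $x,y\in\mathbf{E}$, $|j|\le m$. An element of the class is interpreted as the whole collection $\{f^{(j)}:|j|\le m\}$. For $\mathcal{C}\ell(n)$-valued $f$ this is understood component-wise. For $f\in\mathrm{Lip}(\mathcal{S},k-1+\nu)$ define $$\mathbf{f}^{(i)}=\sum_{r_1,\dots,r_i=0}^{n}e_{r_1}\cdots e_{r_i}\,f^{(\mathbf{1}_{r_1}+\cdots+\mathbf{1}_{r_i})},\qquad i=0,1,\dots,k-1,$$ where $\mathbf{1}_r$ is the multi-index with entry $1$ in position $r$ and $0$ elsewhere; $\mathbf{f}^{(0)}=f^{(0)}=f$. Marcinkiewicz exponent: for a bounded set $D\subset\mathbb{R}^{n+1}$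 not touching $\mathcal{S}$ put $I_p(D)=\int_D\frac{dV(x)}{\mathrm{dist}^p(x,\mathcal{S})}$. Let $\Omega^*=\Omega^-\cap\{x:|x|<r\}$, where $r$ is such that $\mathcal{S}\subset\{|x|<r\}$ (the choice of $r$ is immaterial below). Then $\mathfrak{m}^+(\mathcal{S})=\sup\{p:I_p(\Omega^+)<\infty\}$, $\mathfrak{m}^-(\mathcal{S})=\sup\{p:I_p(\Omega^* )<\infty\}$ and $\mathfrak{m}(\mathcal{S})=\max\{\mathfrak{m}^+(\mathcal{S}),\mathfrak{m}^-(\mathcal{S})\}$. *)

theory Defs
  imports "HOL-Analysis.Analysis"
begin

text \<open>
  The generators are indexed by a finite linearly ordered type \<open>'n\<close> with \<open>n = CARD('n)\<close>, and an
  element is the vector of its coordinates with respect to the basis \<open>e\<^sub>A\<close>, which is \<open>axis A 1\<close>.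
  The Euclidean norm of \<open>real ^ 'n set\<close> is the norm of the algebra. Beware that the library's
  \<open>*\<close> and \<open>1\<close> on this type are componentwise; the Clifford product and unit are \<open>\<star>\<close> and
  \<open>cl_one\<close>.
\<close>

type_synonym 'n clifford = "real ^ ('n set)"

text \<open>
  Sorting \<open>e\<^sub>A e\<^sub>B\<close> costs a factor \<open>-1\<close> for every pair \<open>b < a\<close> (anticommutation) and
  for every pair \<open>b = a\<close> (the square of a generator is \<open>-1\<close>).
\<close>

definition cl_sign :: "'n::{finite,linorder} set \<Rightarrow> 'n set \<Rightarrow> real" where
  "cl_sign A B = (-1) ^ card {(a, b). a \<in> A \<and> b \<in> B \<and> b \<le> a}"

definition cl_mult :: "'n::{finite,linorder} clifford \<Rightarrow> 'n clifford \<Rightarrow> 'n clifford"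
    (infixl "\<star>" 70) where
  "x \<star> y = (\<Sum>A\<in>UNIV. \<Sum>B\<in>UNIV. (cl_sign A B * x $ A * y $ B) *\<^sub>R axis (sym_diff A B) 1)"

definition cl_one :: "'n::{finite,linorder} clifford" where
  "cl_one = axis {} 1"

definition cl_prod_list :: "'n::{finite,linorder} clifford list \<Rightarrow> 'n clifford" where
  "cl_prod_list xs = foldr (\<star>) xs cl_one"

text \<open>
  Points of \<open>\<real>\<^sup>n\<^sup>+\<^sup>1\<close> have the coordinates \<open>x $ None\<close> (this is \<open>x\<^sub>0\<close>) and \<open>x $ Some i\<close>.
  Accordingly \<open>cl_e None\<close> is \<open>e\<^sub>0 = 1\<close>.
\<close>

type_synonym 'n point = "real ^ ('n option)"

fun cl_e :: "'n::{finite,linorder} option \<Rightarrow> 'n clifford" where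
  "cl_e None = cl_one"
| "cl_e (Some i) = axis {i} 1"

text \<open>
  The facts \<open>cl_mult_assoc\<close>, \<open>cl_one_left\<close>, \<open>cl_one_right\<close>, \<open>bilinear_cl_mult\<close>,
  \<open>cl_e_anticommute\<close> and \<open>cl_prod_list_sorted\<close> below show that this is the real unital
  associative algebra with the defining relations and the basis \<open>e\<^sub>A\<close> of increasing products.
\<close>

lemma cl_sign_prod: "cl_sign A B = (\<Prod>a\<in>A. \<Prod>b\<in>B. if b \<le> a then -1 else 1)"
proof -
  have "(\<Prod>a\<in>A. \<Prod>b\<in>B. if b \<le> a then -1 else (1::real))
      = (\<Prod>p\<in>A \<times> B. if snd p \<le> fst p then -1 else 1)"
    by (simp add: prod.cartesian_product case_prod_unfold)
  also have "\<dots> = (-1) ^ card {p \<in> A \<times> B. snd p \<le> fst p}"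
    by (simp add: prod.If_cases Int_def)
  also have "{p \<in> A \<times> B. snd p \<le> fst p} = {(a, b). a \<in> A \<and> b \<in> B \<and> b \<le> a}"
    by auto
  finally show ?thesis by (simp add: cl_sign_def)
qed

lemma prod_sym_diff:
  fixes g :: "'a::finite \<Rightarrow> real"
  assumes "\<And>a. g a * g a = 1"
  shows "prod g (sym_diff A B) = prod g A * prod g B"
proof -
  have A: "prod g A = prod g (A - B) * prod g (A \<inter> B)"
    by (subst prod.union_disjoint [symmetric]) (auto intro: prod.cong)
  have B: "prod g B = prod g (B - A) * prod g (A \<inter> B)"
    by (subst prod.union_disjoint [symmetric]) (auto intro: prod.cong)
  have C: "prod g (sym_diff A B) = prod g (A - B) * prod g (B - A)"
    by (rule prod.union_disjoint) auto
  have D: "prod g (A \<inter> B) * prod g (A \<inter> B) = 1"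
    by (simp add: prod.distrib [symmetric] assms)
  show ?thesis unfolding A B C using D by (simp add: algebra_simps)
qed

lemma cl_sign_sym_diff_left: "cl_sign (sym_diff A B) C = cl_sign A C * cl_sign B C"
  unfolding cl_sign_prod
  by (rule prod_sym_diff) (auto simp: prod.distrib [symmetric] intro!: prod.neutral)

lemma cl_sign_sym_diff_right: "cl_sign A (sym_diff B C) = cl_sign A B * cl_sign A C"
  unfolding cl_sign_prod by (subst prod_sym_diff) (auto simp: prod.distrib)

lemma cl_mult_axis:
  "axis A 1 \<star> axis B 1 = cl_sign A B *\<^sub>R axis (sym_diff A B) 1"
proof -
  have "(cl_sign A' B' * axis A 1 $ A' * axis B 1 $ B') *\<^sub>R axis (sym_diff A' B') (1::real)
      = (if A' = A then if B' = B then cl_sign A B *\<^sub>R axis (sym_diff A B) 1 else 0 else 0)"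
    for A' B' by (simp add: axis_def)
  then show ?thesis
    by (simp add: cl_mult_def if_distrib [where f = "\<lambda>c. sum c UNIV"] cong: if_cong)
       (simp add: sum.If_cases)
qed

lemma bilinear_cl_mult: "bilinear (\<star>)"
  unfolding bilinear_def
  by (auto intro!: linearI
      simp: cl_mult_def algebra_simps sum.distrib scaleR_sum_right scaleR_add_left)

lemma clifford_linear_eqI:
  fixes f g :: "'n::{finite,linorder} clifford \<Rightarrow> 'n clifford"
  assumes "linear f" "linear g" "\<And>A. f (axis A 1) = g (axis A 1)"
  shows "f x = g x"
proof -
  have "f = g"
    by (rule linear_eq_stdbasis [OF assms(1,2)]) (auto simp: Basis_vec_def assms(3))
  then show ?thesis by simp
qed

lemma cl_mult_linear: "linear (\<lambda>y. x \<star> y)" "linear (\<lambda>x. x \<star> y)"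
  using bilinear_cl_mult by (auto simp: bilinear_def)

lemma cl_mult_assoc: "(x \<star> y) \<star> z = x \<star> (y \<star> z)"
proof -
  have lin: "linear (\<lambda>x. (x \<star> y) \<star> z)" "linear (\<lambda>x. x \<star> (y \<star> z))"
    "linear (\<lambda>y. (x \<star> y) \<star> z)" "linear (\<lambda>y. x \<star> (y \<star> z))"
    "linear (\<lambda>z. (x \<star> y) \<star> z)" "linear (\<lambda>z. x \<star> (y \<star> z))" for x y z :: "'a clifford"
    using linear_compose [OF cl_mult_linear(2) [of y] cl_mult_linear(2) [of z]]
      linear_compose [OF cl_mult_linear(1) [of x] cl_mult_linear(2) [of z]]
      linear_compose [OF cl_mult_linear(2) [of z] cl_mult_linear(1) [of x]]
      linear_compose [OF cl_mult_linear(1) [of z] cl_mult_linear(1) [of x]]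
      cl_mult_linear(2) [of "y \<star> z"] cl_mult_linear(1) [of "x \<star> y"]
      linear_compose [OF cl_mult_linear(1) [of y] cl_mult_linear(1) [of x]]
    by (simp_all add: o_def)
  have sd: "sym_diff (sym_diff A B) C = sym_diff A (sym_diff B C)" for A B C :: "'a set"
    by auto
  have b: "(axis A 1 \<star> axis B 1) \<star> axis C 1 = axis A 1 \<star> (axis B 1 \<star> axis C 1)" for A B C :: "'a set"
    unfolding cl_mult_axis bilinear_lmul [OF bilinear_cl_mult] bilinear_rmul [OF bilinear_cl_mult]
      cl_sign_sym_diff_left cl_sign_sym_diff_right sd by (simp add: mult.commute mult.left_commute)
  have "(axis A 1 \<star> axis B 1) \<star> z = axis A 1 \<star> (axis B 1 \<star> z)" for A B :: "'a set" and z
    using clifford_linear_eqI [OF lin(5,6), of "axis A 1" "axis B 1" "axis A 1" "axis B 1"] b by blast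
  then have "(axis A 1 \<star> y) \<star> z = axis A 1 \<star> (y \<star> z)" for A :: "'a set" and y z
    using clifford_linear_eqI [OF lin(3,4), of "axis A 1" z "axis A 1" z] by blast
  then show ?thesis
    using clifford_linear_eqI [OF lin(1,2), of y z y z] by blast
qed

lemma cl_one_left: "cl_one \<star> x = x"
  by (rule clifford_linear_eqI [OF cl_mult_linear(1) linear_id [unfolded id_def]])
     (simp add: cl_one_def cl_mult_axis cl_sign_def)

lemma cl_one_right: "x \<star> cl_one = x"
  by (rule clifford_linear_eqI [OF cl_mult_linear(2) linear_id [unfolded id_def]])
     (simp add: cl_one_def cl_mult_axis cl_sign_def)

lemma cl_e_anticommute:
  "cl_e (Some i) \<star> cl_e (Some j) + cl_e (Some j) \<star> cl_e (Some i) = (if i = j then -2 else 0) *\<^sub>R cl_one"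
proof (cases "i = j")
  case True
  then show ?thesis
    by (simp add: cl_mult_axis cl_sign_prod cl_one_def vec_eq_iff)
next
  case False
  then have "sym_diff {i} {j} = sym_diff {j} {i}" by auto
  with False show ?thesis
    by (auto simp: cl_mult_axis cl_sign_prod scaleR_left_distrib [symmetric])
qed

lemma cl_prod_list_sorted:
  "sorted_wrt (<) is \<Longrightarrow> cl_prod_list (map (\<lambda>i. cl_e (Some i)) is) = axis (set is) 1"
proof (induction "is")
  case Nil
  then show ?case by (simp add: cl_prod_list_def cl_one_def)
next
  case (Cons i "is")
  then have "cl_sign {i} (set is) = 1" and "sym_diff {i} (set is) = insert i (set is)"
    by (auto simp: cl_sign_prod intro!: prod.neutral)
  with Cons show ?case by (simp add: cl_prod_list_def cl_mult_axis)
qed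

definition partial_deriv ::
  "'n option \<Rightarrow> ('n::{finite,linorder} point \<Rightarrow> 'n clifford) \<Rightarrow> 'n point \<Rightarrow> 'n clifford" where
  "partial_deriv j f x = vector_derivative (\<lambda>t. f (x + t *\<^sub>R axis j 1)) (at 0)"

fun Ck_on :: "nat \<Rightarrow> ('n::{finite,linorder} point \<Rightarrow> 'n clifford) \<Rightarrow> 'n point set \<Rightarrow> bool" where
  "Ck_on 0 f U \<longleftrightarrow> continuous_on U f"
| "Ck_on (Suc k) f U \<longleftrightarrow> continuous_on U f \<and>
     (\<forall>j. (\<forall>x\<in>U. (\<lambda>t. f (x + t *\<^sub>R axis j 1)) differentiable at 0) \<and>
          Ck_on k (partial_deriv j f) U)"

definition cauchy_riemann ::
  "('n::{finite,linorder} point \<Rightarrow> 'n clifford) \<Rightarrow> 'n point \<Rightarrow> 'n clifford" where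
  "cauchy_riemann f x = (\<Sum>j\<in>UNIV. cl_e j \<star> partial_deriv j f x)"

definition polymonogenic_on ::
  "nat \<Rightarrow> ('n::{finite,linorder} point \<Rightarrow> 'n clifford) \<Rightarrow> 'n point set \<Rightarrow> bool" where
  "polymonogenic_on k \<Phi> U \<longleftrightarrow>
     open U \<and> Ck_on k \<Phi> U \<and> (\<forall>x\<in>U. (cauchy_riemann ^^ k) \<Phi> x = 0)"

text \<open>
  \<open>n\<close>-dimensional topological submanifolds of \<open>\<real>\<^sup>n\<^sup>+\<^sup>1\<close>; local flatness is not required.
\<close>

definition topological_hypersurface :: "'n::{finite,linorder} point set \<Rightarrow> bool" where
  "topological_hypersurface S \<longleftrightarrow>
     (\<forall>x\<in>S. \<exists>W. openin (top_of_set S) W \<and> x \<in> W \<and>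
        (\<exists>V :: (real ^ 'n::{finite,linorder}) set. open V \<and> W homeomorphic V))"

definition jordan_hypersurface ::
  "'n::{finite,linorder} point set \<Rightarrow> 'n point set \<Rightarrow> 'n point set \<Rightarrow> bool" where
  "jordan_hypersurface S \<Omega>p \<Omega>m \<longleftrightarrow>
     compact S \<and> topological_hypersurface S \<and>
     \<Omega>p \<in> components (- S) \<and> bounded \<Omega>p \<and>
     \<Omega>m \<in> components (- S) \<and> \<not> bounded \<Omega>m \<and>
     - S = \<Omega>p \<union> \<Omega>m \<and> frontier \<Omega>p = S"

text \<open>
  The Hausdorff measure of dimension \<open>d > 0\<close>, up to the usual normalizing constant. The covering
  sets have to be bounded, since \<open>diameter\<close> is meaningless on unbounded sets.
\<close>

definition hausdorff_premeasure :: "real \<Rightarrow> real \<Rightarrow> 'a::metric_space set \<Rightarrow> ennreal" where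
  "hausdorff_premeasure d \<delta> S =
     (INF U \<in> {U :: nat \<Rightarrow> 'a set. S \<subseteq> (\<Union>i. U i) \<and> (\<forall>i. bounded (U i) \<and> diameter (U i) \<le> \<delta>)}.
        \<Sum>i. ennreal (diameter (U i) powr d))"

definition hausdorff_measure :: "real \<Rightarrow> 'a::metric_space set \<Rightarrow> ennreal" where
  "hausdorff_measure d S = (SUP \<delta> \<in> {0<..}. hausdorff_premeasure d \<delta> S)"

definition fractal_hypersurface :: "'n::{finite,linorder} point set \<Rightarrow> bool" where
  "fractal_hypersurface S \<longleftrightarrow> hausdorff_measure (real CARD('n)) S = \<infinity>"

definition dist_integral :: "'a::euclidean_space set \<Rightarrow> real \<Rightarrow> 'a set \<Rightarrow> ennreal" where
  "dist_integral S p D = (\<integral>\<^sup>+x\<in>D. ennreal (1 / infdist x S powr p) \<partial>lborel)"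

text \<open>
  The supremum is taken in the extended reals, so that no boundedness is presupposed.
\<close>

definition one_sided_exponent :: "'a::euclidean_space set \<Rightarrow> 'a set \<Rightarrow> ereal" where
  "one_sided_exponent S D = Sup (ereal ` {p. dist_integral S p D < \<infinity>})"

definition marcinkiewicz_exponent ::
  "'a::euclidean_space set \<Rightarrow> 'a set \<Rightarrow> 'a set \<Rightarrow> real \<Rightarrow> ereal" where
  "marcinkiewicz_exponent S \<Omega>p \<Omega>m r =
     max (one_sided_exponent S \<Omega>p) (one_sided_exponent S (\<Omega>m \<inter> {x. norm x < r}))"

type_synonym 'n multiindex = "'n option \<Rightarrow> nat"

definition mi_abs :: "'n::finite multiindex \<Rightarrow> nat" where
  "mi_abs j = (\<Sum>r\<in>UNIV. j r)"

definition mi_fact :: "'n::finite multiindex \<Rightarrow> real" where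
  "mi_fact j = (\<Prod>r\<in>UNIV. fact (j r))"

definition mi_power :: "'n::finite point \<Rightarrow> 'n multiindex \<Rightarrow> real" where
  "mi_power x j = (\<Prod>r\<in>UNIV. x $ r ^ j r)"

definition mi_plus :: "'n multiindex \<Rightarrow> 'n multiindex \<Rightarrow> 'n multiindex" where
  "mi_plus j l = (\<lambda>r. j r + l r)"

text \<open>The sum \<open>\<one>\<^sub>r\<^sub>1 + \<dots> + \<one>\<^sub>r\<^sub>i\<close> of unit multi-indices.\<close>

definition mi_of_list :: "'n option list \<Rightarrow> 'n multiindex" where
  "mi_of_list rs = (\<lambda>s. \<Sum>r\<leftarrow>rs. if s = r then 1 else 0)"

lemma finite_mi_abs_le: "finite {l :: 'n::finite multiindex. mi_abs (mi_plus j l) \<le> m}"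
proof (rule finite_subset)
  show "{l. mi_abs (mi_plus j l) \<le> m} \<subseteq> (\<Pi>\<^sub>E r\<in>UNIV. {..m})"
  proof
    fix l assume "l \<in> {l. mi_abs (mi_plus j l) \<le> m}"
    then have "(\<Sum>r\<in>UNIV. j r + l r) \<le> m" by (simp add: mi_abs_def mi_plus_def)
    moreover have "j r + l r \<le> (\<Sum>r\<in>UNIV. j r + l r)" for r
      by (rule member_le_sum) auto
    ultimately have "l r \<le> m" for r by (metis add_leD2 order_trans)
    then show "l \<in> (\<Pi>\<^sub>E r\<in>UNIV. {..m})" by auto
  qed
qed (auto intro: finite_PiE)

definition taylor_remainder ::
  "nat \<Rightarrow> ('n::finite multiindex \<Rightarrow> 'n point \<Rightarrow> real) \<Rightarrow> 'n multiindex \<Rightarrow> 'n point \<Rightarrow> 'n point \<Rightarrow> real" where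
  "taylor_remainder m f j x y =
     f j x - (\<Sum>l | mi_abs (mi_plus j l) \<le> m. f (mi_plus j l) y / mi_fact l * mi_power (x - y) l)"

text \<open>
  An element is a whole collection; only its members with \<open>mi_abs j \<le> m\<close>, restricted to \<open>E\<close>,
  matter. The function itself is \<open>f (\<lambda>_. 0)\<close>.
\<close>

definition Lip :: "'n::finite point set \<Rightarrow> nat \<Rightarrow> real \<Rightarrow> ('n multiindex \<Rightarrow> 'n point \<Rightarrow> real) set" where
  "Lip E m \<nu> = {f. \<exists>M>0. \<forall>j. mi_abs j \<le> m \<longrightarrow>
     (\<forall>x\<in>E. \<bar>f j x\<bar> \<le> M) \<and>
     (\<forall>x\<in>E. \<forall>y\<in>E. \<bar>taylor_remainder m f j x y\<bar> \<le> M * norm (x - y) powr (real m + \<nu> - real (mi_abs j)))}"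

definition clifford_Lip ::
  "'n::{finite,linorder} point set \<Rightarrow> nat \<Rightarrow> real \<Rightarrow> ('n multiindex \<Rightarrow> 'n point \<Rightarrow> 'n clifford) set" where
  "clifford_Lip E m \<nu> = {f. \<forall>A. (\<lambda>j x. f j x $ A) \<in> Lip E m \<nu>}"

definition jump_datum ::
  "('n::{finite,linorder} multiindex \<Rightarrow> 'n point \<Rightarrow> 'n clifford) \<Rightarrow> nat \<Rightarrow> 'n point \<Rightarrow> 'n clifford" where
  "jump_datum f i x =
     (\<Sum>rs | length rs = i. cl_prod_list (map cl_e rs) \<star> f (mi_of_list rs) x)"

definition continuous_extension ::
  "('a::topological_space \<Rightarrow> 'b::topological_space) \<Rightarrow> 'a set \<Rightarrow> 'a set \<Rightarrow> ('a \<Rightarrow> 'b) \<Rightarrow> bool" where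
  "continuous_extension g U S G \<longleftrightarrow> continuous_on (U \<union> S) G \<and> (\<forall>x\<in>U. G x = g x)"

definition solves_bvp ::
  "'n::{finite,linorder} point set \<Rightarrow> 'n point set \<Rightarrow> 'n point set \<Rightarrow> nat \<Rightarrow>
   ('n multiindex \<Rightarrow> 'n point \<Rightarrow> 'n clifford) \<Rightarrow> ('n point \<Rightarrow> 'n clifford) \<Rightarrow> bool" where
  "solves_bvp S \<Omega>p \<Omega>m k f \<Phi> \<longleftrightarrow>
     polymonogenic_on k \<Phi> (- S) \<and>
     (\<forall>i<k. \<exists>Gp Gm.
        continuous_extension ((cauchy_riemann ^^ i) \<Phi>) \<Omega>p S Gp \<and>
        continuous_extension ((cauchy_riemann ^^ i) \<Phi>) \<Omega>m S Gm \<and>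
        (\<forall>x\<in>S. Gp x - Gm x = jump_datum f i x) \<and>
        ((cauchy_riemann ^^ i) \<Phi> \<longlongrightarrow> 0) at_infinity)"

end

theory Submission
  imports Defs
begin

text \<open>
  Write \<open>\<D>\<close> for the Cauchy-Riemann operator and \<open>N = n + 1\<close> for the dimension. Because \<open>\<S>\<close> has
  infinite area, the boundary integral of the smooth theory is replaced by a volume integral. The jet
  \<open>f\<close> extends, by Whitney's method, to a function \<open>F\<close> of bounded support that is of class \<open>C\<^sup>2\<^sup>k\<close> off
  \<open>\<S>\<close> and whose derivatives of order \<open>< k\<close> tend to the given data on \<open>\<S>\<close>
  (\<open>tendsto_pd_word_extension\<close>). Let \<open>U\<close> be one of the two domains. The function that is \<open>F\<close> on \<open>U\<close> and
  \<open>0\<close> on the other side has the right jumps and vanishes near infinity, but is not polymonogenic on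
  \<open>U\<close>; the defect is \<open>h = \<D>\<^sup>k F\<close> on \<open>U\<close>, extended by \<open>0\<close>. Hence subtract a solution \<open>u\<close> of
  \<open>\<D>\<^sup>k u = h\<close> all of whose \<open>\<D>\<^sup>i u\<close>, \<open>i < k\<close>, are continuous across \<open>\<S>\<close> and vanish at infinity.

  The functions \<open>x\<^sub>0\<^sup>l / l! \<cdot> conj x / \<bar>x\<bar>\<^sup>N\<close> are a chain of kernels: \<open>\<D>\<close> maps each to the previous one
  and the first to a positive multiple of the Dirac measure (\<open>kernel_step_cr_kernel\<close>). Convolution of
  \<open>h\<close> with the kernel for \<open>l = k - 1\<close> gives \<open>u\<close> up to a constant factor, and \<open>\<D>\<^sup>i u\<close> is, with the same
  factor, the convolution of \<open>h\<close> with the kernel for \<open>l = k - 1 - i\<close>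
  (\<open>cauchy_riemann_potential\<close>). These kernels are \<open>O(\<bar>x\<bar>\<^sup>l\<^sup>+\<^sup>1\<^sup>-\<^sup>N)\<close>, so the convolutions decay at infinity
  since \<open>k < N\<close>, and they are continuous as soon as \<open>h\<close> is in \<open>L\<^sup>p\<close> for some \<open>p > N\<close>, its
  support being bounded (\<open>continuous_potential\<close>).

  This is where the two exponents meet. The extension satisfies \<open>\<bar>h\<bar> \<le> C dist\<^sup>\<nu>\<^sup>-\<^sup>1\<close> near \<open>\<S>\<close>
  (\<open>norm_pd_word_extension_top_le\<close>), so \<open>\<bar>h\<bar>\<^sup>p\<close> is integrable once \<open>dist\<^sup>-\<^sup>p\<^sup>(\<^sup>1\<^sup>-\<^sup>\<nu>\<^sup>)\<close> is integrable over
  the part of \<open>U\<close> near \<open>\<S>\<close>. An exponent \<open>p > N\<close> of this kind exists if the Marcinkiewicz exponent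
  of the side \<open>U\<close> exceeds \<open>N (1 - \<nu>)\<close>, and the hypothesis on \<open>\<nu>\<close> says that it does for at least one of the two sides.
\<close>

section \<open>Functions with continuous iterated partial derivatives\<close>

text \<open>
  The notions behind \<^const>\<open>Ck_on\<close>, for values in any normed space, because cutoffs, coordinates and
  profiles are real-valued. Only derivatives along the axes enter, so one-variable calculus proves
  all closure properties.
\<close>

definition pd :: "'m::finite \<Rightarrow> (real ^ 'm \<Rightarrow> 'b::real_normed_vector) \<Rightarrow> real ^ 'm \<Rightarrow> 'b" where
  "pd j f x = vector_derivative (\<lambda>t. f (x + t *\<^sub>R axis j 1)) (at 0)"

definition has_pd :: "(real ^ 'm::finite \<Rightarrow> 'b::real_normed_vector) \<Rightarrow> 'b \<Rightarrow> 'm \<Rightarrow> real ^ 'm \<Rightarrow> bool" where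
  "has_pd f D j x \<longleftrightarrow> ((\<lambda>t. f (x + t *\<^sub>R axis j 1)) has_vector_derivative D) (at 0)"

fun ck :: "nat \<Rightarrow> (real ^ 'm::finite \<Rightarrow> 'b::real_normed_vector) \<Rightarrow> (real ^ 'm) set \<Rightarrow> bool" where
  "ck 0 f U \<longleftrightarrow> continuous_on U f"
| "ck (Suc k) f U \<longleftrightarrow> continuous_on U f \<and>
     (\<forall>j. (\<forall>x\<in>U. has_pd f (pd j f x) j x) \<and> ck k (pd j f) U)"

lemma has_pd_imp_pd: "has_pd f D j x \<Longrightarrow> pd j f x = D"
  unfolding has_pd_def pd_def by (rule vector_derivative_at)

lemma has_pd_pd_iff:
  "has_pd f (pd j f x) j x \<longleftrightarrow> (\<lambda>t. f (x + t *\<^sub>R axis j 1)) differentiable at 0"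
  unfolding has_pd_def pd_def by (rule vector_derivative_works [symmetric])

lemma partial_deriv_eq_pd: "partial_deriv = pd"
  by (intro ext) (simp add: partial_deriv_def pd_def)

lemma Ck_on_eq_ck: "Ck_on k f U = ck k f U"
  by (induction k arbitrary: f) (simp_all add: has_pd_pd_iff partial_deriv_eq_pd)

lemma ck_imp_continuous: "ck k f U \<Longrightarrow> continuous_on U f"
  by (cases k) auto

lemma ck_subset: "ck k f U \<Longrightarrow> V \<subseteq> U \<Longrightarrow> ck k f V"
  by (induction k arbitrary: f) (auto intro: continuous_on_subset)

lemma ck_SucD: "ck (Suc k) f U \<Longrightarrow> ck k f U"
  by (induction k arbitrary: f) auto

lemma ck_mono: "ck k f U \<Longrightarrow> l \<le> k \<Longrightarrow> ck l f U"
  by (induction k) (auto simp del: ck.simps(2) simp: le_Suc_eq dest: ck_SucD)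

lemma ck_SucI:
  assumes "continuous_on U f" "\<And>j x. x \<in> U \<Longrightarrow> has_pd f (f' j x) j x" "\<And>j. ck k (pd j f) U"
  shows "ck (Suc k) f U"
  using assms has_pd_imp_pd by (metis ck.simps(2))

lemma eventually_line_in_open:
  fixes x :: "real ^ 'm"
  assumes "open U" "x \<in> U"
  shows "\<forall>\<^sub>F t in nhds 0. x + t *\<^sub>R axis j 1 \<in> U"
proof -
  have "((\<lambda>t::real. x + t *\<^sub>R axis j 1) \<longlongrightarrow> x + 0 *\<^sub>R axis j 1) (nhds 0)"
    by (intro tendsto_intros filterlim_ident)
  then show ?thesis using assms by (intro topological_tendstoD) auto
qed

lemma has_pd_cong_open:
  assumes "open U" "x \<in> U" "\<And>y. y \<in> U \<Longrightarrow> f y = g y"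
  shows "has_pd f D j x \<longleftrightarrow> has_pd g D j x"
  unfolding has_pd_def
  by (rule has_vector_derivative_cong_ev)
     (use eventually_mono [OF eventually_line_in_open [OF assms(1,2)] assms(3)] assms in auto)

lemma pd_cong_open:
  assumes "open U" "x \<in> U" "\<And>y. y \<in> U \<Longrightarrow> f y = g y"
  shows "pd j f x = pd j g x"
  unfolding pd_def
  by (rule vector_derivative_cong_eq)
     (use eventually_mono [OF eventually_line_in_open [OF assms(1,2)] assms(3)] assms in auto)

lemma ck_cong_open:
  assumes "open U" "\<And>x. x \<in> U \<Longrightarrow> f x = g x"
  shows "ck k f U \<longleftrightarrow> ck k g U"
  using assms(2)
proof (induction k arbitrary: f g)
  case 0
  then show ?case by (auto intro: continuous_on_cong)
next
  case (Suc k)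
  have p: "pd j f x = pd j g x" if "x \<in> U" for j x
    by (rule pd_cong_open [OF assms(1) that Suc.prems])
  have "ck k (pd j f) U = ck k (pd j g) U" for j
    by (rule Suc.IH) (rule p)
  moreover have "has_pd f (pd j f x) j x \<longleftrightarrow> has_pd g (pd j g x) j x" if "x \<in> U" for x j
    using has_pd_cong_open [OF assms(1) that Suc.prems] p that by simp
  moreover have "continuous_on U f \<longleftrightarrow> continuous_on U g"
    using Suc.prems by (auto intro: continuous_on_cong)
  ultimately show ?case by simp
qed

lemma ck_SucI_open:
  assumes "open U" "continuous_on U f" "\<And>j x. x \<in> U \<Longrightarrow> has_pd f (f' j x) j x" "\<And>j. ck k (f' j) U"
  shows "ck (Suc k) f U"
proof (rule ck_SucI [OF assms(2,3)])
  show "ck k (pd j f) U" for j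
    using ck_cong_open [OF assms(1), of "pd j f" "f' j"] assms(3,4) has_pd_imp_pd by blast
qed

lemma ck_SucE:
  assumes "ck (Suc k) f U"
  shows "x \<in> U \<Longrightarrow> has_pd f (pd j f x) j x" "ck k (pd j f) U" "ck k f U" "continuous_on U f"
proof -
  show "x \<in> U \<Longrightarrow> has_pd f (pd j f x) j x" "ck k (pd j f) U"
    using assms by simp_all
  show "ck k f U" by (rule ck_SucD [OF assms])
  show "continuous_on U f" by (rule ck_imp_continuous [OF assms])
qed

lemma ck_local:
  assumes "\<And>x. x \<in> U \<Longrightarrow> \<exists>V. open V \<and> x \<in> V \<and> ck k f V"
  shows "ck k f U"
proof -
  have c: "continuous_on U f"
    if "\<And>x. x \<in> U \<Longrightarrow> \<exists>V. open V \<and> x \<in> V \<and> ck k f V" for k and f :: "real ^ 'a \<Rightarrow> 'b"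
  proof (rule continuous_at_imp_continuous_on, rule ballI)
    fix x assume "x \<in> U"
    from that [OF this] obtain V where V: "open V" "x \<in> V" "ck k f V" by (elim exE conjE)
    from ck_imp_continuous [OF V(3)] V(1,2) show "isCont f x" by (simp add: continuous_on_eq_continuous_at)
  qed
  show ?thesis
    using assms
  proof (induction k arbitrary: f)
    case 0
    show ?case unfolding ck.simps(1) by (rule c [OF 0])
  next
    case (Suc k)
    have d: "\<exists>V. open V \<and> x \<in> V \<and> ck k (pd j f) V" if "x \<in> U" for x j
    proof -
      from Suc.prems [OF that] obtain V where "open V" "x \<in> V" "ck (Suc k) f V" by (elim exE conjE)
      then show ?thesis using ck_SucE(2) by (intro exI [of _ V]) auto
    qed
    have "has_pd f (pd j f x) j x" if "x \<in> U" for x j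
    proof -
      from Suc.prems [OF that] obtain V where "open V" "x \<in> V" "ck (Suc k) f V" by (elim exE conjE)
      then show ?thesis using ck_SucE(1) by auto
    qed
    moreover have "ck k (pd j f) U" for j by (rule Suc.IH [OF d])
    ultimately show ?case using c [OF Suc.prems] by simp
  qed
qed

subsection \<open>Closure properties\<close>

lemma has_pd_const: "has_pd (\<lambda>_. c) 0 j x"
  by (simp add: has_pd_def)

lemma pd_const: "pd j (\<lambda>_. c) = (\<lambda>_. 0)"
  using has_pd_imp_pd [OF has_pd_const] by blast

lemma has_pd_bounded_linear:
  assumes "bounded_linear L" "has_pd f D j x"
  shows "has_pd (\<lambda>x. L (f x)) (L D) j x"
  using bounded_linear.has_vector_derivative [OF assms(1)] assms(2) by (simp add: has_pd_def)

lemma has_pd_add: "has_pd f D j x \<Longrightarrow> has_pd g E j x \<Longrightarrow> has_pd (\<lambda>x. f x + g x) (D + E) j x"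
  unfolding has_pd_def by (rule has_vector_derivative_add)

lemma has_pd_diff: "has_pd f D j x \<Longrightarrow> has_pd g E j x \<Longrightarrow> has_pd (\<lambda>x. f x - g x) (D - E) j x"
  unfolding has_pd_def by (rule has_vector_derivative_diff)

lemma has_pd_sum:
  "(\<And>i. i \<in> I \<Longrightarrow> has_pd (f i) (D i) j x) \<Longrightarrow> has_pd (\<lambda>x. \<Sum>i\<in>I. f i x) (\<Sum>i\<in>I. D i) j x"
  unfolding has_pd_def by (rule has_vector_derivative_sum)

lemma has_pd_bilinear:
  assumes "bounded_bilinear B" "has_pd f D j x" "has_pd g E j x"
  shows "has_pd (\<lambda>x. B (f x) (g x)) (B (f x) E + B D (g x)) j x"
  using bounded_bilinear.has_vector_derivative [OF assms(1), of _ _ 0 UNIV] assms(2,3)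
  by (fastforce simp: has_pd_def)

lemma has_pd_compose_real:
  fixes f :: "real ^ 'm \<Rightarrow> real"
  assumes "has_pd f D j x" "(g has_real_derivative E) (at (f x))"
  shows "has_pd (\<lambda>x. g (f x)) (E * D) j x"
  using DERIV_chain' [of "\<lambda>t. f (x + t *\<^sub>R axis j 1)" D 0 UNIV g E] assms
  by (simp add: has_pd_def has_real_derivative_iff_has_vector_derivative mult.commute)

lemma has_pd_coord: "has_pd (\<lambda>x. x $ i) (if i = j then 1 else 0) j x"
  unfolding has_pd_def has_real_derivative_iff_has_vector_derivative [symmetric]
  by (auto simp: axis_def intro!: derivative_eq_intros)

lemma has_pd_affine:
  assumes "has_pd f D j (a *\<^sub>R x + b)"
  shows "has_pd (\<lambda>x. f (a *\<^sub>R x + b)) (a *\<^sub>R D) j x"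
proof -
  have "((\<lambda>t. f ((a *\<^sub>R x + b) + t *\<^sub>R axis j 1)) \<circ> (\<lambda>t. a * t) has_vector_derivative a *\<^sub>R D) (at 0)"
    by (rule vector_diff_chain_at) (use assms in \<open>auto simp: has_pd_def intro!: derivative_eq_intros\<close>)
  then show ?thesis by (simp add: has_pd_def o_def algebra_simps)
qed

lemma ck_const: "ck k (\<lambda>_. c) U"
proof (induction k arbitrary: c)
  case (Suc k)
  then show ?case by (simp add: has_pd_const pd_const)
qed simp

lemma ck_bounded_linear:
  assumes "open U" "bounded_linear L" "ck k f U"
  shows "ck k (\<lambda>x. L (f x)) U"
  using assms(3)
proof (induction k arbitrary: f)
  case 0
  then show ?case using bounded_linear.continuous_on [OF assms(2)] by simp
next
  case (Suc k)
  note * = ck_SucE [OF Suc.prems]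
  show ?case
    by (rule ck_SucI_open [OF assms(1) bounded_linear.continuous_on [OF assms(2) *(4)]
        has_pd_bounded_linear [OF assms(2) *(1)] Suc.IH [OF *(2)]])
qed

lemma ck_add:
  assumes "open U" "ck k f U" "ck k g U"
  shows "ck k (\<lambda>x. f x + g x) U"
  using assms(2,3)
proof (induction k arbitrary: f g)
  case (Suc k)
  note * = ck_SucE [OF Suc.prems(1)] and ** = ck_SucE [OF Suc.prems(2)]
  show ?case
    by (rule ck_SucI_open [OF assms(1) continuous_on_add [OF *(4) **(4)]
        has_pd_add [OF *(1) **(1)] Suc.IH [OF *(2) **(2)]])
qed (auto intro: continuous_intros)

lemma ck_sum:
  assumes "open U" "\<And>i. i \<in> I \<Longrightarrow> ck k (f i) U"
  shows "ck k (\<lambda>x. \<Sum>i\<in>I. f i x) U"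
  using assms(2) by (induction I rule: infinite_finite_induct) (auto intro: ck_add ck_const assms(1))

lemma ck_bilinear:
  assumes "open U" "bounded_bilinear B" "ck k f U" "ck k g U"
  shows "ck k (\<lambda>x. B (f x) (g x)) U"
  using assms(3,4)
proof (induction k arbitrary: f g)
  case 0
  then show ?case using bounded_bilinear.continuous_on [OF assms(2)] by auto
next
  case (Suc k)
  note * = ck_SucE [OF Suc.prems(1)] and ** = ck_SucE [OF Suc.prems(2)]
  show ?case
    by (rule ck_SucI_open [OF assms(1) bounded_bilinear.continuous_on [OF assms(2) *(4) **(4)]
        has_pd_bilinear [OF assms(2) *(1) **(1)]
        ck_add [OF assms(1) Suc.IH [OF *(3) **(2)] Suc.IH [OF *(2) **(3)]]])
qed

lemmas ck_mult = ck_bilinear [OF _ bounded_bilinear_mult]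
lemmas ck_scaleR = ck_bilinear [OF _ bounded_bilinear_scaleR]

lemma ck_cmult: "open U \<Longrightarrow> ck k f U \<Longrightarrow> ck k (\<lambda>x. c *\<^sub>R f x) U"
  by (rule ck_bounded_linear [OF _ bounded_linear_scaleR_right])

lemma ck_diff:
  assumes "open U" "ck k f U" "ck k g U"
  shows "ck k (\<lambda>x. f x - g x) U"
  using ck_add [OF assms(1,2) ck_cmult [OF assms(1,3), of "-1"]] by simp

lemma ck_prod:
  fixes f :: "'i \<Rightarrow> real ^ 'm \<Rightarrow> real"
  assumes "open U" "\<And>i. i \<in> I \<Longrightarrow> ck k (f i) U"
  shows "ck k (\<lambda>x. \<Prod>i\<in>I. f i x) U"
  using assms(2) by (induction I rule: infinite_finite_induct) (auto intro: ck_mult ck_const assms(1))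

lemma ck_power:
  fixes f :: "real ^ 'm \<Rightarrow> real"
  assumes "open U" "ck k f U"
  shows "ck k (\<lambda>x. f x ^ n) U"
  by (induction n) (auto intro: ck_mult ck_const assms)

lemma ck_coord: "open U \<Longrightarrow> ck k (\<lambda>x. x $ i) U"
proof (cases k)
  case (Suc l)
  assume "open U"
  then show ?thesis unfolding Suc
    by (rule ck_SucI_open) (auto intro!: continuous_intros has_pd_coord ck_const)
qed (auto intro!: continuous_intros)

lemma ck_affine:
  assumes "ck k f UNIV"
  shows "ck k (\<lambda>x. f (a *\<^sub>R x + b)) UNIV"
  using assms
proof (induction k arbitrary: f)
  case 0
  then show ?case by (auto intro!: continuous_intros intro: continuous_on_compose2)
next
  case (Suc k)
  note * = ck_SucE [OF Suc.prems]
  have c: "continuous_on UNIV (\<lambda>x. f (a *\<^sub>R x + b))"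
    by (rule continuous_on_compose2 [OF *(4)]) (auto intro!: continuous_intros)
  show ?case
    by (rule ck_SucI_open [OF open_UNIV c has_pd_affine [OF *(1)] ck_cmult [OF open_UNIV Suc.IH [OF *(2)]]]) simp
qed

text \<open>
  The exponent is arbitrary in the induction, since a derivative lowers it by one.
\<close>

lemma ck_powr:
  fixes f :: "real ^ 'm \<Rightarrow> real"
  assumes "open U" "\<And>x. x \<in> U \<Longrightarrow> f x > 0" "ck k f U"
  shows "ck k (\<lambda>x. f x powr a) U"
  using assms(3)
proof (induction k arbitrary: a)
  case 0
  then show ?case using assms(2) by (force intro!: continuous_intros)
next
  case (Suc k)
  note * = ck_SucE [OF Suc.prems]
  have c: "continuous_on U (\<lambda>x. f x powr a)"
    using assms(2) *(4) by (force intro!: continuous_intros)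
  have d: "has_pd (\<lambda>x. f x powr a) ((a * f x powr (a - 1)) * pd j f x) j x" if "x \<in> U" for j x
    using has_pd_compose_real [OF *(1) [OF that], of "\<lambda>y. y powr a"]
      has_real_derivative_powr [OF assms(2) [OF that]] by blast
  show ?case
    by (rule ck_SucI_open [OF assms(1) c d])
       (auto intro!: ck_mult [OF assms(1)] ck_const Suc.IH * )
qed

lemma ck_inverse:
  fixes f :: "real ^ 'm \<Rightarrow> real"
  assumes "open U" "\<And>x. x \<in> U \<Longrightarrow> f x > 0" "ck k f U"
  shows "ck k (\<lambda>x. inverse (f x)) U"
  using ck_powr [OF assms, of "-1"] ck_cong_open [OF assms(1), of "\<lambda>x. f x powr -1" "\<lambda>x. inverse (f x)"]
    assms(2) by (auto simp: powr_minus less_imp_le)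

subsection \<open>Smooth steps\<close>

text \<open>
  One power of \<open>max 0 t\<close> is lost with each derivative, so \<open>max 0 t ^ (k + 1)\<close> is of class \<open>C\<^sup>k\<close>.
\<close>

lemma has_real_derivative_max_power:
  "((\<lambda>t::real. max 0 t ^ (k + 2)) has_real_derivative real (k + 2) * max 0 t ^ (k + 1)) (at t)"
proof -
  consider "t < 0" | "t = 0" | "t > 0" by linarith
  then show ?thesis
  proof cases
    case 1
    have "((\<lambda>t::real. 0) has_real_derivative 0) (at t)" by simp
    moreover have "\<forall>\<^sub>F y in nhds t. (0::real) = max 0 y ^ (k + 2)"
      using eventually_nhds_in_open [of "{..<0}" t] 1 by (auto elim!: eventually_mono)
    ultimately have "((\<lambda>t::real. max 0 t ^ (k + 2)) has_real_derivative 0) (at t)"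
      by (rule DERIV_cong_ev [OF refl _ refl, THEN iffD1, rotated])
    with 1 show ?thesis by simp
  next
    case 3
    have "((\<lambda>t::real. t ^ (k + 2)) has_real_derivative real (k + 2) * t ^ (k + 1)) (at t)"
      using DERIV_pow [of "k + 2" t UNIV] by simp
    moreover have "\<forall>\<^sub>F y in nhds t. y ^ (k + 2) = max 0 y ^ (k + 2)"
      using eventually_nhds_in_open [of "{0<..}" t] 3 by (auto elim!: eventually_mono simp: max_def)
    ultimately have "((\<lambda>t::real. max 0 t ^ (k + 2)) has_real_derivative real (k + 2) * t ^ (k + 1)) (at t)"
      by (rule DERIV_cong_ev [OF refl _ refl, THEN iffD1, rotated])
    with 3 show ?thesis by simp
  next
    case 2
    have "((\<lambda>h::real. max 0 h ^ (k + 2) / h) \<longlongrightarrow> 0) (at 0)"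
    proof (rule Lim_null_comparison)
      show "\<forall>\<^sub>F h in at 0. norm (max 0 h ^ (k + 2) / h) \<le> \<bar>h\<bar> ^ (k + 1)"
      proof (rule always_eventually, rule allI)
        show "norm (max 0 h ^ (k + 2) / h) \<le> \<bar>h\<bar> ^ (k + 1)" for h :: real
          by (cases "h > 0") (auto simp: max_def mult_nonpos_nonneg)
      qed
      show "((\<lambda>h::real. \<bar>h\<bar> ^ (k + 1)) \<longlongrightarrow> 0) (at 0)" by (rule tendsto_eq_intros | simp)+
    qed
    with 2 show ?thesis by (simp add: DERIV_def)
  qed
qed

lemma ck_max_power:
  fixes f :: "real ^ 'm \<Rightarrow> real"
  assumes "open U" "ck k f U"
  shows "ck k (\<lambda>x. max 0 (f x) ^ (k + 1)) U"
  using assms(2)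
proof (induction k arbitrary: f)
  case 0
  then show ?case by (auto intro!: continuous_intros)
next
  case (Suc k)
  note * = ck_SucE [OF Suc.prems]
  have d: "has_pd (\<lambda>x. max 0 (f x) ^ (Suc k + 1)) ((real (k + 2) * max 0 (f x) ^ (k + 1)) * pd j f x) j x"
    if "x \<in> U" for j x
    using has_pd_compose_real [OF *(1) [OF that] has_real_derivative_max_power, of k j] by simp
  show ?case
    using *(4) by (intro ck_SucI_open [OF assms(1) _ d] ck_mult [OF assms(1)] ck_const Suc.IH *
        continuous_intros)
qed

text \<open>
  A step of class \<open>C\<^sup>k\<close>, with \<open>k\<close> a parameter: a problem of finite order differentiates only finitely
  often, and the rational expression is elementary.
\<close>

definition smooth_step :: "nat \<Rightarrow> real \<Rightarrow> real" where
  "smooth_step k t = max 0 t ^ (k + 1) / (max 0 t ^ (k + 1) + max 0 (1 - t) ^ (k + 1))"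

lemma smooth_step_denominator: "max 0 t ^ (k + 1) + max 0 (1 - t) ^ (k + 1) > (0::real)"
proof (cases "t > 0")
  case True
  then show ?thesis by (auto intro: add_pos_nonneg)
next
  case False
  then have "max 0 (1 - t) ^ (k + 1) > 0" by (intro zero_less_power) auto
  then show ?thesis by (rule add_nonneg_pos [rotated]) auto
qed

lemma smooth_step_0: "t \<le> 0 \<Longrightarrow> smooth_step k t = 0"
  by (simp add: smooth_step_def max_def)

lemma smooth_step_1: "t \<ge> 1 \<Longrightarrow> smooth_step k t = 1"
  using smooth_step_denominator [of t k] by (simp add: smooth_step_def max_def)

lemma ck_smooth_step:
  fixes f :: "real ^ 'm \<Rightarrow> real"
  assumes "open U" "ck k f U"
  shows "ck k (\<lambda>x. smooth_step k (f x)) U"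
  unfolding smooth_step_def divide_inverse
  by (intro ck_mult ck_inverse ck_add ck_max_power ck_diff ck_const assms smooth_step_denominator)

subsection \<open>Scaled bounds for iterated partial derivatives\<close>

text \<open>
  The length scale \<open>s\<close> grants a derivative of order \<open>i \<le> k\<close> the bound \<open>C / s ^ i\<close>. With these weights
  the Leibniz rule is multiplicative in \<open>C\<close>.
\<close>

fun pd_bounded :: "nat \<Rightarrow> real \<Rightarrow> real \<Rightarrow> (real ^ 'm::finite \<Rightarrow> 'b::real_normed_vector) \<Rightarrow> (real ^ 'm) set \<Rightarrow> bool" where
  "pd_bounded 0 s C f U \<longleftrightarrow> (\<forall>x\<in>U. norm (f x) \<le> C)"
| "pd_bounded (Suc k) s C f U \<longleftrightarrow> (\<forall>x\<in>U. norm (f x) \<le> C) \<and> (\<forall>j. pd_bounded k s (C / s) (pd j f) U)"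

lemma pd_bounded_imp_norm_le: "pd_bounded k s C f U \<Longrightarrow> x \<in> U \<Longrightarrow> norm (f x) \<le> C"
  by (cases k) auto

lemma pd_bounded_subset: "pd_bounded k s C f U \<Longrightarrow> V \<subseteq> U \<Longrightarrow> pd_bounded k s C f V"
  by (induction k arbitrary: f C) auto

lemma pd_bounded_SucD: "pd_bounded (Suc k) s C f U \<Longrightarrow> pd_bounded k s C f U"
  by (induction k arbitrary: f C) auto

lemma pd_bounded_mono:
  assumes "pd_bounded k s C f U" "C \<le> D" "0 < t" "t \<le> s" "0 \<le> C"
  shows "pd_bounded k t D f U"
  using assms(1,2,5)
proof (induction k arbitrary: f C D)
  case 0
  then show ?case by force
next
  case (Suc k)
  have "C / s \<le> D / t" using Suc.prems assms by (intro frac_le) auto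
  moreover have "0 \<le> C / s" using Suc.prems assms by auto
  ultimately show ?case using Suc by force
qed

lemma pd_bounded_cong_open:
  assumes "open U" "\<And>x. x \<in> U \<Longrightarrow> f x = g x"
  shows "pd_bounded k s C f U \<longleftrightarrow> pd_bounded k s C g U"
  using assms(2)
proof (induction k arbitrary: f g C)
  case (Suc k)
  have "pd_bounded k s (C / s) (pd j f) U = pd_bounded k s (C / s) (pd j g) U" for j
    by (rule Suc.IH) (rule pd_cong_open [OF assms(1) _ Suc.prems])
  with Suc.prems show ?case by auto
qed auto

lemma pd_bounded_empty: "pd_bounded k s C f {}"
  by (induction k arbitrary: f C) simp_all

lemma pd_bounded_zero: "C \<ge> 0 \<Longrightarrow> s > 0 \<Longrightarrow> pd_bounded k s C (\<lambda>_. 0) U"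
proof (induction k arbitrary: C)
  case (Suc k)
  then show ?case by (simp add: pd_const)
qed simp

lemma pd_bounded_const: "s > 0 \<Longrightarrow> pd_bounded k s (norm c) (\<lambda>_. c) U"
proof (cases k)
  case (Suc k)
  assume "s > 0"
  with Suc show ?thesis by (simp add: pd_bounded_zero pd_const)
qed simp

lemma pd_bounded_add:
  assumes "open U" "ck k f U" "ck k g U" "pd_bounded k s C f U" "pd_bounded k s D g U"
  shows "pd_bounded k s (C + D) (\<lambda>x. f x + g x) U"
  using assms(2-)
proof (induction k arbitrary: f g C D)
  case 0
  then show ?case by (simp add: norm_triangle_mono)
next
  case (Suc k)
  note * = ck_SucE [OF Suc.prems(1)] and ** = ck_SucE [OF Suc.prems(2)]
  have "pd_bounded k s (C / s + D / s) (\<lambda>x. pd j f x + pd j g x) U" for j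
    using Suc.prems(3,4) by (intro Suc.IH * **) auto
  moreover have "pd j (\<lambda>x. f x + g x) x = pd j f x + pd j g x" if "x \<in> U" for j x
    by (rule has_pd_imp_pd [OF has_pd_add [OF *(1) **(1)]]) fact+
  ultimately have "pd_bounded k s ((C + D) / s) (pd j (\<lambda>x. f x + g x)) U" for j
    using pd_bounded_cong_open [OF assms(1), of "pd j (\<lambda>x. f x + g x)" "\<lambda>x. pd j f x + pd j g x" for j]
    by (simp add: add_divide_distrib)
  moreover have "norm (f x + g x) \<le> C + D" if "x \<in> U" for x
    using Suc.prems(3,4) that by (simp add: norm_triangle_mono)
  ultimately show ?case by simp
qed

lemma pd_bounded_sum:
  assumes "open U" "finite I" "s > 0" "\<And>i. i \<in> I \<Longrightarrow> ck k (f i) U" "\<And>i. i \<in> I \<Longrightarrow> pd_bounded k s C (f i) U"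
  shows "pd_bounded k s (real (card I) * C) (\<lambda>x. \<Sum>i\<in>I. f i x) U"
  using assms(2,4,5)
proof (induction I)
  case empty
  then show ?case by (simp add: pd_bounded_zero assms)
next
  case (insert i I)
  have "pd_bounded k s (C + real (card I) * C) (\<lambda>x. f i x + (\<Sum>i\<in>I. f i x)) U"
    by (rule pd_bounded_add) (use insert assms(1) in \<open>auto intro: ck_sum\<close>)
  then show ?case using insert by (simp add: algebra_simps)
qed

text \<open>
  The Leibniz rule; \<open>2 ^ k\<close> bounds the number of its terms.
\<close>

lemma pd_bounded_scaleR:
  assumes "open U" "s > 0" "ck k f U" "ck k g U" "pd_bounded k s C f U" "pd_bounded k s D g U"
  shows "pd_bounded k s (2 ^ k * (C * D)) (\<lambda>x. f x *\<^sub>R g x) U"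
proof (cases "U = {}")
  case False
  then show ?thesis
    using assms(3-)
  proof (induction k arbitrary: f g C D)
    case 0
    then show ?case by (auto intro!: mult_mono intro: order_trans [OF norm_ge_zero])
  next
    case (Suc k)
    note * = ck_SucE [OF Suc.prems(2)] and ** = ck_SucE [OF Suc.prems(3)]
    from False obtain x0 where "x0 \<in> U" by blast
    then have CD: "0 \<le> C" "0 \<le> D"
      using Suc.prems(4,5) by (auto intro: order_trans [OF norm_ge_zero])
    have "pd_bounded k s (2 ^ k * (C * (D / s)) + 2 ^ k * ((C / s) * D)) (\<lambda>x. f x *\<^sub>R pd j g x + pd j f x *\<^sub>R g x) U" for j
      using Suc.prems(4,5) pd_bounded_SucD [OF Suc.prems(4)] pd_bounded_SucD [OF Suc.prems(5)]
      by (intro pd_bounded_add ck_scaleR Suc.IH * ** assms(1)) (auto simp: False)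
    moreover have "pd j (\<lambda>x. f x *\<^sub>R g x) x = f x *\<^sub>R pd j g x + pd j f x *\<^sub>R g x" if "x \<in> U" for j x
      by (rule has_pd_imp_pd [OF has_pd_bilinear [OF bounded_bilinear_scaleR *(1) **(1)]]) fact+
    ultimately have "pd_bounded k s ((2 ^ Suc k * (C * D)) / s) (pd j (\<lambda>x. f x *\<^sub>R g x)) U" for j
      using pd_bounded_cong_open [OF assms(1), of "pd j (\<lambda>x. f x *\<^sub>R g x)" "\<lambda>x. f x *\<^sub>R pd j g x + pd j f x *\<^sub>R g x" for j]
      by (simp add: field_simps)
    moreover have "norm (f x *\<^sub>R g x) \<le> 2 ^ Suc k * (C * D)" if "x \<in> U" for x
    proof -
      have "norm (f x *\<^sub>R g x) \<le> 1 * (C * D)"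
        using Suc.prems(4,5) that CD by (auto intro!: mult_mono)
      also have "\<dots> \<le> 2 ^ Suc k * (C * D)"
        using CD by (intro mult_right_mono one_le_power) auto
      finally show ?thesis .
    qed
    ultimately show ?case by simp
  qed
qed (simp add: pd_bounded_empty)

lemma pd_bounded_cmult:
  assumes "open U" "ck k f U" "pd_bounded k s C f U"
  shows "pd_bounded k s (\<bar>c\<bar> * C) (\<lambda>x. c *\<^sub>R f x) U"
  using assms(2-)
proof (induction k arbitrary: f C)
  case 0
  then show ?case by (auto intro!: mult_left_mono)
next
  case (Suc k)
  note * = ck_SucE [OF Suc.prems(1)]
  have "pd_bounded k s (\<bar>c\<bar> * (C / s)) (\<lambda>x. c *\<^sub>R pd j f x) U" for j
    using Suc.prems(2) by (intro Suc.IH * ) auto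
  moreover have "pd j (\<lambda>x. c *\<^sub>R f x) x = c *\<^sub>R pd j f x" if "x \<in> U" for j x
    by (rule has_pd_imp_pd [OF has_pd_bounded_linear [OF bounded_linear_scaleR_right *(1)]]) fact
  ultimately have "pd_bounded k s ((\<bar>c\<bar> * C) / s) (pd j (\<lambda>x. c *\<^sub>R f x)) U" for j
    using pd_bounded_cong_open [OF assms(1), of "pd j (\<lambda>x. c *\<^sub>R f x)" "\<lambda>x. c *\<^sub>R pd j f x" for j]
    by simp
  with Suc.prems(2) show ?case by (auto intro!: mult_left_mono)
qed

lemma pd_bounded_dilation:
  assumes "ck k f UNIV" "pd_bounded k 1 C f UNIV" "s > 0"
  shows "pd_bounded k s C (\<lambda>x. f ((1 / s) *\<^sub>R x + b)) UNIV"
  using assms(1,2)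
proof (induction k arbitrary: f C)
  case (Suc k)
  note * = ck_SucE [OF Suc.prems(1)]
  have "pd_bounded k s C (\<lambda>x. pd j f ((1 / s) *\<^sub>R x + b)) UNIV" for j
    by (rule Suc.IH [OF *(2)]) (use Suc.prems(2) in simp)
  then have "pd_bounded k s (\<bar>1 / s\<bar> * C) (\<lambda>x. (1 / s) *\<^sub>R pd j f ((1 / s) *\<^sub>R x + b)) UNIV" for j
    by (intro pd_bounded_cmult ck_affine *) auto
  moreover have "pd j (\<lambda>x. f ((1 / s) *\<^sub>R x + b)) = (\<lambda>x. (1 / s) *\<^sub>R pd j f ((1 / s) *\<^sub>R x + b))" for j
    by (intro ext has_pd_imp_pd has_pd_affine *(1)) simp
  ultimately show ?case using Suc.prems(2) assms(3) by simp
qed simp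

lemma pd_eq_0_outside:
  fixes f :: "real ^ 'm \<Rightarrow> 'b::real_normed_vector"
  assumes "closed K" "\<And>x. x \<notin> K \<Longrightarrow> f x = 0" "x \<notin> K"
  shows "pd j f x = 0"
proof -
  have "pd j f x = pd j (\<lambda>_. 0) x"
    by (rule pd_cong_open [of "- K"]) (use assms in auto)
  then show ?thesis by (simp add: pd_const)
qed

lemma bounded_if_compact_support:
  fixes f :: "'a::metric_space \<Rightarrow> 'b::real_normed_vector"
  assumes "compact K" "\<And>x. x \<notin> K \<Longrightarrow> f x = 0" "continuous_on K f"
  obtains C where "C > 0" "\<And>x. norm (f x) \<le> C"
proof -
  from compact_continuous_image [OF assms(3,1)] have "bounded (f ` K)" by (rule compact_imp_bounded)
  then obtain C where C: "C > 0" "\<And>x. x \<in> K \<Longrightarrow> norm (f x) \<le> C" by (auto simp: bounded_pos)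
  have "norm (f x) \<le> C" for x by (cases "x \<in> K") (use C assms(2) in auto)
  with C that show ?thesis by blast
qed

lemma pd_bounded_compact_support:
  assumes "ck k f UNIV" "compact K" "\<And>x. x \<notin> K \<Longrightarrow> f x = 0"
  shows "\<exists>C>0. pd_bounded k 1 C f UNIV"
  using assms(1,3)
proof (induction k arbitrary: f)
  case 0
  then show ?case
    using bounded_if_compact_support [OF assms(2), of f] continuous_on_subset [of UNIV f K]
    by (metis UNIV_I pd_bounded.simps(1) ck.simps(1) top_greatest)
next
  case (Suc k)
  note * = ck_SucE [OF Suc.prems(1)]
  from *(4) have cont: "continuous_on K f" by (rule continuous_on_subset) auto
  obtain C where C: "C > 0" "\<And>x. norm (f x) \<le> C"
    using bounded_if_compact_support [OF assms(2) Suc.prems(2) cont] by metis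
  have "\<forall>j. \<exists>C>0. pd_bounded k 1 C (pd j f) UNIV"
    by (intro allI Suc.IH [OF *(2)] pd_eq_0_outside [OF compact_imp_closed [OF assms(2)] Suc.prems(2)])
  then obtain D where D: "\<And>j. D j > 0" "\<And>j. pd_bounded k 1 (D j) (pd j f) UNIV" by metis
  define E where "E = C + (\<Sum>j\<in>UNIV. D j)"
  have "D j \<le> (\<Sum>j\<in>UNIV. D j)" for j using D(1) by (intro member_le_sum) (auto intro: less_imp_le)
  then have "D j \<le> E" for j using C(1) by (auto simp: E_def intro: add_increasing)
  then have "pd_bounded k 1 E (pd j f) UNIV" for j using pd_bounded_mono [OF D(2)] D(1) by (simp add: less_imp_le)
  moreover have "C \<le> E" using D(1) sum_nonneg [of UNIV D] by (simp add: E_def less_imp_le)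
  ultimately show ?case using C by (intro exI [of _ E]) (auto intro: order_trans)
qed

subsection \<open>Mean value estimates\<close>

lemma norm_diff_le_vector_derivative:
  fixes \<gamma> :: "real \<Rightarrow> 'b::real_normed_vector"
  assumes "\<And>t. t \<in> closed_segment 0 \<tau> \<Longrightarrow> (\<gamma> has_vector_derivative \<gamma>' t) (at t)"
    and "\<And>t. t \<in> closed_segment 0 \<tau> \<Longrightarrow> norm (\<gamma>' t) \<le> B"
  shows "norm (\<gamma> \<tau> - \<gamma> 0) \<le> B * \<bar>\<tau>\<bar>"
proof -
  have "norm (\<gamma> \<tau> - \<gamma> 0) \<le> B * norm (\<tau> - 0)"
  proof (rule differentiable_bound [where S = "closed_segment 0 \<tau>" and f' = "\<lambda>t h. h *\<^sub>R \<gamma>' t"])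
    fix t assume t: "t \<in> closed_segment 0 \<tau>"
    show "(\<gamma> has_derivative (\<lambda>h. h *\<^sub>R \<gamma>' t)) (at t within closed_segment 0 \<tau>)"
      using assms(1) [OF t] by (auto simp: has_vector_derivative_def intro: has_derivative_at_withinI)
    show "onorm (\<lambda>h. h *\<^sub>R \<gamma>' t) \<le> B"
      using assms(2) [OF t] by (intro onorm_le) (simp add: mult.commute [of B] mult_left_mono)
  qed auto
  then show ?thesis by simp
qed

lemma has_vector_derivative_along_axis:
  assumes "has_pd f D j (x + t *\<^sub>R axis j 1)"
  shows "((\<lambda>t. f (x + t *\<^sub>R axis j 1)) has_vector_derivative D) (at t)"
proof -
  have "((\<lambda>u. f ((x + t *\<^sub>R axis j 1) + u *\<^sub>R axis j 1)) \<circ> (\<lambda>u. u - t) has_vector_derivative 1 *\<^sub>R D) (at t)"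
    by (rule vector_diff_chain_at)
       (use assms in \<open>auto simp: has_pd_def intro!: derivative_eq_intros\<close>)
  moreover have "(\<lambda>u. f ((x + t *\<^sub>R axis j 1) + u *\<^sub>R axis j 1)) \<circ> (\<lambda>u. u - t) = (\<lambda>u. f (x + u *\<^sub>R axis j 1))"
    by (auto simp: o_def algebra_simps)
  ultimately show ?thesis by simp
qed

text \<open>
  The centre of a ball is joined to \<open>x\<close> by a path that changes one coordinate at a time. Its points
  are no farther from the centre than \<open>x\<close>, so partial derivatives suffice.
\<close>

lemma norm_diff_le_partial_derivs:
  fixes f :: "real ^ 'm \<Rightarrow> 'b::real_normed_vector"
  assumes d: "\<And>j y. y \<in> ball q \<rho> \<Longrightarrow> has_pd f (f' j y) j y"
    and b: "\<And>j y. y \<in> ball q \<rho> \<Longrightarrow> norm (f' j y) \<le> B"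
    and x: "x \<in> ball q \<rho>"
  shows "norm (f x - f q) \<le> real CARD('m) * \<rho> * B"
proof -
  define y where "y I = (\<chi> i. if i \<in> I then x $ i else q $ i)" for I :: "'m set"
  have B: "B \<ge> 0" using b [OF x] norm_ge_zero order_trans by blast
  have "norm (f (y I) - f q) \<le> real (card I) * \<rho> * B" for I
  proof (induction I rule: infinite_finite_induct)
    case (insert j I)
    define \<tau> where "\<tau> = x $ j - q $ j"
    have y': "y (insert j I) = y I + \<tau> *\<^sub>R axis j 1"
      using insert by (auto simp: y_def \<tau>_def axis_def vec_eq_iff)
    have in_ball: "y I + t *\<^sub>R axis j 1 \<in> ball q \<rho>" if "t \<in> closed_segment 0 \<tau>" for t
    proof -
      have "\<bar>t\<bar> \<le> \<bar>x $ j - q $ j\<bar>"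
        using that by (auto simp: closed_segment_eq_real_ivl \<tau>_def split: if_splits)
      then have "norm (y I + t *\<^sub>R axis j 1 - q) \<le> norm (x - q)"
        using insert by (intro norm_le_componentwise_cart) (auto simp: y_def axis_def)
      then show ?thesis using x by (auto simp: dist_norm norm_minus_commute)
    qed
    have "norm (f (y I + \<tau> *\<^sub>R axis j 1) - f (y I + 0 *\<^sub>R axis j 1)) \<le> B * \<bar>\<tau>\<bar>"
      by (rule norm_diff_le_vector_derivative [of \<tau> "\<lambda>t. f (y I + t *\<^sub>R axis j 1)"])
         (use in_ball b in \<open>auto intro!: has_vector_derivative_along_axis d\<close>)
    moreover have "\<bar>\<tau>\<bar> \<le> \<rho>"
      using component_le_norm_cart [of "x - q" j] x by (auto simp: \<tau>_def dist_norm norm_minus_commute)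
    then have "B * \<bar>\<tau>\<bar> \<le> B * \<rho>" using B by (rule mult_left_mono)
    ultimately have "norm (f (y (insert j I)) - f (y I)) \<le> B * \<rho>" by (simp add: y')
    then have "norm ((f (y (insert j I)) - f (y I)) + (f (y I) - f q)) \<le> B * \<rho> + real (card I) * \<rho> * B"
      using insert.IH by (rule norm_triangle_mono)
    then show ?case using insert by (simp add: algebra_simps)
  qed (simp_all add: y_def)
  from this [of UNIV] show ?thesis by (simp add: y_def)
qed

subsection \<open>Words of partial derivatives\<close>

text \<open>
  Words rather than multi-indices, because an iterated Cauchy-Riemann operator is a sum over words whose
  coefficients do not commute.
\<close>

primrec pd_word :: "'m::finite list \<Rightarrow> (real ^ 'm \<Rightarrow> 'b::real_normed_vector) \<Rightarrow> real ^ 'm \<Rightarrow> 'b" where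
  "pd_word [] f = f"
| "pd_word (r # rs) f = pd r (pd_word rs f)"

lemma pd_word_snoc: "pd_word (rs @ [r]) f = pd_word rs (pd r f)"
  by (induction rs) auto

lemma ck_pd_word: "ck (k + length rs) f U \<Longrightarrow> ck k (pd_word rs f) U"
proof (induction rs arbitrary: k)
  case (Cons r rs)
  then have "ck (Suc k) (pd_word rs f) U" using Cons.IH [of "Suc k"] by simp
  then show ?case using ck_SucE(2) by simp
qed simp

lemma pd_word_diff:
  assumes "open U" "ck (length rs) f U" "ck (length rs) g U" "x \<in> U"
  shows "pd_word rs (\<lambda>x. f x - g x) x = pd_word rs f x - pd_word rs g x"
  using assms(2-)
proof (induction rs arbitrary: x)
  case (Cons r rs)
  have c: "ck 1 (pd_word rs f) U" "ck 1 (pd_word rs g) U"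
    using Cons.prems(1,2) by (simp_all del: ck.simps add: ck_pd_word)
  have c': "ck (length rs) f U" "ck (length rs) g U"
    by (rule ck_mono [OF Cons.prems(1)], simp) (rule ck_mono [OF Cons.prems(2)], simp)
  have "pd r (pd_word rs (\<lambda>x. f x - g x)) x = pd r (\<lambda>x. pd_word rs f x - pd_word rs g x) x"
    by (rule pd_cong_open [OF assms(1) Cons.prems(3) Cons.IH [OF c']])
  also have "\<dots> = pd r (pd_word rs f) x - pd r (pd_word rs g) x"
    using c Cons.prems(3) by (intro has_pd_imp_pd has_pd_diff) auto
  finally show ?case by simp
qed simp

lemma pd_bounded_pd_word:
  assumes "pd_bounded k s C f U" "length rs \<le> k" "x \<in> U"
  shows "norm (pd_word rs f x) \<le> C / s ^ length rs"
  using assms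
proof (induction rs arbitrary: f k C rule: rev_induct)
  case Nil
  then show ?case using pd_bounded_imp_norm_le by fastforce
next
  case (snoc r rs)
  then obtain l where l: "k = Suc l" by (cases k) auto
  have "norm (pd_word rs (pd r f) x) \<le> (C / s) / s ^ length rs"
    using snoc.prems by (intro snoc.IH [of l]) (auto simp: l)
  then show ?case by (simp add: pd_word_snoc mult.commute)
qed

section \<open>Taylor polynomials of Whitney jets\<close>

definition taylor ::
  "nat \<Rightarrow> ('n::finite multiindex \<Rightarrow> 'n point \<Rightarrow> 'b::real_normed_vector) \<Rightarrow> 'n point \<Rightarrow> 'n point \<Rightarrow> 'b" where
  "taylor m f p x = (\<Sum>l | mi_abs l \<le> m. (mi_power (x - p) l / mi_fact l) *\<^sub>R f l p)"

text \<open>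
  The jet of the derivative: differentiating a Taylor polynomial amounts to shifting its jet.
\<close>

definition mi_shift :: "'n multiindex \<Rightarrow> ('n multiindex \<Rightarrow> 'c) \<Rightarrow> 'n multiindex \<Rightarrow> 'c" where
  "mi_shift j f = (\<lambda>l. f (mi_plus j l))"

abbreviation mi_unit :: "'n option \<Rightarrow> 'n multiindex" where
  "mi_unit r \<equiv> mi_of_list [r]"

lemma mi_unit_apply: "mi_unit r s = (if s = r then 1 else 0)"
  by (simp add: mi_of_list_def)

lemma mi_of_list_Nil: "mi_of_list [] = (\<lambda>_. 0)"
  by (simp add: mi_of_list_def)

lemma mi_of_list_Cons: "mi_of_list (r # rs) = mi_plus (mi_unit r) (mi_of_list rs)"
  by (auto simp: mi_of_list_def mi_plus_def)

lemma mi_plus_assoc: "mi_plus (mi_plus a b) c = mi_plus a (mi_plus b c)"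
  by (simp add: mi_plus_def add.assoc)

lemma mi_plus_commute: "mi_plus a b = mi_plus b a"
  by (simp add: mi_plus_def add.commute)

lemma mi_shift_shift: "mi_shift a (mi_shift b f) = mi_shift (mi_plus b a) f"
  by (simp add: mi_shift_def mi_plus_assoc)

lemma mi_shift_0: "mi_shift (\<lambda>_. 0) f = f"
  by (simp add: mi_shift_def mi_plus_def)

lemma mi_abs_plus: "mi_abs (mi_plus a b) = mi_abs a + mi_abs b"
  by (simp add: mi_abs_def mi_plus_def sum.distrib)

lemma mi_abs_unit: "mi_abs (mi_unit r) = 1"
  by (simp add: mi_abs_def mi_unit_apply)

lemma mi_abs_of_list: "mi_abs (mi_of_list rs) = length rs"
proof (induction rs)
  case Nil
  then show ?case by (simp add: mi_of_list_Nil mi_abs_def)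
next
  case (Cons r rs)
  then show ?case by (subst mi_of_list_Cons) (simp add: mi_abs_plus mi_abs_unit)
qed

lemma mi_abs_eq_0: "mi_abs l = 0 \<longleftrightarrow> l = (\<lambda>_. 0)"
  by (auto simp: mi_abs_def)

lemma finite_mi_le: "finite {l :: 'n::finite multiindex. mi_abs l \<le> m}"
  using finite_mi_abs_le [of "\<lambda>_. 0" m] by (simp add: mi_plus_def)

lemma mi_fact_ge_1: "mi_fact l \<ge> 1"
  unfolding mi_fact_def by (rule prod_ge_1) (rule fact_ge_1)

lemma abs_mi_power_le: "\<bar>mi_power v l\<bar> \<le> norm v ^ mi_abs l"
proof -
  have "\<bar>mi_power v l\<bar> = (\<Prod>r\<in>UNIV. \<bar>v $ r\<bar> ^ l r)"
    by (simp add: mi_power_def abs_prod power_abs)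
  also have "\<dots> \<le> (\<Prod>r\<in>UNIV. norm v ^ l r)"
    by (intro prod_mono conjI power_mono component_le_norm_cart) auto
  also have "\<dots> = norm v ^ mi_abs l" by (simp add: mi_abs_def power_sum)
  finally show ?thesis .
qed

lemma taylor_0: "taylor 0 f p x = f (\<lambda>_. 0) p"
  by (simp add: taylor_def mi_abs_eq_0 mi_power_def mi_fact_def)

lemma taylor_center:
  fixes f :: "'n::finite multiindex \<Rightarrow> 'n point \<Rightarrow> 'b::real_normed_vector"
  shows "taylor m f p p = f (\<lambda>_. 0) p"
proof -
  have "taylor m f p p = (\<Sum>l :: 'n multiindex | mi_abs l \<le> m. if l = (\<lambda>_. 0) then f (\<lambda>_. 0) p else 0)"
    unfolding taylor_def
  proof (rule sum.cong [OF refl])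
    fix l :: "'n multiindex"
    have "mi_power (p - p) l = 0" if "l \<noteq> (\<lambda>_. 0)"
      using that by (auto simp: mi_power_def zero_power)
    then show "(mi_power (p - p) l / mi_fact l) *\<^sub>R f l p = (if l = (\<lambda>_. 0) then f (\<lambda>_. 0) p else 0)"
      by (auto simp: mi_power_def mi_fact_def)
  qed
  also have "\<dots> = f (\<lambda>_. 0) p"
  proof -
    have "mi_abs ((\<lambda>_. 0) :: 'n multiindex) = 0" by (simp add: mi_abs_def)
    then show ?thesis by (simp add: sum.delta finite_mi_le)
  qed
  finally show ?thesis .
qed

subsection \<open>Derivatives\<close>

lemma has_pd_mi_power:
  "has_pd (\<lambda>x. mi_power (x - p) (mi_plus (mi_unit r) l) / mi_fact (mi_plus (mi_unit r) l))
     (mi_power (x - p) l / mi_fact l) r x"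
proof -
  define C where "C = (\<Prod>s\<in>UNIV - {r}. (x - p) $ s ^ l s)"
  define F where "F = (\<Prod>s\<in>UNIV - {r}. fact (l s) :: real)"
  have F: "F \<noteq> 0" by (simp add: F_def)
  have pow: "mi_power (x + t *\<^sub>R axis r 1 - p) (mi_plus (mi_unit r) l) = ((x - p) $ r + t) ^ Suc (l r) * C" for t
    unfolding mi_power_def C_def
    by (subst prod.remove [of _ r]) (auto simp: mi_plus_def mi_unit_apply axis_def add_ac add_diff_eq intro!: prod.cong arg_cong2 [where f = "(*)"])
  have pow': "mi_power (x - p) l = (x - p) $ r ^ l r * C"
    unfolding mi_power_def C_def by (subst prod.remove [of _ r]) auto
  have fact': "mi_fact (mi_plus (mi_unit r) l) = fact (Suc (l r)) * F" "mi_fact l = fact (l r) * F"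
    unfolding mi_fact_def F_def
    by (subst prod.remove [of _ r]; auto simp: mi_plus_def mi_unit_apply intro!: prod.cong)+
  have "((\<lambda>t. ((x - p) $ r + t) ^ Suc (l r)) has_real_derivative (1 + real (l r)) * (1 * ((x - p) $ r + 0) ^ l r)) (at 0)"
    by (rule DERIV_power_Suc) (auto intro!: derivative_eq_intros)
  from DERIV_cdivide [OF DERIV_cmult_right [OF this, of C], of "fact (Suc (l r)) * F"]
  have "((\<lambda>t. ((x - p) $ r + t) ^ Suc (l r) * C / (fact (Suc (l r)) * F)) has_real_derivative
      (1 + real (l r)) * (1 * ((x - p) $ r + 0) ^ l r) * C / (fact (Suc (l r)) * F)) (at 0)" .
  moreover have "(1 + real (l r)) * (1 * ((x - p) $ r + 0) ^ l r) * C / (fact (Suc (l r)) * F)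
      = mi_power (x - p) l / mi_fact l"
  proof -
    have "fact (Suc (l r)) = (1 + real (l r)) * fact (l r)" by simp
    moreover have "1 + real (l r) \<noteq> 0" by linarith
    ultimately show ?thesis unfolding fact' pow' by (simp del: fact_Suc add: mult.assoc)
  qed
  ultimately show ?thesis
    unfolding has_pd_def pow fact' by (simp only: has_real_derivative_iff_has_vector_derivative)
qed

lemma has_pd_mi_power_0:
  assumes "l r = 0"
  shows "has_pd (\<lambda>x. mi_power (x - p) l) 0 r x"
proof -
  have "mi_power (x + t *\<^sub>R axis r 1 - p) l = mi_power (x - p) l" for t
    unfolding mi_power_def using assms by (intro prod.cong) (auto simp: axis_def)
  then show ?thesis by (simp add: has_pd_def)
qed

lemma has_pd_taylor_Suc:
  fixes f :: "'n::finite multiindex \<Rightarrow> 'n point \<Rightarrow> 'b::real_normed_vector"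
  shows
  "has_pd (taylor (Suc m) f p) (taylor m (mi_shift (mi_unit r) f) p x) r x"
proof -
  let ?u = "mi_plus (mi_unit r)"
  let ?A = "{l :: 'n multiindex. mi_abs l \<le> Suc m}"
  define D where
    "D l = (if l r = 0 then 0 else (mi_power (x - p) (\<lambda>s. l s - mi_unit r s) / mi_fact (\<lambda>s. l s - mi_unit r s)) *\<^sub>R f l p)" for l
  have u: "?u (\<lambda>s. l s - mi_unit r s) = l" if "l r \<noteq> 0" for l
    using that by (auto simp: mi_plus_def mi_unit_apply)
  have u': "(\<lambda>s. ?u l s - mi_unit r s) = l" for l
    by (auto simp: mi_plus_def)
  have u0: "?u l r \<noteq> 0" for l by (simp add: mi_plus_def mi_unit_apply)
  have "has_pd (\<lambda>x. (mi_power (x - p) l / mi_fact l) *\<^sub>R f l p) (D l) r x" for l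
  proof (cases "l r = 0")
    case True
    then show ?thesis
      using has_pd_bounded_linear [OF bounded_linear_scaleR_left [where x = "f l p"]
          has_pd_bounded_linear [OF bounded_linear_divide [of "mi_fact l"] has_pd_mi_power_0 [of l r p x]]]
      by (simp add: D_def)
  next
    case False
    then show ?thesis
      using has_pd_bounded_linear [OF bounded_linear_scaleR_left [where x = "f l p"]
          has_pd_mi_power [of p r "\<lambda>s. l s - mi_unit r s" x]]
      by (simp add: D_def u)
  qed
  then have "has_pd (\<lambda>x. \<Sum>l\<in>?A. (mi_power (x - p) l / mi_fact l) *\<^sub>R f l p) (sum D ?A) r x"
    by (rule has_pd_sum)
  moreover have "sum D ?A = sum D (?u ` {l. mi_abs l \<le> m})"
  proof (rule sum.mono_neutral_right [OF finite_mi_le])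
    show "?u ` {l. mi_abs l \<le> m} \<subseteq> ?A" by (auto simp: mi_abs_plus mi_abs_unit)
    show "\<forall>l\<in>?A - ?u ` {l. mi_abs l \<le> m}. D l = 0"
    proof
      fix l assume l: "l \<in> ?A - ?u ` {l. mi_abs l \<le> m}"
      show "D l = 0"
      proof (cases "l r = 0")
        case False
        then have "mi_abs l = Suc (mi_abs (\<lambda>s. l s - mi_unit r s))"
          using mi_abs_plus [of "mi_unit r" "\<lambda>s. l s - mi_unit r s"] by (simp add: u mi_abs_unit)
        with l False u [of l, OF False] have "l \<in> ?u ` {l. mi_abs l \<le> m}"
          by (intro image_eqI [of _ _ "\<lambda>s. l s - mi_unit r s"]) auto
        with l show ?thesis by blast
      qed (simp add: D_def)
    qed
  qed
  moreover have "inj_on ?u {l. mi_abs l \<le> m}"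
    by (rule inj_onI) (metis u')
  then have "sum D (?u ` {l. mi_abs l \<le> m}) = (\<Sum>l | mi_abs l \<le> m. D (?u l))"
    by (simp add: sum.reindex)
  moreover have "D (?u l) = (mi_power (x - p) l / mi_fact l) *\<^sub>R mi_shift (mi_unit r) f l p" for l
    using u0 [of l] by (simp add: D_def u' mi_shift_def)
  ultimately show ?thesis unfolding taylor_def [abs_def] by simp
qed

lemma pd_taylor_Suc: "pd r (taylor (Suc m) f p) = taylor m (mi_shift (mi_unit r) f) p"
  by (intro ext has_pd_imp_pd has_pd_taylor_Suc)

lemma pd_taylor_0: "pd r (taylor 0 f p) = (\<lambda>_. 0)"
  using pd_const [of r "f (\<lambda>_. 0) p"] by (simp add: taylor_0 [abs_def])

lemma ck_taylor: "ck k (taylor m f p) UNIV"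
  unfolding taylor_def [abs_def] mi_power_def divide_inverse vector_minus_component
  by (intro ck_sum ck_scaleR ck_mult ck_prod ck_power ck_diff ck_coord ck_const open_UNIV)

lemma pd_word_taylor:
  assumes "length rs \<le> m"
  shows "pd_word rs (taylor m f p) = taylor (m - length rs) (mi_shift (mi_of_list rs) f) p"
  using assms
proof (induction rs)
  case Nil
  then show ?case by (simp add: mi_of_list_Nil mi_shift_0)
next
  case (Cons r rs)
  then have m: "m - length rs = Suc (m - length (r # rs))" by simp
  have "pd_word (r # rs) (taylor m f p) = pd r (taylor (m - length rs) (mi_shift (mi_of_list rs) f) p)"
    using Cons by simp
  also have "\<dots> = taylor (m - length (r # rs)) (mi_shift (mi_of_list (r # rs)) f) p"
    unfolding m pd_taylor_Suc mi_shift_shift mi_of_list_Cons [of r rs] by (simp only: mi_plus_commute)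
  finally show ?case .
qed

lemma pd_word_taylor_top: "pd_word rs (taylor m f p) = (\<lambda>_. 0)" if "length rs = Suc m"
proof -
  from that obtain r rs' where rs: "rs = r # rs'" "length rs' = m" by (cases rs) auto
  then show ?thesis by (simp add: pd_word_taylor pd_taylor_0)
qed

subsection \<open>Estimates\<close>

lemma norm_taylor_diff_center_le:
  fixes f :: "'n::finite multiindex \<Rightarrow> 'n point \<Rightarrow> 'b::real_normed_vector"
  assumes "\<And>l. mi_abs l \<le> m \<Longrightarrow> norm (f l p) \<le> M" "norm (x - p) \<le> 1"
  shows "norm (taylor m f p x - f (\<lambda>_. 0) p) \<le> real (card {l :: 'n multiindex. mi_abs l \<le> m}) * M * norm (x - p)"
    (is "norm (taylor m f p x - _) \<le> real (card ?A) * M * _")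
proof -
  have "taylor m f p x - taylor m f p p =
      (\<Sum>l\<in>?A. ((mi_power (x - p) l - mi_power 0 l) / mi_fact l) *\<^sub>R f l p)"
    by (simp add: taylor_def sum_subtractf [symmetric] scaleR_left_diff_distrib diff_divide_distrib)
  moreover have "norm (((mi_power (x - p) l - mi_power 0 l) / mi_fact l) *\<^sub>R f l p) \<le> M * norm (x - p)"
    if "mi_abs l \<le> m" for l
  proof -
    have "\<bar>mi_power (x - p) l - mi_power 0 l\<bar> \<le> norm (x - p)"
    proof (cases "l = (\<lambda>_. 0)")
      case False
      then have "mi_power 0 l = 0" by (auto simp: mi_power_def zero_power)
      moreover from False have "norm (x - p) ^ mi_abs l \<le> norm (x - p) ^ 1"
        using assms(2) mi_abs_eq_0 [of l] by (intro power_decreasing) auto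
      ultimately show ?thesis using abs_mi_power_le [of "x - p" l] by simp
    qed (simp add: mi_power_def)
    moreover have "\<bar>mi_power (x - p) l - mi_power 0 l\<bar> / mi_fact l \<le> \<bar>mi_power (x - p) l - mi_power 0 l\<bar>"
      using mi_fact_ge_1 [of l] by (simp add: divide_le_eq mult_le_cancel_left1 abs_ge_zero)
    ultimately have "\<bar>(mi_power (x - p) l - mi_power 0 l) / mi_fact l\<bar> \<le> norm (x - p)"
      using mi_fact_ge_1 [of l] by simp
    then have "\<bar>(mi_power (x - p) l - mi_power 0 l) / mi_fact l\<bar> * norm (f l p) \<le> norm (x - p) * M"
      using assms(1) [OF that] by (intro mult_mono) auto
    then show ?thesis by (simp add: mult.commute)
  qed
  ultimately have "norm (taylor m f p x - taylor m f p p) \<le> (\<Sum>l\<in>?A. M * norm (x - p))"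
    by (simp only:) (rule sum_norm_le, simp)
  then show ?thesis by (simp add: taylor_center)
qed

text \<open>
  A partial derivative of the difference of two Taylor polynomials is the difference for the shifted
  jet, one order lower, and the value of the difference at \<open>q\<close> is the remainder. So induction on the
  order works, with one mean value estimate per step in a ball of radius comparable to the scale \<open>s\<close>.
\<close>

lemma pd_bounded_taylor_diff:
  fixes L \<nu> :: real
  assumes L: "L > 0"
  shows "\<exists>C>0. \<forall>(f :: 'n::finite multiindex \<Rightarrow> 'n point \<Rightarrow> 'b::real_normed_vector) p q s A K. s > 0 \<longrightarrow> A \<ge> 0 \<longrightarrow>
    (\<forall>l. mi_abs l \<le> m \<longrightarrow> norm (f l q - taylor (m - mi_abs l) (mi_shift l f) p q)
        \<le> A * s powr (real m + \<nu> - real (mi_abs l))) \<longrightarrow>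
    pd_bounded K s (C * A * s powr (real m + \<nu>)) (\<lambda>x. taylor m f q x - taylor m f p x) (ball q (L * s))"
proof (induction m)
  case 0
  show ?case
  proof (intro exI [of _ 1] conjI allI impI)
    fix f :: "'n multiindex \<Rightarrow> 'n point \<Rightarrow> 'b" and p q and s A :: real and K
    assume "s > 0" "0 \<le> A" and *: "\<forall>l. mi_abs l \<le> 0 \<longrightarrow> norm (f l q - taylor (0 - mi_abs l) (mi_shift l f) p q)
        \<le> A * s powr (real 0 + \<nu> - real (mi_abs l))"
    from *[rule_format, of "\<lambda>_. 0"] have "norm (f (\<lambda>_. 0) q - f (\<lambda>_. 0) p) \<le> A * s powr \<nu>"
      by (simp add: taylor_0 mi_shift_0 mi_abs_def)
    then show "pd_bounded K s (1 * A * s powr (real 0 + \<nu>)) (\<lambda>x. taylor 0 f q x - taylor 0 f p x) (ball q (L * s))"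
      using \<open>s > 0\<close> unfolding taylor_0
      by (intro pd_bounded_mono [OF pd_bounded_const]) auto
  qed auto
next
  case (Suc m)
  let ?N = "real CARD('n option)"
  from Suc.IH obtain C where C: "C > 0" and IH: "\<And>(f :: 'n multiindex \<Rightarrow> 'n point \<Rightarrow> 'b) p q s A K. s > 0 \<Longrightarrow> A \<ge> 0 \<Longrightarrow>
    (\<And>l. mi_abs l \<le> m \<Longrightarrow> norm (f l q - taylor (m - mi_abs l) (mi_shift l f) p q)
        \<le> A * s powr (real m + \<nu> - real (mi_abs l))) \<Longrightarrow>
    pd_bounded K s (C * A * s powr (real m + \<nu>)) (\<lambda>x. taylor m f q x - taylor m f p x) (ball q (L * s))"
    by auto
  show ?case
  proof (intro exI [of _ "1 + ?N * L * C + C"] conjI allI impI)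
    show "0 < 1 + ?N * L * C + C" using C L by (simp add: add_pos_pos)
    fix f :: "'n multiindex \<Rightarrow> 'n point \<Rightarrow> 'b" and p q and s A :: real and K
    assume s: "s > 0" and A: "0 \<le> A" and rem: "\<forall>l. mi_abs l \<le> Suc m \<longrightarrow> norm (f l q - taylor (Suc m - mi_abs l) (mi_shift l f) p q)
        \<le> A * s powr (real (Suc m) + \<nu> - real (mi_abs l))"
    let ?g = "\<lambda>x. taylor (Suc m) f q x - taylor (Suc m) f p x"
    let ?g' = "\<lambda>r x. taylor m (mi_shift (mi_unit r) f) q x - taylor m (mi_shift (mi_unit r) f) p x"
    define B where "B = A * s powr (real m + \<nu>)"
    have B: "B \<ge> 0" using A by (simp add: B_def)
    have g': "has_pd ?g (?g' r x) r x" for r x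
      by (intro has_pd_diff has_pd_taylor_Suc)
    have pd_g: "pd r ?g = ?g' r" for r
      using g' has_pd_imp_pd by blast
    have pd_bounded_g': "pd_bounded K s (C * B) (?g' r) (ball q (L * s))" for r K
    proof -
      have "norm (mi_shift (mi_unit r) f l q - taylor (m - mi_abs l) (mi_shift l (mi_shift (mi_unit r) f)) p q)
          \<le> A * s powr (real m + \<nu> - real (mi_abs l))" if "mi_abs l \<le> m" for l
        using rem [rule_format, of "mi_plus (mi_unit r) l"] that
        by (simp only: mi_shift_shift) (simp add: mi_shift_def mi_abs_plus mi_abs_unit add_diff_eq)
      from IH [OF s A this] show ?thesis by (simp add: B_def mult.assoc)
    qed
    have powr_s: "A * s powr (real (Suc m) + \<nu>) = B * s"
    proof -
      have "s powr (real (Suc m) + \<nu>) = s powr (1 + (real m + \<nu>))" by (simp add: add_ac)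
      also have "\<dots> = s * s powr (real m + \<nu>)" using s by (simp add: powr_add)
      finally show ?thesis by (simp add: B_def)
    qed
    have val: "norm (?g x) \<le> (1 + ?N * L * C + C) * (B * s)" if "x \<in> ball q (L * s)" for x
    proof -
      have "norm (?g x - ?g q) \<le> ?N * (L * s) * (C * B)"
        using pd_bounded_imp_norm_le [OF pd_bounded_g'] by (intro norm_diff_le_partial_derivs [OF g' _ that])
      moreover have "norm (?g q) \<le> B * s"
        using rem [rule_format, of "\<lambda>_. 0"] by (simp add: mi_shift_0 mi_abs_def taylor_center powr_s [symmetric])
      ultimately have "norm (?g x) \<le> B * s + ?N * (L * s) * (C * B)"
        using norm_triangle_ineq [of "?g x - ?g q" "?g q"] by simp
      also have "\<dots> \<le> (1 + ?N * L * C + C) * (B * s)"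
        using B C s by (simp add: algebra_simps)
      finally show ?thesis .
    qed
    have "pd_bounded K s ((1 + ?N * L * C + C) * (B * s)) ?g (ball q (L * s))"
    proof (cases K)
      case 0
      then show ?thesis using val by simp
    next
      case (Suc K')
      have "C * B \<le> (1 + ?N * L * C + C) * B"
        using C L B by (intro mult_right_mono) auto
      then have "pd_bounded K' s ((1 + ?N * L * C + C) * (B * s) / s) (pd r ?g) (ball q (L * s))" for r
        unfolding pd_g using s B C by (intro pd_bounded_mono [OF pd_bounded_g']) auto
      then show ?thesis using val Suc by simp
    qed
    then show "pd_bounded K s ((1 + ?N * L * C + C) * A * s powr (real (Suc m) + \<nu>)) ?g (ball q (L * s))"
      by (simp only: powr_s mult.assoc)
  qed
qed

subsection \<open>Lipschitz data\<close>

text \<open>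
  The membership in \<^const>\<open>Lip\<close> with the constant exposed and the components put together: the
  remainder is the difference of a jet entry and the Taylor polynomial of the shifted jet.
\<close>

definition whitney_jet ::
  "'n::finite point set \<Rightarrow> nat \<Rightarrow> real \<Rightarrow> real \<Rightarrow> ('n multiindex \<Rightarrow> 'n point \<Rightarrow> 'b::real_normed_vector) \<Rightarrow> bool" where
  "whitney_jet S m \<nu> M f \<longleftrightarrow> (\<forall>j. mi_abs j \<le> m \<longrightarrow>
     (\<forall>x\<in>S. norm (f j x) \<le> M) \<and>
     (\<forall>x\<in>S. \<forall>y\<in>S. norm (f j x - taylor (m - mi_abs j) (mi_shift j f) y x)
        \<le> M * norm (x - y) powr (real m + \<nu> - real (mi_abs j))))"

lemma clifford_Lip_imp_whitney_jet:
  fixes f :: "'n::{finite,linorder} multiindex \<Rightarrow> 'n point \<Rightarrow> 'n clifford"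
  assumes "f \<in> clifford_Lip S m \<nu>"
  obtains M where "M > 0" "whitney_jet S m \<nu> M f"
proof -
  have "\<forall>A. \<exists>M>0. \<forall>j. mi_abs j \<le> m \<longrightarrow>
     (\<forall>x\<in>S. \<bar>f j x $ A\<bar> \<le> M) \<and>
     (\<forall>x\<in>S. \<forall>y\<in>S. \<bar>taylor_remainder m (\<lambda>j x. f j x $ A) j x y\<bar> \<le> M * norm (x - y) powr (real m + \<nu> - real (mi_abs j)))"
    using assms by (simp add: clifford_Lip_def Lip_def)
  then obtain M where M: "\<And>A. M A > 0" "\<And>A j x. mi_abs j \<le> m \<Longrightarrow> x \<in> S \<Longrightarrow> \<bar>f j x $ A\<bar> \<le> M A"
    "\<And>A j x y. mi_abs j \<le> m \<Longrightarrow> x \<in> S \<Longrightarrow> y \<in> S \<Longrightarrow>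
      \<bar>taylor_remainder m (\<lambda>j x. f j x $ A) j x y\<bar> \<le> M A * norm (x - y) powr (real m + \<nu> - real (mi_abs j))"
    by metis
  have rem: "taylor_remainder m (\<lambda>j x. f j x $ A) j x y = (f j x - taylor (m - mi_abs j) (mi_shift j f) y x) $ A"
    if "mi_abs j \<le> m" for A x y and j :: "'n multiindex"
  proof -
    have "{l. mi_abs (mi_plus j l) \<le> m} = {l. mi_abs l \<le> m - mi_abs j}"
      using that by (auto simp: mi_abs_plus)
    then show ?thesis
      by (simp add: taylor_remainder_def taylor_def mi_shift_def sum_component mult.commute)
  qed
  show ?thesis
  proof
    show "(\<Sum>A\<in>UNIV. M A) > 0" by (intro sum_pos M) auto
    show "whitney_jet S m \<nu> (\<Sum>A\<in>UNIV. M A) f"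
      unfolding whitney_jet_def
    proof (intro allI impI conjI ballI)
      fix j :: "'n multiindex" and x assume jx: "mi_abs j \<le> m" "x \<in> S"
      show "norm (f j x) \<le> (\<Sum>A\<in>UNIV. M A)"
        by (rule order_trans [OF norm_le_l1_cart]) (intro sum_mono M jx)
      fix y assume "y \<in> S"
      with jx show "norm (f j x - taylor (m - mi_abs j) (mi_shift j f) y x)
        \<le> (\<Sum>A\<in>UNIV. M A) * norm (x - y) powr (real m + \<nu> - real (mi_abs j))"
        unfolding sum_distrib_right
        by (intro order_trans [OF norm_le_l1_cart] sum_mono) (metis rem M(3))
    qed
  qed
qed

section \<open>Whitney extension\<close>

subsection \<open>A partition of unity indexed by the integer lattice\<close>

text \<open>
  Differences of translates of a step telescope, so the integer translates of \<open>bump_real\<close> add up to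
  \<open>1\<close>; products over the coordinates do the same for the lattice.
\<close>

definition lattice_point :: "('m::finite \<Rightarrow> int) \<Rightarrow> real ^ 'm" where
  "lattice_point z = (\<chi> i. real_of_int (z i))"

definition bump_real :: "nat \<Rightarrow> real \<Rightarrow> real" where
  "bump_real K t = smooth_step K (t + 1) - smooth_step K t"

definition bump :: "nat \<Rightarrow> real ^ 'm::finite \<Rightarrow> real" where
  "bump K x = (\<Prod>i\<in>UNIV. bump_real K (x $ i))"

lemma bump_real_eq_0: "\<bar>t\<bar> \<ge> 1 \<Longrightarrow> bump_real K t = 0"
  unfolding bump_real_def by (cases "t \<ge> 1") (simp_all add: smooth_step_0 smooth_step_1)

lemma bump_real_telescope:
  assumes "0 \<le> t" "t < 1"
  shows "bump_real K t + bump_real K (t - 1) = 1"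
  using assms by (simp add: bump_real_def smooth_step_0 smooth_step_1)

lemma bump_eq_0: "\<bar>x $ i\<bar> \<ge> 1 \<Longrightarrow> bump K x = 0"
  by (auto simp: bump_def intro: bump_real_eq_0)

lemma ck_bump: "ck K (bump K) UNIV"
  unfolding bump_def [abs_def] bump_real_def
  by (intro ck_prod ck_diff ck_smooth_step ck_add ck_coord ck_const open_UNIV)

lemma pd_bounded_bump: "\<exists>C>0. pd_bounded K 1 C (bump K :: real ^ 'm::finite \<Rightarrow> real) UNIV"
proof (rule pd_bounded_compact_support [OF ck_bump compact_cball])
  fix x :: "real ^ 'm" assume x: "x \<notin> cball 0 (real CARD('m))"
  have "\<exists>i. \<bar>x $ i\<bar> \<ge> 1"
  proof (rule ccontr)
    assume "\<not> ?thesis"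
    then have "(\<Sum>i\<in>UNIV. \<bar>x $ i\<bar>) \<le> (\<Sum>i\<in>(UNIV :: 'm set). 1)"
      by (intro sum_mono) (auto simp: not_le intro: less_imp_le)
    with norm_le_l1_cart [of x] x show False by simp
  qed
  then show "bump K x = 0" using bump_eq_0 by blast
qed

lemma sum_bump:
  fixes x :: "real ^ 'm::finite"
  assumes "finite Z" "\<And>z. bump K (x - lattice_point z) \<noteq> 0 \<Longrightarrow> z \<in> Z"
  shows "(\<Sum>z\<in>Z. bump K (x - lattice_point z)) = 1"
proof -
  let ?B = "\<lambda>i. {\<lfloor>x $ i\<rfloor>, \<lfloor>x $ i\<rfloor> + 1}"
  let ?P = "\<Pi>\<^sub>E i\<in>UNIV. ?B i"
  have P: "finite ?P" by (intro finite_PiE) auto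
  have off: "bump K (x - lattice_point z) = 0" if "z \<notin> ?P" for z
  proof -
    from that obtain i where "z i \<noteq> \<lfloor>x $ i\<rfloor>" "z i \<noteq> \<lfloor>x $ i\<rfloor> + 1" by auto
    then have "z i \<le> \<lfloor>x $ i\<rfloor> - 1 \<or> z i \<ge> \<lfloor>x $ i\<rfloor> + 2" by linarith
    then have "\<bar>x $ i - z i\<bar> \<ge> 1" by linarith
    then show ?thesis by (intro bump_eq_0 [of _ i]) (simp add: lattice_point_def)
  qed
  have "(\<Sum>z\<in>Z. bump K (x - lattice_point z)) = (\<Sum>z\<in>Z \<union> ?P. bump K (x - lattice_point z))"
    using assms P by (intro sum.mono_neutral_left) auto
  also have "\<dots> = (\<Sum>z\<in>?P. bump K (x - lattice_point z))"
    using assms P off by (intro sum.mono_neutral_right) auto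
  also have "\<dots> = (\<Prod>i\<in>UNIV. \<Sum>u\<in>?B i. bump_real K (x $ i - real_of_int u))"
    by (subst prod_sum_PiE) (auto simp: bump_def lattice_point_def)
  also have "\<dots> = 1"
  proof (rule prod.neutral, rule ballI)
    fix i
    show "(\<Sum>u\<in>?B i. bump_real K (x $ i - real_of_int u)) = 1"
      using bump_real_telescope [of "x $ i - \<lfloor>x $ i\<rfloor>" K] floor_correct [of "x $ i"] by (simp add: algebra_simps)
  qed
  finally show ?thesis .
qed

subsection \<open>The extension\<close>

text \<open>
  At scale \<open>2\<^sup>-\<^sup>i\<close> the lattice partition of unity patches together the Taylor polynomials at points of \<open>S\<close>
  nearest to those lattice points that lie close to \<open>S\<close>. The patched function \<open>level i\<close> is good at
  distances comparable to \<open>2\<^sup>-\<^sup>i\<close>, so \<open>approx\<close> overwrites each level by the next one closer to \<open>S\<close>,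
  where the cutoff of the next level is \<open>1\<close>. The scales replace the cubes of a Whitney decomposition.

  A weight lives within \<open>N * scale i\<close> of its lattice point, as the \<open>l\<^sup>1\<close> norm bounds the Euclidean one.
  Cells reach to \<open>2 * N * scale i\<close>, so the cutoff is \<open>1\<close> at distances below \<open>N * scale i\<close> and \<open>0\<close> beyond
  \<open>3 * N * scale i\<close>.
\<close>

locale whitney_extension =
  fixes S :: "'n::finite point set" and m :: nat and \<nu> M :: real
    and f :: "'n multiindex \<Rightarrow> 'n point \<Rightarrow> 'b::real_normed_vector" and K :: nat and N :: real
  assumes N_def: "N = real CARD('n option)"
    and compact_S: "compact S" and S_nonempty: "S \<noteq> {}"
    and jet: "whitney_jet S m \<nu> M f" and M_pos: "M > 0" and \<nu>_pos: "0 < \<nu>"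
begin

definition scale :: "nat \<Rightarrow> real" where
  "scale i = (1 / 2) ^ i"

definition cell_point :: "nat \<Rightarrow> ('n option \<Rightarrow> int) \<Rightarrow> 'n point" where
  "cell_point i z = scale i *\<^sub>R lattice_point z"

definition cells :: "nat \<Rightarrow> ('n option \<Rightarrow> int) set" where
  "cells i = {z. infdist (cell_point i z) S \<le> 2 * N * scale i}"

definition nearest :: "'n point \<Rightarrow> 'n point" where
  "nearest y = (SOME p. p \<in> S \<and> infdist y S = dist y p)"

definition weight :: "nat \<Rightarrow> ('n option \<Rightarrow> int) \<Rightarrow> 'n point \<Rightarrow> real" where
  "weight i z x = bump K ((1 / scale i) *\<^sub>R x + (- lattice_point z))"

definition cutoff :: "nat \<Rightarrow> 'n point \<Rightarrow> real" where
  "cutoff i x = (\<Sum>z\<in>cells i. weight i z x)"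

definition level :: "nat \<Rightarrow> 'n point \<Rightarrow> 'b" where
  "level i x = (\<Sum>z\<in>cells i. weight i z x *\<^sub>R taylor m f (nearest (cell_point i z)) x)"

primrec approx :: "nat \<Rightarrow> 'n point \<Rightarrow> 'b" where
  "approx 0 = level 0"
| "approx (Suc i) = (\<lambda>x. level (Suc i) x + (1 - cutoff (Suc i) x) *\<^sub>R approx i x)"

text \<open>Off \<open>S\<close> the sequence is eventually constant.\<close>

definition extension :: "'n point \<Rightarrow> 'b" where
  "extension x = lim (\<lambda>i. approx i x)"

lemma scale_pos: "scale i > 0"
  by (simp add: scale_def)

lemma scale_mono: "i \<le> j \<Longrightarrow> scale j \<le> scale i"
  unfolding scale_def by (rule power_decreasing) auto

lemma scale_le_1: "scale i \<le> 1"
  using scale_mono [of 0 i] by (simp add: scale_def)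

lemma N_ge_1: "N \<ge> 1"
  by (simp add: N_def)

lemma nearest: "nearest y \<in> S" "dist y (nearest y) = infdist y S"
proof -
  have "\<exists>p. p \<in> S \<and> infdist y S = dist y p"
    using infdist_attains_inf [OF compact_imp_closed [OF compact_S] S_nonempty, of y] by metis
  from someI_ex [OF this] show "nearest y \<in> S" "dist y (nearest y) = infdist y S"
    by (simp_all add: nearest_def)
qed

lemma finite_cells: "finite (cells i)"
proof -
  obtain R where R: "\<And>p. p \<in> S \<Longrightarrow> norm p \<le> R"
    using compact_imp_bounded [OF compact_S] by (auto simp: bounded_iff)
  define B where "B = \<lceil>(R + 2 * N * scale i) / scale i\<rceil>"
  have "cells i \<subseteq> (\<Pi>\<^sub>E r\<in>UNIV. {- B..B})"
  proof
    fix z assume z: "z \<in> cells i"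
    have "\<bar>z r\<bar> \<le> B" for r
    proof -
      have "scale i * \<bar>real_of_int (z r)\<bar> = \<bar>cell_point i z $ r\<bar>"
        using scale_pos [of i] by (simp add: cell_point_def lattice_point_def abs_mult)
      also have "\<dots> \<le> norm (cell_point i z)" by (rule component_le_norm_cart)
      also have "\<dots> \<le> norm (nearest (cell_point i z)) + dist (cell_point i z) (nearest (cell_point i z))"
        using norm_triangle_ineq2 [of "cell_point i z" "nearest (cell_point i z)"] by (simp add: dist_norm)
      also have "\<dots> \<le> R + 2 * N * scale i"
        using z R nearest by (intro add_mono) (auto simp: cells_def)
      finally have "\<bar>real_of_int (z r)\<bar> \<le> (R + 2 * N * scale i) / scale i"
        using scale_pos [of i] by (simp add: pos_le_divide_eq mult.commute)
      also have "\<dots> \<le> real_of_int B" unfolding B_def by (rule le_of_int_ceiling)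
      finally show ?thesis by linarith
    qed
    then show "z \<in> (\<Pi>\<^sub>E r\<in>UNIV. {- B..B})" by (auto simp: abs_le_iff minus_le_iff)
  qed
  then show ?thesis by (rule finite_subset) (intro finite_PiE; simp)
qed

lemma weight_support_coord:
  assumes "weight i z x \<noteq> 0"
  shows "\<bar>x $ r / scale i - real_of_int (z r)\<bar> < 1"
  using assms bump_eq_0 [of "(1 / scale i) *\<^sub>R x + (- lattice_point z)" r K]
  by (force simp: weight_def lattice_point_def)

lemma weight_support:
  assumes "weight i z x \<noteq> 0"
  shows "dist x (cell_point i z) \<le> N * scale i"
proof -
  have "norm (x - cell_point i z) \<le> (\<Sum>r\<in>UNIV. \<bar>(x - cell_point i z) $ r\<bar>)" by (rule norm_le_l1_cart)
  also have "\<dots> \<le> (\<Sum>r\<in>(UNIV :: 'n option set). scale i)"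
  proof (rule sum_mono)
    fix r
    have "x $ r - scale i * real_of_int (z r) = scale i * (x $ r / scale i - real_of_int (z r))"
      using scale_pos [of i] by (simp add: field_simps)
    then have "\<bar>(x - cell_point i z) $ r\<bar> = scale i * \<bar>x $ r / scale i - real_of_int (z r)\<bar>"
      using scale_pos [of i] by (simp add: cell_point_def lattice_point_def abs_mult)
    also have "\<dots> \<le> scale i * 1"
      using weight_support_coord [OF assms, of r] scale_pos [of i] by (intro mult_left_mono) auto
    finally show "\<bar>(x - cell_point i z) $ r\<bar> \<le> scale i" by simp
  qed
  finally show ?thesis by (simp add: dist_norm N_def)
qed

lemma weight_eq_0_far:
  assumes "infdist x S > 3 * N * scale i" "z \<in> cells i"
  shows "weight i z x = 0"
proof (rule ccontr)
  assume "weight i z x \<noteq> 0"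
  then have "dist x (cell_point i z) \<le> N * scale i" by (rule weight_support)
  moreover have "infdist (cell_point i z) S \<le> 2 * N * scale i" using assms by (simp add: cells_def)
  moreover have "infdist x S \<le> infdist (cell_point i z) S + dist x (cell_point i z)" by (rule infdist_triangle)
  ultimately show False using assms(1) by linarith
qed

lemma cutoff_eq_0: "infdist x S > 3 * N * scale i \<Longrightarrow> cutoff i x = 0"
  by (simp add: cutoff_def weight_eq_0_far)

lemma level_eq_0: "infdist x S > 3 * N * scale i \<Longrightarrow> level i x = 0"
  by (simp add: level_def weight_eq_0_far)

lemma cutoff_eq_1:
  assumes "infdist x S < N * scale i"
  shows "cutoff i x = 1"
proof -
  have "z \<in> cells i" if "bump K ((1 / scale i) *\<^sub>R x - lattice_point z) \<noteq> 0" for z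
  proof -
    have "dist x (cell_point i z) \<le> N * scale i" using that by (intro weight_support) (simp add: weight_def)
    moreover have "infdist (cell_point i z) S \<le> infdist x S + dist (cell_point i z) x" by (rule infdist_triangle)
    ultimately show ?thesis using assms by (simp add: cells_def dist_commute)
  qed
  from sum_bump [OF finite_cells this] show ?thesis by (simp add: cutoff_def weight_def)
qed

lemma ck_weight: "ck K (weight i z) UNIV"
  unfolding weight_def [abs_def] by (rule ck_affine [OF ck_bump])

lemma ck_cutoff: "ck K (cutoff i) UNIV"
  unfolding cutoff_def [abs_def] by (intro ck_sum ck_weight open_UNIV)

lemma ck_level: "ck K (level i) UNIV"
  unfolding level_def [abs_def] by (intro ck_sum ck_scaleR ck_weight ck_taylor open_UNIV)

lemma ck_approx: "ck K (approx i) UNIV"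
  by (induction i) (simp_all add: ck_level ck_add ck_scaleR ck_diff ck_const ck_cutoff)

lemma approx_stable:
  assumes "infdist x S > 3 * N * scale i" "i \<le> j"
  shows "approx j x = approx i x"
  using assms(2)
proof (induction j rule: dec_induct)
  case (step j)
  have "3 * N * scale (Suc j) \<le> 3 * N * scale i"
    using step scale_mono [of i "Suc j"] N_ge_1 by (intro mult_left_mono) auto
  with assms(1) have "infdist x S > 3 * N * scale (Suc j)" by linarith
  with step.IH show ?case by (simp add: cutoff_eq_0 level_eq_0)
qed simp

lemma extension_eq_approx:
  assumes "infdist x S > 3 * N * scale i"
  shows "extension x = approx i x"
proof -
  have "(\<lambda>j. approx j x) \<longlonglongrightarrow> approx i x"
    by (rule tendsto_eventually, rule eventually_sequentiallyI [of i], rule approx_stable [OF assms])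
  then show ?thesis unfolding extension_def by (rule limI)
qed

lemma infdist_pos: "x \<notin> S \<Longrightarrow> infdist x S > 0"
  using infdist_pos_not_in_closed [OF compact_imp_closed [OF compact_S] S_nonempty] by blast

lemma ex_scale_less: "d > 0 \<Longrightarrow> \<exists>i. C * scale i < d"
proof -
  assume d: "d > 0"
  have "(\<lambda>i. C * scale i) \<longlonglongrightarrow> C * 0"
    unfolding scale_def by (intro tendsto_mult tendsto_const LIMSEQ_power_zero) simp
  then have "\<forall>\<^sub>F i in sequentially. C * scale i < d" using d by (intro order_tendstoD(2) [of _ 0]) simp_all
  then show ?thesis by (auto simp: eventually_sequentially)
qed

lemma ck_extension: "ck K extension (- S)"
proof (rule ck_local)
  fix x assume "x \<in> - S"
  then obtain i where i: "3 * N * scale i < infdist x S" using ex_scale_less [of "infdist x S" "3 * N"] infdist_pos [of x] by auto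
  let ?V = "{y. 3 * N * scale i < infdist y S}"
  have "open ?V" by (intro open_Collect_less continuous_intros)
  moreover have "ck K extension ?V"
    using ck_cong_open [OF \<open>open ?V\<close>, of extension "approx i"] extension_eq_approx ck_subset [OF ck_approx]
    by blast
  ultimately show "\<exists>V. open V \<and> x \<in> V \<and> ck K extension V" using i by blast
qed

lemma extension_eq_0:
  assumes "infdist x S > 3 * N"
  shows "extension x = 0"
proof -
  have *: "infdist x S > 3 * N * scale i" for i
    using assms N_ge_1 mult_left_mono [OF scale_le_1 [of i], of "3 * N"] by linarith
  have "approx i x = 0" for i
    by (induction i) (simp_all add: level_eq_0 [OF *])
  with extension_eq_approx [OF *] show ?thesis by metis
qed

subsection \<open>Comparison with Taylor polynomials\<close>

lemma norm_remainder_le: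
  assumes pq: "p \<in> S" "q \<in> S" "dist q p \<le> L * s" and L: "L \<ge> 1" and s: "s > 0" and l: "mi_abs l \<le> m"
  shows "norm (f l q - taylor (m - mi_abs l) (mi_shift l f) p q)
    \<le> (M * L powr (real m + \<nu>)) * s powr (real m + \<nu> - real (mi_abs l))"
proof -
  let ?a = "real m + \<nu> - real (mi_abs l)"
  have a: "?a > 0" using l \<nu>_pos by linarith
  have "norm (f l q - taylor (m - mi_abs l) (mi_shift l f) p q) \<le> M * norm (q - p) powr ?a"
    using jet pq l by (simp add: whitney_jet_def)
  also have "norm (q - p) powr ?a \<le> (L * s) powr ?a"
    using pq a by (intro powr_mono2) (auto simp: dist_norm)
  also have "\<dots> = L powr ?a * s powr ?a" using L s by (intro powr_mult)
  also have "L powr ?a \<le> L powr (real m + \<nu>)" using L by (intro powr_mono) auto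
  finally show ?thesis using M_pos by (simp add: mult_ac mult_left_mono mult_right_mono)
qed

definition relevant :: "nat \<Rightarrow> 'n point set \<Rightarrow> ('n option \<Rightarrow> int) set" where
  "relevant j U = {z \<in> cells j. \<exists>y\<in>U. weight j z y \<noteq> 0}"

text \<open>
  On a ball no larger than the mesh only boundedly many weights are nonzero: their lattice coordinates
  are within \<open>2\<close> of those of the scaled centre.
\<close>

lemma card_relevant_le:
  assumes "U \<subseteq> ball x (scale j)"
  shows "card (relevant j U) \<le> 6 ^ CARD('n option)"
proof -
  let ?B = "\<lambda>r. {\<lfloor>x $ r / scale j\<rfloor> - 2..\<lfloor>x $ r / scale j\<rfloor> + 3}"
  have "relevant j U \<subseteq> (\<Pi>\<^sub>E r\<in>UNIV. ?B r)"
  proof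
    fix z assume "z \<in> relevant j U"
    then obtain y where y: "y \<in> U" "weight j z y \<noteq> 0" by (auto simp: relevant_def)
    have "z r \<in> ?B r" for r
    proof -
      have "\<bar>(y - x) $ r\<bar> \<le> scale j"
        using component_le_norm_cart [of "y - x" r] y assms by (force simp: dist_norm norm_minus_commute)
      then have "\<bar>y $ r / scale j - x $ r / scale j\<bar> \<le> 1"
        using scale_pos [of j] by (simp add: diff_divide_distrib [symmetric])
      with weight_support_coord [OF y(2), of r] have "\<bar>x $ r / scale j - real_of_int (z r)\<bar> < 2" by linarith
      then show ?thesis by (auto simp: abs_less_iff) linarith+
    qed
    then show "z \<in> (\<Pi>\<^sub>E r\<in>UNIV. ?B r)" by auto
  qed
  then have "card (relevant j U) \<le> card (\<Pi>\<^sub>E r\<in>UNIV. ?B r)"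
    by (rule card_mono [rotated]) (intro finite_PiE; simp)
  also have "\<dots> = 6 ^ CARD('n option)" by (subst card_PiE) auto
  finally show ?thesis .
qed

lemma pd_bounded_weighted_sum:
  assumes W: "pd_bounded K 1 W (bump K :: 'n point \<Rightarrow> real) UNIV" "W \<ge> 0"
    and U: "open U" "U \<subseteq> ball x (scale j)" and s: "0 < s" "s \<le> scale j" and D: "D \<ge> 0"
    and v: "\<And>z. z \<in> relevant j U \<Longrightarrow> ck K (v z) U" "\<And>z. z \<in> relevant j U \<Longrightarrow> pd_bounded K s D (v z) U"
  shows "pd_bounded K s (6 ^ CARD('n option) * (2 ^ K * (W * D))) (\<lambda>y. \<Sum>z\<in>cells j. weight j z y *\<^sub>R v z y) U"
proof -
  have fin: "finite (relevant j U)" unfolding relevant_def using finite_cells by simp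
  have w: "pd_bounded K s W (weight j z) U" for z
  proof -
    have b: "pd_bounded K (scale j) W (weight j z) UNIV"
      unfolding weight_def [abs_def] by (rule pd_bounded_dilation [OF ck_bump W(1) scale_pos])
    show ?thesis by (rule pd_bounded_mono [OF pd_bounded_subset [OF b subset_UNIV] order_refl s W(2)])
  qed
  have w': "ck K (weight j z) U" for z by (rule ck_subset [OF ck_weight]) simp
  have "pd_bounded K s (real (card (relevant j U)) * (2 ^ K * (W * D))) (\<lambda>y. \<Sum>z\<in>relevant j U. weight j z y *\<^sub>R v z y) U"
    by (intro pd_bounded_sum pd_bounded_scaleR ck_scaleR U s fin w w' v)
  moreover have "real (card (relevant j U)) * (2 ^ K * (W * D)) \<le> 6 ^ CARD('n option) * (2 ^ K * (W * D))"
    using card_relevant_le [OF U(2)] W(2) D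
    by (intro mult_right_mono) (auto simp flip: of_nat_le_iff [where 'a = real])
  ultimately have b: "pd_bounded K s (6 ^ CARD('n option) * (2 ^ K * (W * D))) (\<lambda>y. \<Sum>z\<in>relevant j U. weight j z y *\<^sub>R v z y) U"
    by (rule pd_bounded_mono [OF _ _ s(1) order_refl]) (use W(2) D in simp)
  have eq: "(\<Sum>z\<in>relevant j U. weight j z y *\<^sub>R v z y) = (\<Sum>z\<in>cells j. weight j z y *\<^sub>R v z y)" if "y \<in> U" for y
    using that finite_cells by (intro sum.mono_neutral_left) (auto simp: relevant_def)
  show ?thesis by (rule pd_bounded_cong_open [OF U(1) eq, THEN iffD1, OF _ b])
qed

text \<open>
  If the distance \<open>d\<close> of \<open>x\<close> from \<open>S\<close> lies between \<open>N * scale (i + 1)\<close> and \<open>N * scale i\<close>, then near \<open>x\<close>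
  level \<open>i\<close> has erased all coarser ones, and levels beyond \<open>i + 4\<close> vanish. In each of the five
  remaining levels all Taylor polynomials involved have their centres within a multiple of \<open>d\<close> of each
  other. Subtracting the polynomial at \<open>p\<close> from the recursion for \<open>approx\<close> gives a recursion for the
  differences, in which the bound deteriorates by a fixed factor per level.
\<close>

lemma pd_bounded_extension:
  "\<exists>E>0. \<forall>x p i. N * scale (Suc i) \<le> infdist x S \<longrightarrow> infdist x S < N * scale i \<longrightarrow> p \<in> S \<longrightarrow> dist x p = infdist x S \<longrightarrow>
     (\<exists>U. open U \<and> x \<in> U \<and> U \<subseteq> - S \<and>
       pd_bounded K (scale (i + 4)) (E * scale (i + 4) powr (real m + \<nu>)) (\<lambda>y. extension y - taylor m f p y) U)"
proof -
  \<comment> \<open>every centre within 49 N s of x, and p within 16 N s of x, where s = scale (i + 4)\<close>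
  define L where "L = 66 * N"
  have L: "L \<ge> 1" "L > 0" using N_ge_1 by (auto simp: L_def)
  have "\<exists>W>0. pd_bounded K 1 W (bump K :: 'n point \<Rightarrow> real) UNIV" by (rule pd_bounded_bump)
  then obtain W where W: "W > 0" "pd_bounded K 1 W (bump K :: 'n point \<Rightarrow> real) UNIV"
    by (elim exE conjE)
  have "\<exists>C>0. \<forall>(f :: 'n multiindex \<Rightarrow> 'n point \<Rightarrow> 'b) p q s A K. s > 0 \<longrightarrow> A \<ge> 0 \<longrightarrow>
    (\<forall>l. mi_abs l \<le> m \<longrightarrow> norm (f l q - taylor (m - mi_abs l) (mi_shift l f) p q)
        \<le> A * s powr (real m + \<nu> - real (mi_abs l))) \<longrightarrow>
    pd_bounded K s (C * A * s powr (real m + \<nu>)) (\<lambda>x. taylor m f q x - taylor m f p x) (ball q (L * s))"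
    by (rule pd_bounded_taylor_diff [OF L(2)])
  then obtain C where C: "C > 0" and T0: "\<forall>(f :: 'n multiindex \<Rightarrow> 'n point \<Rightarrow> 'b) p q s A K. s > 0 \<longrightarrow> A \<ge> 0 \<longrightarrow>
    (\<forall>l. mi_abs l \<le> m \<longrightarrow> norm (f l q - taylor (m - mi_abs l) (mi_shift l f) p q)
        \<le> A * s powr (real m + \<nu> - real (mi_abs l))) \<longrightarrow>
    pd_bounded K s (C * A * s powr (real m + \<nu>)) (\<lambda>x. taylor m f q x - taylor m f p x) (ball q (L * s))"
    by (elim exE conjE)
  have T: "\<And>(f :: 'n multiindex \<Rightarrow> 'n point \<Rightarrow> 'b) p q s A K. s > 0 \<Longrightarrow> A \<ge> 0 \<Longrightarrow>
    (\<And>l. mi_abs l \<le> m \<Longrightarrow> norm (f l q - taylor (m - mi_abs l) (mi_shift l f) p q)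
        \<le> A * s powr (real m + \<nu> - real (mi_abs l))) \<Longrightarrow>
    pd_bounded K s (C * A * s powr (real m + \<nu>)) (\<lambda>x. taylor m f q x - taylor m f p x) (ball q (L * s))"
    by (rule T0 [rule_format])
  define A where "A = M * L powr (real m + \<nu>)"
  define c :: real where "c = 6 ^ CARD('n option)"
  define E1 where "E1 = c * (2 ^ K * (W * (C * A)))"
  define Q where "Q = c * (2 ^ K * (W * 1))"
  define E where "E t = ((\<lambda>e. E1 + 2 ^ K * ((1 + Q) * e)) ^^ t) E1" for t :: nat
  have pos: "A > 0" "c > 0" using M_pos L by (auto simp: A_def c_def)
  then have pos': "E1 > 0" "Q > 0" using W C by (auto simp: E1_def Q_def)
  then have E_pos: "E t > 0" for t by (induction t) (auto simp: E_def intro!: add_pos_pos mult_pos_pos)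
  have "\<exists>U. open U \<and> x \<in> U \<and> U \<subseteq> - S \<and>
       pd_bounded K (scale (i + 4)) (E 4 * scale (i + 4) powr (real m + \<nu>)) (\<lambda>y. extension y - taylor m f p y) U"
    if x: "N * scale (Suc i) \<le> infdist x S" "infdist x S < N * scale i" "p \<in> S" "dist x p = infdist x S" for x p i
  proof -
    define s where "s = scale (i + 4)"
    have s: "s > 0" "scale i = 16 * s" "scale (Suc i) = 8 * s"
      by (simp_all add: s_def scale_def power_add power_divide)
    have Ns: "N * s \<ge> s" "N * s > 0" using s N_ge_1 by auto
    let ?b = "s powr (real m + \<nu>)"
    have b: "?b > 0" using s by simp
    let ?P = "taylor m f p"
    define U where "U = ball x s \<inter> {y. infdist y S < N * scale i}"
    have U: "open U" "x \<in> U"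
      using s x by (auto simp: U_def intro!: open_Int open_Collect_less continuous_intros)
    have far: "infdist y S > 3 * N * scale (i + 4)" if "y \<in> U" for y
    proof -
      have "infdist x S \<le> infdist y S + dist x y" by (rule infdist_triangle)
      moreover have "dist x y < s" using that by (simp add: U_def)
      moreover have "8 * (N * s) \<le> infdist x S" using x(1) s by simp
      ultimately have "3 * (N * s) < infdist y S" using Ns by linarith
      then show ?thesis by (simp add: s_def mult.assoc)
    qed
    have US: "U \<subseteq> - S"
    proof
      fix y assume "y \<in> U"
      from far [OF this] have "infdist y S > 0" using scale_pos [of "i + 4"] N_ge_1
        by (meson less_trans mult_pos_pos zero_less_numeral zero_less_one order_less_le_trans)
      then show "y \<in> - S" by auto
    qed
    have step: "s \<le> scale j" "scale j \<le> 16 * s" "U \<subseteq> ball x (scale j)" if "i \<le> j" "j \<le> i + 4" for j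
      using scale_mono [OF that(1)] scale_mono [OF that(2)] s by (auto simp: s_def U_def)
    have near: "pd_bounded K s (C * A * ?b) (\<lambda>y. taylor m f (nearest (cell_point j z)) y - ?P y) U"
      if j: "i \<le> j" "j \<le> i + 4" and z: "z \<in> relevant j U" for j z
    proof -
      let ?q = "nearest (cell_point j z)"
      from z obtain y where y: "y \<in> U" "weight j z y \<noteq> 0" "z \<in> cells j" by (auto simp: relevant_def)
      have "dist y (cell_point j z) \<le> N * scale j" using y by (intro weight_support)
      moreover have "dist (cell_point j z) ?q \<le> 2 * N * scale j" using y nearest by (simp add: cells_def)
      moreover have "N * scale j \<le> N * (16 * s)" using step(2) [OF j] N_ge_1 by (intro mult_left_mono) auto
      moreover have "dist y ?q \<le> dist y (cell_point j z) + dist (cell_point j z) ?q" by (rule dist_triangle)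
      \<comment> \<open>the lattice point is at most N meshes from y and 2 N meshes from ?q, and the mesh is at most 16 s\<close>
      ultimately have yq: "dist y ?q \<le> 48 * (N * s)" by linarith
      have xq: "dist x ?q \<le> 49 * (N * s)"
        using yq y(1) Ns dist_triangle [of x ?q y] by (simp add: U_def)
      have "dist ?q p \<le> dist x ?q + dist x p" by (rule dist_triangle3)
      moreover have "infdist x S < 16 * (N * s)" using x(2) s by simp
      ultimately have "dist ?q p \<le> 66 * (N * s)" using xq x(4) Ns by linarith
      then have qp: "dist ?q p \<le> L * s" by (simp add: L_def mult.assoc)
      have "U \<subseteq> ball ?q (L * s)"
      proof
        fix u assume "u \<in> U"
        then have "dist x u < s" by (simp add: U_def)
        with xq Ns dist_triangle [of ?q u x] have "dist ?q u < 66 * (N * s)" by (simp add: dist_commute)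
        then show "u \<in> ball ?q (L * s)" by (simp add: L_def mult.assoc)
      qed
      moreover have "pd_bounded K s (C * A * ?b) (\<lambda>y. taylor m f ?q y - ?P y) (ball ?q (L * s))"
        using norm_remainder_le [OF x(3) nearest(1) qp L(1) s(1)] s(1) pos by (intro T) (auto simp: A_def)
      ultimately show ?thesis by (rule pd_bounded_subset [rotated])
    qed
    have ckU: "ck K g U" if "ck K g UNIV" for g :: "'n point \<Rightarrow> 'b" by (rule ck_subset [OF that]) simp
    have ckU': "ck K g U" if "ck K g UNIV" for g :: "'n point \<Rightarrow> real" by (rule ck_subset [OF that]) simp
    have level_bd: "pd_bounded K s (E1 * ?b) (\<lambda>y. level j y - cutoff j y *\<^sub>R ?P y) U" if j: "i \<le> j" "j \<le> i + 4" for j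
    proof -
      have "pd_bounded K s (c * (2 ^ K * (W * (C * A * ?b))))
          (\<lambda>y. \<Sum>z\<in>cells j. weight j z y *\<^sub>R (taylor m f (nearest (cell_point j z)) y - ?P y)) U"
        unfolding c_def using W C pos b s
        by (intro pd_bounded_weighted_sum [OF W(2) _ U(1) step(3) [OF j] s(1) step(1) [OF j]] near j ckU ck_diff ck_taylor open_UNIV) auto
      moreover have "(\<Sum>z\<in>cells j. weight j z y *\<^sub>R (taylor m f (nearest (cell_point j z)) y - ?P y))
          = level j y - cutoff j y *\<^sub>R ?P y" for y
        by (simp add: level_def cutoff_def scaleR_right_diff_distrib sum_subtractf scaleR_sum_left)
      ultimately show ?thesis by (simp add: E1_def mult.assoc)
    qed
    have cutoff_bd: "pd_bounded K s (1 + Q) (\<lambda>y. 1 - cutoff j y) U" if j: "i \<le> j" "j \<le> i + 4" for j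
    proof -
      have "pd_bounded K s (c * (2 ^ K * (W * 1))) (\<lambda>y. \<Sum>z\<in>cells j. weight j z y *\<^sub>R (1 :: real)) U"
        unfolding c_def using W s pd_bounded_const [OF s(1), of K "1 :: real" U]
        by (intro pd_bounded_weighted_sum [OF W(2) _ U(1) step(3) [OF j] s(1) step(1) [OF j]] ck_const) auto
      then have "pd_bounded K s Q (cutoff j) U" by (simp add: Q_def cutoff_def [abs_def])
      then have "pd_bounded K s (1 + \<bar>-1\<bar> * Q) (\<lambda>y. 1 + (-1) *\<^sub>R cutoff j y) U"
        using pd_bounded_const [OF s(1), of K "1 :: real" U]
        by (intro pd_bounded_add U pd_bounded_cmult ck_cmult ckU' ck_const ck_cutoff) auto
      then show ?thesis by simp
    qed
    have "pd_bounded K s (E t * ?b) (\<lambda>y. approx (i + t) y - ?P y) U" if "t \<le> 4" for t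
      using that
    proof (induction t)
      case 0
      have eq: "level i y - cutoff i y *\<^sub>R ?P y = approx (i + 0) y - ?P y" if "y \<in> U" for y
      proof -
        have "cutoff i y = 1" using that by (intro cutoff_eq_1) (simp add: U_def)
        then show ?thesis by (cases i) simp_all
      qed
      have "pd_bounded K s (E1 * ?b) (\<lambda>y. approx (i + 0) y - ?P y) U"
        by (rule pd_bounded_cong_open [OF U(1) eq, THEN iffD1, OF _ level_bd [of i]]) simp_all
      then show ?case by (simp add: E_def)
    next
      case (Suc t)
      let ?j = "i + Suc t"
      have "pd_bounded K s (E1 * ?b + 2 ^ K * ((1 + Q) * (E t * ?b)))
          (\<lambda>y. (level ?j y - cutoff ?j y *\<^sub>R ?P y) + (1 - cutoff ?j y) *\<^sub>R (approx (i + t) y - ?P y)) U"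
        using Suc
        by (intro pd_bounded_add pd_bounded_scaleR level_bd cutoff_bd U s ck_diff ck_scaleR ck_const ckU ckU' ck_taylor ck_level ck_cutoff ck_approx open_UNIV) auto
      moreover have "(level ?j y - cutoff ?j y *\<^sub>R ?P y) + (1 - cutoff ?j y) *\<^sub>R (approx (i + t) y - ?P y)
          = approx ?j y - ?P y" for y
        by (simp add: algebra_simps)
      moreover have "E1 * ?b + 2 ^ K * ((1 + Q) * (E t * ?b)) = E (Suc t) * ?b"
        by (simp add: E_def algebra_simps)
      ultimately show ?case by (simp only:)
    qed
    from this [of 4] have b4: "pd_bounded K s (E 4 * ?b) (\<lambda>y. approx (i + 4) y - ?P y) U" by simp
    have eq: "approx (i + 4) y - ?P y = extension y - ?P y" if "y \<in> U" for y
      using extension_eq_approx [OF far [OF that]] by simp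
    have "pd_bounded K s (E 4 * ?b) (\<lambda>y. extension y - ?P y) U"
      by (rule pd_bounded_cong_open [OF U(1) eq, THEN iffD1, OF _ b4])
    with U US show ?thesis unfolding s_def by blast
  qed
  then show ?thesis by (intro exI [of _ "E 4"] conjI allI impI E_pos)
qed

text \<open>
  The comparison of scales \<open>s \<le> d \<le> 16 N s\<close> turns the previous lemma into powers of the distance; the
  exponent may have either sign, whence the constant.
\<close>

proposition extension_estimate:
  "\<exists>C>0. \<forall>x p rs. x \<notin> S \<longrightarrow> infdist x S < N \<longrightarrow> p \<in> S \<longrightarrow> dist x p = infdist x S \<longrightarrow> length rs \<le> K \<longrightarrow>
     norm (pd_word rs extension x - pd_word rs (taylor m f p) x)
       \<le> C * infdist x S powr (real m + \<nu> - real (length rs))"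
proof -
  from pd_bounded_extension obtain E where E: "E > 0" and
    bd0: "\<forall>x p i. N * scale (Suc i) \<le> infdist x S \<longrightarrow> infdist x S < N * scale i \<longrightarrow> p \<in> S \<longrightarrow> dist x p = infdist x S \<longrightarrow>
     (\<exists>U. open U \<and> x \<in> U \<and> U \<subseteq> - S \<and>
       pd_bounded K (scale (i + 4)) (E * scale (i + 4) powr (real m + \<nu>)) (\<lambda>y. extension y - taylor m f p y) U)"
    by (elim exE conjE)
  note pd_bounded = bd0 [rule_format]
  define C where "C = E * (16 * N) powr (real m + \<nu> + real K)"
  have "norm (pd_word rs extension x - pd_word rs (taylor m f p) x) \<le> C * infdist x S powr (real m + \<nu> - real (length rs))"
    if x: "x \<notin> S" "infdist x S < N" "p \<in> S" "dist x p = infdist x S" and rs: "length rs \<le> K" for x p rs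
  proof -
    let ?d = "infdist x S"
    let ?a = "real m + \<nu> - real (length rs)"
    have d: "?d > 0" using infdist_pos x by blast
    define i where "i = (LEAST i. N * scale (Suc i) \<le> ?d)"
    have ex: "\<exists>i. N * scale (Suc i) \<le> ?d"
    proof -
      obtain i where "N * scale i < ?d" using ex_scale_less [OF d, of N] by (elim exE)
      moreover have "N * scale (Suc i) \<le> N * scale i"
        using N_ge_1 scale_mono [of i "Suc i"] by (intro mult_left_mono) auto
      ultimately show ?thesis by (intro exI [of _ i]) linarith
    qed
    have i1: "N * scale (Suc i) \<le> ?d" unfolding i_def by (rule LeastI_ex [OF ex])
    have i2: "?d < N * scale i"
    proof (cases i)
      case 0
      then show ?thesis using x(2) by (simp add: scale_def)
    next
      case (Suc k)
      then show ?thesis using not_less_Least [of k "\<lambda>i. N * scale (Suc i) \<le> ?d"] by (simp add: i_def not_le)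
    qed
    define s where "s = scale (i + 4)"
    have s: "s > 0" "scale i = 16 * s" "scale (Suc i) = 8 * s"
      by (simp_all add: s_def scale_def power_add power_divide)
    from pd_bounded [OF i1 i2 x(3,4)] obtain U where U: "open U" "x \<in> U" "U \<subseteq> - S"
      and b: "pd_bounded K s (E * s powr (real m + \<nu>)) (\<lambda>y. extension y - taylor m f p y) U"
      unfolding s_def by blast
    have "pd_word rs extension x - pd_word rs (taylor m f p) x = pd_word rs (\<lambda>y. extension y - taylor m f p y) x"
    proof (rule pd_word_diff [OF U(1) _ _ U(2), symmetric])
      show "ck (length rs) extension U"
        using ck_mono [OF ck_extension rs] U(3) by (rule ck_subset)
      show "ck (length rs) (taylor m f p) U" by (rule ck_subset [OF ck_taylor]) simp
    qed
    also have "norm \<dots> \<le> E * s powr (real m + \<nu>) / s ^ length rs" by (rule pd_bounded_pd_word [OF b rs U(2)])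
    also have "\<dots> = E * s powr ?a"
      using s by (simp add: powr_diff powr_realpow)
    also have "s powr ?a \<le> (16 * N) powr (real m + \<nu> + real K) * ?d powr ?a"
    proof -
      have "s \<le> N * s" "8 * (N * s) \<le> ?d" "?d < 16 * (N * s)"
        using s i1 i2 N_ge_1 mult_right_mono [OF N_ge_1, of s] by simp_all
      then have "s \<le> ?d" "?d \<le> 16 * (N * s)" using s(1) by linarith+
      then have q: "0 < s / ?d" "s / ?d \<le> 1" "?d / s \<le> 16 * N"
        using d s(1) by (simp_all add: divide_le_eq)
      have "s powr ?a = (s / ?d) powr ?a * ?d powr ?a"
        using s d by (simp add: powr_mult [symmetric])
      also have "(s / ?d) powr ?a \<le> (16 * N) powr (real m + \<nu> + real K)"
      proof -
        have "(s / ?d) powr ?a \<le> (s / ?d) powr (- (real m + \<nu> + real K))"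
          using q rs \<nu>_pos by (intro powr_mono') auto
        also have "\<dots> = (?d / s) powr (real m + \<nu> + real K)"
        proof -
          have "(s / ?d) powr (- \<beta>) = (?d / s) powr \<beta>" for \<beta>
            using s d by (simp add: powr_minus powr_divide)
          then show ?thesis .
        qed
        also have "\<dots> \<le> (16 * N) powr (real m + \<nu> + real K)"
          using q \<nu>_pos s d by (intro powr_mono2) auto
        finally show ?thesis .
      qed
      finally show ?thesis by (simp add: mult_right_mono)
    qed
    finally show ?thesis using E by (simp add: C_def mult.assoc)
  qed
  moreover have "C > 0" using E N_ge_1 by (simp add: C_def)
  ultimately show ?thesis by blast
qed

text \<open>
  The value at \<open>x\<close> is compared with the Taylor polynomial at a nearest point \<open>p\<close>, this with its value at
  \<open>p\<close>, and the data at \<open>p\<close> with those at \<open>q\<close> through the same Taylor polynomial; all distances are at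
  most \<open>2 * dist x q\<close>.
\<close>

lemma tendsto_pd_word_extension:
  assumes rs: "length rs \<le> m" "length rs \<le> K" and q: "q \<in> S"
  shows "(pd_word rs extension \<longlongrightarrow> f (mi_of_list rs) q) (at q within - S)"
proof -
  from extension_estimate obtain C where C: "C > 0" and est: "\<And>x p. x \<notin> S \<Longrightarrow> infdist x S < N \<Longrightarrow>
     p \<in> S \<Longrightarrow> dist x p = infdist x S \<Longrightarrow>
     norm (pd_word rs extension x - pd_word rs (taylor m f p) x) \<le> C * infdist x S powr (real m + \<nu> - real (length rs))"
    using rs(2) by metis
  define m' where "m' = m - length rs"
  define g where "g = mi_shift (mi_of_list rs) f"
  define \<alpha> where "\<alpha> = real m + \<nu> - real (length rs)"
  define c where "c = real (card {l :: 'n multiindex. mi_abs l \<le> m'}) * M"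
  have \<alpha>: "\<alpha> > 0" using rs \<nu>_pos by (simp add: \<alpha>_def)
  have g0: "g (\<lambda>_. 0) = f (mi_of_list rs)" by (simp add: g_def mi_shift_def mi_plus_def)
  have g_le: "norm (g l p) \<le> M" if "mi_abs l \<le> m'" "p \<in> S" for l p
    using jet that rs by (simp add: whitney_jet_def g_def mi_shift_def m'_def mi_abs_plus mi_abs_of_list)
  have near: "norm (taylor m' g p x - g (\<lambda>_. 0) p) \<le> c * norm (x - p)" if "p \<in> S" "norm (x - p) \<le> 1" for x p
    unfolding c_def using g_le that by (intro norm_taylor_diff_center_le) auto
  have rem: "norm (g (\<lambda>_. 0) q - taylor m' g p q) \<le> M * norm (q - p) powr \<alpha>" if "p \<in> S" for p
  proof -
    have "mi_abs (mi_of_list rs) \<le> m" using rs by (simp add: mi_abs_of_list)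
    with jet that q show ?thesis
      unfolding g0 unfolding whitney_jet_def g_def m'_def \<alpha>_def mi_abs_of_list [symmetric] by blast
  qed
  have c: "c \<ge> 0" using M_pos by (simp add: c_def)
  show ?thesis
  proof (rule LIM_zero_cancel, rule Lim_null_comparison)
    let ?h = "\<lambda>x. C * dist x q powr \<alpha> + c * dist x q + c * (2 * dist x q) + M * (2 * dist x q) powr \<alpha>"
    show "\<forall>\<^sub>F x in at q within - S. norm (pd_word rs extension x - f (mi_of_list rs) q) \<le> ?h x"
    proof -
      have "\<forall>\<^sub>F x in at q within - S. dist x q < 1 / 2"
        using tendstoD [OF tendsto_ident_at, of "1 / 2" q "- S"] by simp
      moreover have "\<forall>\<^sub>F x in at q within - S. x \<in> - S" by (auto simp: eventually_at_filter)
      ultimately show ?thesis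
      proof eventually_elim
        case (elim x)
        let ?p = "nearest x"
        have d: "infdist x S \<le> dist x q" by (rule infdist_le [OF q])
        have p: "norm (x - ?p) \<le> dist x q" using d nearest(2) [of x] by (simp add: dist_norm)
        have qp: "norm (q - ?p) \<le> 2 * dist x q"
          using p norm_triangle_ineq [of "q - x" "x - ?p"] by (simp add: dist_norm norm_minus_commute)
        have "norm (pd_word rs extension x - pd_word rs (taylor m f ?p) x) \<le> C * infdist x S powr \<alpha>"
          unfolding \<alpha>_def using elim d N_ge_1 nearest by (intro est) auto
        also have "\<dots> \<le> C * dist x q powr \<alpha>"
          using C d \<alpha> infdist_nonneg by (intro mult_left_mono powr_mono2) auto
        finally have 1: "norm (pd_word rs extension x - taylor m' g ?p x) \<le> C * dist x q powr \<alpha>"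
          unfolding pd_word_taylor [OF rs(1)] m'_def g_def .
        have 2: "norm (taylor m' g ?p x - g (\<lambda>_. 0) ?p) \<le> c * dist x q"
        proof -
          have "norm (x - ?p) \<le> 1" using p elim(1) by linarith
          from order_trans [OF near [OF nearest(1) this] mult_left_mono [OF p c]] show ?thesis .
        qed
        have 3: "norm (g (\<lambda>_. 0) ?p - taylor m' g ?p q) \<le> c * (2 * dist x q)"
        proof -
          have "norm (q - ?p) \<le> 1" using qp elim(1) by linarith
          from near [OF nearest(1) this] have "norm (taylor m' g ?p q - g (\<lambda>_. 0) ?p) \<le> c * norm (q - ?p)" .
          also have "\<dots> \<le> c * (2 * dist x q)" using qp c by (rule mult_left_mono)
          finally show ?thesis by (simp add: norm_minus_commute)
        qed
        have 4: "norm (taylor m' g ?p q - g (\<lambda>_. 0) q) \<le> M * (2 * dist x q) powr \<alpha>"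
        proof -
          have "norm (g (\<lambda>_. 0) q - taylor m' g ?p q) \<le> M * norm (q - ?p) powr \<alpha>" by (rule rem [OF nearest(1)])
          also have "\<dots> \<le> M * (2 * dist x q) powr \<alpha>"
            using M_pos qp \<alpha> by (intro mult_left_mono powr_mono2) auto
          finally show ?thesis by (simp add: norm_minus_commute)
        qed
        have "pd_word rs extension x - g (\<lambda>_. 0) q = (((pd_word rs extension x - taylor m' g ?p x)
            + (taylor m' g ?p x - g (\<lambda>_. 0) ?p)) + (g (\<lambda>_. 0) ?p - taylor m' g ?p q)) + (taylor m' g ?p q - g (\<lambda>_. 0) q)"
          by simp
        then show ?case using norm_triangle_mono [OF norm_triangle_mono [OF norm_triangle_mono [OF 1 2] 3] 4]
          by (simp only: g0)
      qed
    qed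
    have "((\<lambda>x. dist x q) \<longlongrightarrow> dist q q) (at q within - S)" by (intro tendsto_intros)
    then have t: "((\<lambda>x. dist x q) \<longlongrightarrow> 0) (at q within - S)" by simp
    have "(?h \<longlongrightarrow> C * 0 powr \<alpha> + c * 0 + c * (2 * 0) + M * (2 * 0) powr \<alpha>) (at q within - S)"
      using \<alpha> by (intro tendsto_intros t tendsto_powr' disjI2 conjI) auto
    then show "(?h \<longlongrightarrow> 0) (at q within - S)" using \<alpha> by simp
  qed
qed

text \<open>
  A derivative of order \<open>m + 1\<close> annihilates the Taylor polynomial, so the estimate bounds the extension
  itself.
\<close>

lemma norm_pd_word_extension_top_le:
  assumes "Suc m \<le> K"
  shows "\<exists>C>0. \<forall>x rs. x \<notin> S \<longrightarrow> infdist x S < N \<longrightarrow> length rs = Suc m \<longrightarrow>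
     norm (pd_word rs extension x) \<le> C * infdist x S powr (\<nu> - 1)"
proof -
  from extension_estimate obtain C where C: "C > 0" and est: "\<And>x p rs. x \<notin> S \<Longrightarrow> infdist x S < N \<Longrightarrow>
     p \<in> S \<Longrightarrow> dist x p = infdist x S \<Longrightarrow> length rs \<le> K \<Longrightarrow>
     norm (pd_word rs extension x - pd_word rs (taylor m f p) x) \<le> C * infdist x S powr (real m + \<nu> - real (length rs))"
    by metis
  have "norm (pd_word rs extension x) \<le> C * infdist x S powr (\<nu> - 1)"
    if "x \<notin> S" "infdist x S < N" "length rs = Suc m" for x rs
    using est [OF that(1,2) nearest, of rs] assms that(3) by (simp add: pd_word_taylor_top)
  with C show ?thesis by blast
qed

end

section \<open>Differentiation of convolutions\<close>

subsection \<open>Dominated differentiation\<close>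

lemma has_vector_derivative_at_0_iff:
  fixes \<gamma> :: "real \<Rightarrow> 'b::real_normed_vector"
  shows "(\<gamma> has_vector_derivative D) (at 0) \<longleftrightarrow> ((\<lambda>t. (1 / t) *\<^sub>R (\<gamma> t - \<gamma> 0)) \<longlongrightarrow> D) (at 0)"
proof -
  have "(\<gamma> has_vector_derivative D) (at 0) \<longleftrightarrow> ((\<lambda>t. norm (\<gamma> t - \<gamma> 0 - t *\<^sub>R D) / norm t) \<longlongrightarrow> 0) (at 0)"
    by (simp add: has_vector_derivative_def has_derivative_at bounded_linear_scaleR_left)
  also have "\<dots> \<longleftrightarrow> ((\<lambda>t. norm ((1 / t) *\<^sub>R (\<gamma> t - \<gamma> 0) - D)) \<longlongrightarrow> 0) (at 0)"
  proof (rule tendsto_cong)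
    have "norm (\<gamma> t - \<gamma> 0 - t *\<^sub>R D) / norm t = norm ((1 / t) *\<^sub>R (\<gamma> t - \<gamma> 0) - D)" if "t \<noteq> 0" for t
    proof -
      have "(1 / t) *\<^sub>R (\<gamma> t - \<gamma> 0) - D = (1 / t) *\<^sub>R (\<gamma> t - \<gamma> 0 - t *\<^sub>R D)"
        using that by (simp add: scaleR_right_diff_distrib)
      then show ?thesis by simp
    qed
    then show "\<forall>\<^sub>F t in at 0. norm (\<gamma> t - \<gamma> 0 - t *\<^sub>R D) / norm t = norm ((1 / t) *\<^sub>R (\<gamma> t - \<gamma> 0) - D)"
      by (auto simp: eventually_at_filter)
  qed
  also have "\<dots> \<longleftrightarrow> ((\<lambda>t. (1 / t) *\<^sub>R (\<gamma> t - \<gamma> 0)) \<longlongrightarrow> D) (at 0)"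
    by (simp add: tendsto_norm_zero_iff LIM_zero_iff)
  finally show ?thesis .
qed

text \<open>
  Difference quotients are dominated by the bound for the derivative, by the mean value theorem along
  the axis.
\<close>

lemma has_pd_integral:
  fixes F :: "real ^ 'm::finite \<Rightarrow> 'y \<Rightarrow> 'b::{banach, second_countable_topology}"
  assumes U: "open U" "x \<in> U"
    and int: "\<And>x. x \<in> U \<Longrightarrow> integrable Q (F x)"
    and d: "\<And>x y. x \<in> U \<Longrightarrow> y \<in> space Q \<Longrightarrow> has_pd (\<lambda>x. F x y) (F' x y) j x"
    and meas: "F' x \<in> borel_measurable Q"
    and g: "integrable Q g" "\<And>x y. x \<in> U \<Longrightarrow> y \<in> space Q \<Longrightarrow> norm (F' x y) \<le> g y"
  shows "has_pd (\<lambda>x. \<integral>y. F x y \<partial>Q) (\<integral>y. F' x y \<partial>Q) j x"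
proof -
  obtain e where e: "e > 0" "ball x e \<subseteq> U" using U openE by blast
  have line: "x + t *\<^sub>R axis j 1 \<in> U" if "\<bar>t\<bar> < e" for t
    using that e(2) by (intro subsetD [OF e(2)]) (simp add: dist_norm)
  let ?q = "\<lambda>t y. (1 / t) *\<^sub>R (F (x + t *\<^sub>R axis j 1) y - F x y)"
  have "((\<lambda>t. \<integral>y. ?q t y \<partial>Q) \<longlongrightarrow> (\<integral>y. F' x y \<partial>Q)) (at 0 within ball 0 e)"
    unfolding tendsto_at_iff_sequentially
  proof (intro allI impI)
    fix X :: "nat \<Rightarrow> real"
    assume X: "\<forall>i. X i \<in> ball 0 e - {0}" "X \<longlonglongrightarrow> 0"
    then have Xe: "\<bar>X i\<bar> < e" "X i \<noteq> 0" for i by auto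
    show "((\<lambda>t. \<integral>y. ?q t y \<partial>Q) \<circ> X) \<longlonglongrightarrow> (\<integral>y. F' x y \<partial>Q)"
      unfolding o_def
    proof (rule integral_dominated_convergence [OF meas _ g(1)])
      show "?q (X i) \<in> borel_measurable Q" for i
        using int [OF line [OF Xe(1)]] int [OF U(2)] by measurable
      show "AE y in Q. (\<lambda>i. ?q (X i) y) \<longlonglongrightarrow> F' x y"
      proof (rule AE_I2)
        fix y assume y: "y \<in> space Q"
        have "((\<lambda>t. ?q t y) \<longlongrightarrow> F' x y) (at 0)"
          using d [OF U(2) y] unfolding has_pd_def has_vector_derivative_at_0_iff by simp
        moreover have "filterlim X (at 0) sequentially"
          using X(2) Xe(2) by (simp add: filterlim_at)
        ultimately show "(\<lambda>i. ?q (X i) y) \<longlonglongrightarrow> F' x y" by (rule filterlim_compose)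
      qed
      show "AE y in Q. norm (?q (X i) y) \<le> g y" for i
      proof (rule AE_I2)
        fix y assume y: "y \<in> space Q"
        have seg: "x + t *\<^sub>R axis j 1 \<in> U" if "t \<in> closed_segment 0 (X i)" for t
          using that Xe(1) [of i] by (intro line) (auto simp: closed_segment_eq_real_ivl split: if_splits)
        have "norm (F (x + X i *\<^sub>R axis j 1) y - F (x + 0 *\<^sub>R axis j 1) y) \<le> g y * \<bar>X i\<bar>"
          by (rule norm_diff_le_vector_derivative [of "X i" "\<lambda>t. F (x + t *\<^sub>R axis j 1) y"
                "\<lambda>t. F' (x + t *\<^sub>R axis j 1) y"])
             (use seg y g(2) in \<open>auto intro!: has_vector_derivative_along_axis d\<close>)
        then show "norm (?q (X i) y) \<le> g y" using Xe(2) [of i] by (simp add: divide_le_eq)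
      qed
    qed
  qed
  moreover have "at 0 within ball 0 e = at (0 :: real)"
    using e(1) by (intro at_within_open) auto
  ultimately have "((\<lambda>t. \<integral>y. ?q t y \<partial>Q) \<longlongrightarrow> (\<integral>y. F' x y \<partial>Q)) (at 0)"
    by (simp only:)
  moreover have "\<forall>\<^sub>F t in at 0. (\<integral>y. ?q t y \<partial>Q) = (1 / t) *\<^sub>R ((\<integral>y. F (x + t *\<^sub>R axis j 1) y \<partial>Q) - (\<integral>y. F x y \<partial>Q))"
  proof -
    have "\<forall>\<^sub>F t in at 0. \<bar>t\<bar> < e" using e(1) by (auto simp: eventually_at dist_norm)
    then show ?thesis
    proof (rule eventually_mono)
      fix t :: real assume "\<bar>t\<bar> < e"
      from int [OF line [OF this]] int [OF U(2)]
      show "(\<integral>y. ?q t y \<partial>Q) = (1 / t) *\<^sub>R ((\<integral>y. F (x + t *\<^sub>R axis j 1) y \<partial>Q) - (\<integral>y. F x y \<partial>Q))"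
        by (simp only: integral_scaleR_right Bochner_Integration.integral_diff)
    qed
  qed
  ultimately have "((\<lambda>t. (1 / t) *\<^sub>R ((\<integral>y. F (x + t *\<^sub>R axis j 1) y \<partial>Q) - (\<integral>y. F x y \<partial>Q))) \<longlongrightarrow> (\<integral>y. F' x y \<partial>Q)) (at 0)"
    by (rule Lim_transform_eventually)
  then show ?thesis unfolding has_pd_def has_vector_derivative_at_0_iff by simp
qed

lemma continuous_on_integral_dominated:
  fixes F :: "'x::first_countable_topology \<Rightarrow> 'y \<Rightarrow> 'b::{banach, second_countable_topology}"
  assumes c: "\<And>y. y \<in> space Q \<Longrightarrow> continuous_on U (\<lambda>x. F x y)"
    and meas: "\<And>x. x \<in> U \<Longrightarrow> F x \<in> borel_measurable Q"
    and g: "integrable Q g" "\<And>x y. x \<in> U \<Longrightarrow> y \<in> space Q \<Longrightarrow> norm (F x y) \<le> g y"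
  shows "continuous_on U (\<lambda>x. \<integral>y. F x y \<partial>Q)"
  unfolding continuous_on_def
proof
  fix x assume x: "x \<in> U"
  show "((\<lambda>x. \<integral>y. F x y \<partial>Q) \<longlongrightarrow> (\<integral>y. F x y \<partial>Q)) (at x within U)"
    unfolding tendsto_at_iff_sequentially
  proof (intro allI impI)
    fix X assume X: "\<forall>i. X i \<in> U - {x}" "X \<longlonglongrightarrow> x"
    show "((\<lambda>x. \<integral>y. F x y \<partial>Q) \<circ> X) \<longlonglongrightarrow> (\<integral>y. F x y \<partial>Q)"
      unfolding o_def
    proof (rule integral_dominated_convergence [OF meas [OF x] _ g(1)])
      show "F (X i) \<in> borel_measurable Q" for i using X by (intro meas) auto
      show "AE y in Q. (\<lambda>i. F (X i) y) \<longlonglongrightarrow> F x y"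
      proof (rule AE_I2)
        fix y assume "y \<in> space Q"
        from c [OF this] x have "((\<lambda>x. F x y) \<longlongrightarrow> F x y) (at x within U)" by (auto simp: continuous_on_def)
        with X show "(\<lambda>i. F (X i) y) \<longlonglongrightarrow> F x y" unfolding tendsto_at_iff_sequentially o_def by blast
      qed
      show "AE y in Q. norm (F (X i) y) \<le> g y" for i using X g(2) by (intro AE_I2) auto
    qed
  qed
qed

lemma integrable_compact_support:
  fixes g :: "'a::euclidean_space \<Rightarrow> 'b::{banach, second_countable_topology}"
  assumes "continuous_on UNIV g" "\<And>x. norm x > R \<Longrightarrow> g x = 0"
  shows "integrable lborel g"
proof -
  have "integrable lborel (\<lambda>x. indicator (cball 0 R) x *\<^sub>R g x)"
    using assms(1) by (intro borel_integrable_compact compact_cball continuous_on_subset [OF assms(1)]) auto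
  moreover have "(\<lambda>x. indicator (cball 0 R) x *\<^sub>R g x) = g"
    using assms(2) by (auto simp: indicator_def not_le)
  ultimately show ?thesis by simp
qed

text \<open>
  The integral of a translate does not depend on the translation; differentiate under the integral.
\<close>

lemma integral_pd_eq_0:
  fixes g :: "real ^ 'm::finite \<Rightarrow> 'b::{banach, second_countable_topology}"
  assumes g: "ck 1 g UNIV" "\<And>x. norm x > R \<Longrightarrow> g x = 0"
  shows "(\<integral>y. pd j g y \<partial>lborel) = 0"
proof -
  have cont: "continuous_on UNIV g" "continuous_on UNIV (pd j g)" and d: "has_pd g (pd j g x) j x" for x
    using g(1) by auto
  have pd0: "pd j g x = 0" if "norm x > R" for x
    by (rule pd_eq_0_outside [of "cball 0 R"]) (use g(2) that in \<open>auto simp: not_le\<close>)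
  have m: "g \<in> borel_measurable borel" "pd j g \<in> borel_measurable borel"
    using cont by (auto intro: borel_measurable_continuous_onI)
  obtain B where B: "B > 0" "\<And>x. norm (pd j g x) \<le> B"
    using bounded_if_compact_support [of "cball 0 R" "pd j g"] pd0 continuous_on_subset [OF cont(2)]
    by (metis compact_cball dist_0_norm mem_cball not_le subset_UNIV)
  have transl: "(\<integral>y. g (x + y) \<partial>lborel) = (\<integral>y. g y \<partial>lborel)" for x
  proof -
    have "(\<integral>y. g y \<partial>lborel) = (\<integral>y. g y \<partial>distr lborel borel ((+) x))" by (simp add: lborel_distr_plus)
    also have "\<dots> = (\<integral>y. g (x + y) \<partial>lborel)" using m by (intro integral_distr) auto
    finally show ?thesis ..
  qed
  have "has_pd (\<lambda>x. \<integral>y. g (x + y) \<partial>lborel) (\<integral>y. pd j g (0 + y) \<partial>lborel) j 0"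
  proof (rule has_pd_integral [of "ball 0 1" _ _ _ _ _ "\<lambda>y. indicator (cball 0 (R + 1)) y * B"])
    show "integrable lborel (\<lambda>y. g (x + y))" if x: "x \<in> ball 0 1" for x
    proof (rule integrable_compact_support)
      show "continuous_on UNIV (\<lambda>y. g (x + y))"
        by (rule continuous_on_compose2 [OF cont(1)]) (auto intro!: continuous_intros)
      show "g (x + y) = 0" if "norm y > R + norm x" for y
        using that norm_triangle_ineq4 [of "x + y" x] by (intro g(2)) simp
    qed
    show "has_pd (\<lambda>x. g (x + y)) (pd j g (x + y)) j x" for x y
      using has_pd_affine [of g "pd j g (x + y)" j 1 x y] d by simp
    show "(\<lambda>y. pd j g (0 + y)) \<in> borel_measurable lborel" using m by simp
    show "integrable lborel (\<lambda>y. indicator (cball 0 (R + 1)) y * B)"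
      using borel_integrable_compact [of "cball 0 (R + 1)" "\<lambda>_. B"] by simp
    show "norm (pd j g (x + y)) \<le> indicator (cball 0 (R + 1)) y * B" if "x \<in> ball 0 1" for x y
    proof (cases "norm y \<le> R + 1")
      case False
      then have "norm (x + y) > R" using that norm_triangle_ineq4 [of "x + y" x] by simp
      then show ?thesis using B(1) pd0 by simp
    qed (simp add: B)
  qed auto
  then have "has_pd (\<lambda>x. \<integral>y. g y \<partial>lborel) (\<integral>y. pd j g y \<partial>lborel) j 0" by (simp add: transl)
  then show ?thesis using has_pd_imp_pd [OF has_pd_const] has_pd_imp_pd by metis
qed

subsection \<open>Potentials of Clifford-valued densities\<close>

lemma bounded_bilinear_cl_mult: "bounded_bilinear (\<star>)"
  using bilinear_cl_mult bilinear_conv_bounded_bilinear by blast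

lemma norm_cl_mult_bound:
  obtains c where "c > 0" "\<And>a b :: 'n::{finite,linorder} clifford. norm (a \<star> b) \<le> norm a * norm b * c"
  using bounded_bilinear.pos_bounded [OF bounded_bilinear_cl_mult] by metis

interpretation cl: bounded_bilinear "(\<star>) :: 'n::{finite,linorder} clifford \<Rightarrow> 'n clifford \<Rightarrow> 'n clifford"
  by (rule bounded_bilinear_cl_mult)

lemma borel_measurable_cl_mult [measurable (raw)]:
  assumes "f \<in> borel_measurable Q" "g \<in> borel_measurable Q"
  shows "(\<lambda>y. f y \<star> g y) \<in> borel_measurable Q"
  by (rule borel_measurable_continuous_Pair [OF assms]) (intro cl.continuous_on continuous_intros)

definition potential :: "('n::{finite,linorder} point \<Rightarrow> 'n clifford) \<Rightarrow> ('n point \<Rightarrow> 'n clifford) \<Rightarrow> 'n point \<Rightarrow> 'n clifford" where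
  "potential E h x = (\<integral>y. E (x - y) \<star> h y \<partial>lborel)"

definition locally_integrable :: "('n::{finite,linorder} point \<Rightarrow> 'n clifford) \<Rightarrow> bool" where
  "locally_integrable E \<longleftrightarrow> E \<in> borel_measurable borel \<and>
     (\<forall>R. integrable lborel (\<lambda>y. indicator (cball 0 R) y * norm (E y)))"

lemma lborel_distr_reflect: "distr lborel borel (\<lambda>y. x - y) = (lborel :: 'a::euclidean_space measure)"
  by (subst (2) lborel_affine [of "-1" x]) (simp_all add: density_1)

lemma integral_reflect:
  fixes f :: "'a::euclidean_space \<Rightarrow> 'b::{banach, second_countable_topology}"
  assumes "f \<in> borel_measurable borel"
  shows "(\<integral>y. f (x - y) \<partial>lborel) = (\<integral>y. f y \<partial>lborel)"
    and "integrable lborel (\<lambda>y. f (x - y)) \<longleftrightarrow> integrable lborel f"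
  using integral_distr [of "\<lambda>y. x - y" lborel borel f] integrable_distr_eq [of "\<lambda>y. x - y" lborel borel f] assms
  by (simp_all add: lborel_distr_reflect)

lemma potential_commute:
  assumes "E \<in> borel_measurable borel" "h \<in> borel_measurable borel"
  shows "potential E h x = (\<integral>y. E y \<star> h (x - y) \<partial>lborel)"
  using integral_reflect(1) [of "\<lambda>y. E (x - y) \<star> h y" x] assms by (simp add: potential_def)

text \<open>A smooth density of compact support absorbs the derivatives.\<close>

context
  fixes E :: "'n::{finite,linorder} point \<Rightarrow> 'n clifford"
  assumes E: "locally_integrable E"
begin

lemma dominated_near:
  assumes g: "continuous_on UNIV g" "\<And>x. norm x > R \<Longrightarrow> g x = 0"
  obtains G where "integrable lborel G" "\<And>x y. norm x \<le> \<rho> \<Longrightarrow> norm (E y \<star> g (x - y)) \<le> G y"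
proof -
  obtain c where c: "c > 0" "\<And>a b :: 'n clifford. norm (a \<star> b) \<le> norm a * norm b * c"
    using norm_cl_mult_bound by blast
  have g0: "g x = 0" if "x \<notin> cball 0 R" for x using that g(2) by (simp add: not_le)
  obtain B where B: "B > 0" "\<And>x. norm (g x) \<le> B"
    using bounded_if_compact_support [OF compact_cball g0 continuous_on_subset [OF g(1) subset_UNIV]] by metis
  show ?thesis
  proof
    show "integrable lborel (\<lambda>y. (indicator (cball 0 (R + \<rho>)) y * norm (E y)) * (B * c))"
      using E by (intro integrable_mult_left) (simp add: locally_integrable_def)
    show "norm (E y \<star> g (x - y)) \<le> (indicator (cball 0 (R + \<rho>)) y * norm (E y)) * (B * c)"
      if x: "norm x \<le> \<rho>" for x y
    proof (cases "norm y \<le> R + \<rho>")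
      case True
      have "norm (E y \<star> g (x - y)) \<le> norm (E y) * norm (g (x - y)) * c" by (rule c)
      also have "\<dots> \<le> norm (E y) * B * c"
        using B c by (intro mult_right_mono mult_left_mono) auto
      finally show ?thesis using True by (simp add: mult.assoc)
    next
      case False
      then have "norm (x - y) > R" using x norm_triangle_ineq2 [of y x] by (simp add: norm_minus_commute)
      then show ?thesis using g(2) B c by (simp add: cl.zero_right)
    qed
  qed
qed

lemma integrable_near:
  assumes g: "continuous_on UNIV g" "\<And>x. norm x > R \<Longrightarrow> g x = 0"
  shows "integrable lborel (\<lambda>y. E y \<star> g (x - y))" "integrable lborel (\<lambda>y. E (x - y) \<star> g y)"
proof -
  have m: "E \<in> borel_measurable borel" "g \<in> borel_measurable borel"
    using E g(1) by (auto simp: locally_integrable_def intro: borel_measurable_continuous_onI)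
  obtain G where G: "integrable lborel G" "\<And>x' y. norm x' \<le> norm x \<Longrightarrow> norm (E y \<star> g (x' - y)) \<le> G y"
    using dominated_near [OF g] by blast
  show 1: "integrable lborel (\<lambda>y. E y \<star> g (x - y))"
    by (rule Bochner_Integration.integrable_bound [OF G(1)])
       (use m G(2) [of x] order_trans [OF _ abs_ge_self] in \<open>auto\<close>)
  show "integrable lborel (\<lambda>y. E (x - y) \<star> g y)"
    using integral_reflect(2) [of "\<lambda>y. E (x - y) \<star> g y" x] 1 m by simp
qed

lemma continuous_potential_near:
  assumes g: "continuous_on UNIV g" "\<And>x. norm x > R \<Longrightarrow> g x = 0"
  shows "continuous_on UNIV (potential E g)"
proof -
  have m: "E \<in> borel_measurable borel" "g \<in> borel_measurable borel"
    using E g(1) by (auto simp: locally_integrable_def intro: borel_measurable_continuous_onI)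
  have "continuous_on (ball 0 \<rho>) (potential E g)" for \<rho>
  proof -
    obtain G where G: "integrable lborel G" "\<And>x y. norm x \<le> \<rho> \<Longrightarrow> norm (E y \<star> g (x - y)) \<le> G y"
      using dominated_near [OF g] by blast
    have "continuous_on (ball 0 \<rho>) (\<lambda>x. \<integral>y. E y \<star> g (x - y) \<partial>lborel)"
    proof (rule continuous_on_integral_dominated [OF _ _ G(1)])
      show "continuous_on (ball 0 \<rho>) (\<lambda>x. E y \<star> g (x - y))" for y
        by (intro cl.continuous_on continuous_on_const continuous_on_compose2 [OF g(1)] continuous_intros) auto
      show "(\<lambda>y. E y \<star> g (x - y)) \<in> borel_measurable lborel" for x using m by measurable
      show "norm (E y \<star> g (x - y)) \<le> G y" if "x \<in> ball 0 \<rho>" for x y using that G(2) by simp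
    qed
    then show ?thesis using potential_commute [OF m] by simp
  qed
  then have "isCont (potential E g) x" for x
    using continuous_on_eq_continuous_at [of "ball 0 (norm x + 1)" "potential E g"] by auto
  then show ?thesis by (simp add: continuous_at_imp_continuous_on)
qed

lemma has_pd_potential_near:
  assumes g: "ck 1 g UNIV" "\<And>x. norm x > R \<Longrightarrow> g x = 0"
  shows "has_pd (potential E g) (potential E (pd j g) x) j x"
proof -
  have cont: "continuous_on UNIV g" "continuous_on UNIV (pd j g)" and d: "has_pd g (pd j g x) j x" for x
    using g(1) by auto
  have pd0: "pd j g x = 0" if "norm x > R" for x
    by (rule pd_eq_0_outside [of "cball 0 R"]) (use g(2) that in \<open>auto simp: not_le\<close>)
  have m: "E \<in> borel_measurable borel" "g \<in> borel_measurable borel" "pd j g \<in> borel_measurable borel"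
    using E cont by (auto simp: locally_integrable_def intro: borel_measurable_continuous_onI)
  obtain G where G: "integrable lborel G" "\<And>x' y. norm x' \<le> norm x + 1 \<Longrightarrow> norm (E y \<star> pd j g (x' - y)) \<le> G y"
    using dominated_near [OF cont(2) pd0] by blast
  have "has_pd (\<lambda>x. \<integral>y. E y \<star> g (x - y) \<partial>lborel) (\<integral>y. E y \<star> pd j g (x - y) \<partial>lborel) j x"
  proof (rule has_pd_integral [of "ball 0 (norm x + 1)" _ _ _ _ _ G])
    show "integrable lborel (\<lambda>y. E y \<star> g (x - y))" for x by (rule integrable_near [OF cont(1) g(2)])
    show "has_pd (\<lambda>x. E y \<star> g (x - y)) (E y \<star> pd j g (x - y)) j x" for x y
      using has_pd_bounded_linear [OF cl.bounded_linear_right has_pd_affine [of g "pd j g (x - y)" j 1 x "- y"]] d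
      by simp
    show "(\<lambda>y. E y \<star> pd j g (x - y)) \<in> borel_measurable lborel" using m by measurable
  qed (use G in auto)
  then show ?thesis using potential_commute [OF m(1,2)] potential_commute [OF m(1,3)] by (simp add: has_pd_def)
qed

lemma ck_potential_near:
  assumes "ck k g UNIV" "\<And>x. norm x > R \<Longrightarrow> g x = 0"
  shows "ck k (potential E g) UNIV"
  using assms
proof (induction k arbitrary: g)
  case 0
  from continuous_potential_near [OF ck_imp_continuous [OF 0(1)] 0(2)] show ?case by simp
next
  case (Suc k)
  have "pd j g x = 0" if "norm x > R" for j x
    by (rule pd_eq_0_outside [of "cball 0 R"]) (use Suc.prems(2) that in \<open>auto simp: not_le\<close>)
  then have IH: "ck k (potential E (pd j g)) UNIV" for j
    using Suc.IH [OF ck_SucE(2) [OF Suc.prems(1)]] by blast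
  show ?case
    by (rule ck_SucI_open [OF open_UNIV continuous_potential_near [OF ck_imp_continuous [OF Suc.prems(1)] Suc.prems(2)]
        has_pd_potential_near [OF ck_mono [OF Suc.prems(1)] Suc.prems(2)] IH]) simp_all
qed

end

text \<open>Away from the support of the density the kernel takes the derivatives.\<close>

context
  fixes w :: "'n::{finite,linorder} point \<Rightarrow> 'n clifford" and R \<rho> :: real and x0 :: "'n point"
  assumes w: "integrable lborel w" "\<And>x. norm x > R \<Longrightarrow> w x = 0" "\<And>x. x \<in> ball x0 \<rho> \<Longrightarrow> w x = 0"
    and \<rho>: "\<rho> > 0"
begin

lemma dominated_far:
  assumes "continuous_on (- {0}) E"
  obtains G where "integrable lborel G" "\<And>x y. x \<in> ball x0 (\<rho> / 2) \<Longrightarrow> norm (E (x - y) \<star> w y) \<le> G y"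
proof -
  obtain c where c: "c > 0" "\<And>a b :: 'n clifford. norm (a \<star> b) \<le> norm a * norm b * c"
    using norm_cl_mult_bound by blast
  let ?A = "cball 0 (R + norm x0 + \<rho>) - ball 0 (\<rho> / 2) :: 'n point set"
  have "compact ?A" by (intro compact_diff) auto
  then have "bounded (E ` ?A)"
    using \<rho> by (intro compact_imp_bounded compact_continuous_image continuous_on_subset [OF assms]) auto
  then obtain B where B: "B > 0" "\<And>z. z \<in> ?A \<Longrightarrow> norm (E z) \<le> B" by (auto simp: bounded_pos)
  show ?thesis
  proof
    show "integrable lborel (\<lambda>y. B * norm (w y) * c)" using w(1) by simp
    show "norm (E (x - y) \<star> w y) \<le> B * norm (w y) * c" if x: "x \<in> ball x0 (\<rho> / 2)" for x y
    proof (cases "w y = 0")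
      case False
      then have y: "norm y \<le> R" "dist x0 y \<ge> \<rho>" using w by (auto simp: not_less[symmetric])
      have "dist x0 y \<le> dist x0 x + dist x y" by (rule dist_triangle)
      then have "norm (x - y) \<ge> \<rho> / 2" using x y by (simp add: dist_norm)
      moreover have "norm (x - y) \<le> R + norm x0 + \<rho>"
      proof -
        have "norm (x - y) \<le> norm (x - x0) + norm x0 + norm y"
          using norm_triangle_ineq4 [of x y] norm_triangle_sub [of x x0] by linarith
        then show ?thesis using x y \<rho> by (simp add: dist_norm norm_minus_commute)
      qed
      ultimately have "norm (E (x - y)) \<le> B" by (intro B) auto
      then have "norm (E (x - y)) * norm (w y) * c \<le> B * norm (w y) * c"
        using c by (intro mult_right_mono) auto
      then show ?thesis using c(2) order_trans by blast
    qed (simp add: cl.zero_right)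
  qed
qed

lemma integrable_far:
  assumes "continuous_on (- {0}) E" "x \<in> ball x0 (\<rho> / 2)"
  shows "integrable lborel (\<lambda>y. E (x - y) \<star> w y)"
proof -
  have m: "E \<in> borel_measurable borel"
    using borel_measurable_continuous_countable_exceptions [OF _ assms(1)] by simp
  obtain G where G: "integrable lborel G" "\<And>x y. x \<in> ball x0 (\<rho> / 2) \<Longrightarrow> norm (E (x - y) \<star> w y) \<le> G y"
    using dominated_far [OF assms(1)] by blast
  show ?thesis
    by (rule Bochner_Integration.integrable_bound [OF G(1)])
       (use m w(1) G(2) [OF assms(2)] order_trans [OF _ abs_ge_self] in \<open>auto intro!: borel_measurable_cl_mult measurable_compose [of _ lborel borel E]\<close>)
qed

lemma continuous_potential_far:
  assumes "continuous_on (- {0}) E"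
  shows "continuous_on (ball x0 (\<rho> / 2)) (potential E w)"
proof -
  obtain G where G: "integrable lborel G" "\<And>x y. x \<in> ball x0 (\<rho> / 2) \<Longrightarrow> norm (E (x - y) \<star> w y) \<le> G y"
    using dominated_far [OF assms] by blast
  show ?thesis
    unfolding potential_def [abs_def]
  proof (rule continuous_on_integral_dominated [OF _ _ G])
    show "(\<lambda>y. E (x - y) \<star> w y) \<in> borel_measurable lborel" if "x \<in> ball x0 (\<rho> / 2)" for x
      using integrable_far [OF assms that] by (rule borel_measurable_integrable)
    show "continuous_on (ball x0 (\<rho> / 2)) (\<lambda>x. E (x - y) \<star> w y)" for y
    proof (cases "w y = 0")
      case False
      then have "y \<notin> ball x0 \<rho>" using w(3) by blast
      then have "y \<notin> ball x0 (\<rho> / 2)" using \<rho> by auto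
      then show ?thesis
        by (intro cl.continuous_on continuous_on_const continuous_on_compose2 [OF assms] continuous_intros) auto
    qed (simp add: cl.zero_right)
  qed auto
qed

lemma has_pd_potential_far:
  assumes E: "ck 1 E (- {0})" and x: "x \<in> ball x0 (\<rho> / 2)"
  shows "has_pd (potential E w) (potential (pd j E) w x) j x"
proof -
  have cont: "continuous_on (- {0}) E" "continuous_on (- {0}) (pd j E)"
    and d: "z \<noteq> 0 \<Longrightarrow> has_pd E (pd j E z) j z" for z
    using E by auto
  obtain G where G: "integrable lborel G" "\<And>x y. x \<in> ball x0 (\<rho> / 2) \<Longrightarrow> norm (pd j E (x - y) \<star> w y) \<le> G y"
    using dominated_far [OF cont(2)] by blast
  show ?thesis
    unfolding potential_def [abs_def]
  proof (rule has_pd_integral [of "ball x0 (\<rho> / 2)" _ _ _ _ _ G])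
    show "integrable lborel (\<lambda>y. E (x - y) \<star> w y)" if "x \<in> ball x0 (\<rho> / 2)" for x
      by (rule integrable_far [OF cont(1) that])
    show "(\<lambda>y. pd j E (x - y) \<star> w y) \<in> borel_measurable lborel"
      using integrable_far [OF cont(2) x] by (rule borel_measurable_integrable)
    show "has_pd (\<lambda>x. E (x - y) \<star> w y) (pd j E (x - y) \<star> w y) j x" if "x \<in> ball x0 (\<rho> / 2)" for x y
    proof (cases "w y = 0")
      case True
      then show ?thesis using has_pd_const [of 0] by (simp add: cl.zero_right)
    next
      case False
      then have "y \<notin> ball x0 \<rho>" using w(3) by blast
      then have "y \<notin> ball x0 (\<rho> / 2)" using \<rho> by auto
      then have "x - y \<noteq> 0" using that by auto
      then show ?thesis
        using has_pd_bounded_linear [OF cl.bounded_linear_left has_pd_affine [of E "pd j E (x - y)" j 1 x "- y"]] d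
        by simp
    qed
  qed (use G x in auto)
qed

lemma ck_potential_far:
  assumes "ck k E (- {0})"
  shows "ck k (potential E w) (ball x0 (\<rho> / 2))"
  using assms
proof (induction k arbitrary: E)
  case 0
  from continuous_potential_far [OF ck_imp_continuous [OF 0]] show ?case by simp
next
  case (Suc k)
  show ?case
    by (rule ck_SucI_open [OF open_ball continuous_potential_far [OF ck_imp_continuous [OF Suc.prems]]
        has_pd_potential_far [OF ck_mono [OF Suc.prems]] Suc.IH [OF ck_SucE(2) [OF Suc.prems]]]) auto
qed

end

subsection \<open>Localization\<close>

lemma ex_plateau:
  fixes x0 :: "real ^ 'm::finite"
  assumes "\<rho> > 0"
  obtains \<eta> :: "real ^ 'm \<Rightarrow> real" where "ck k \<eta> UNIV" "\<And>x. x \<in> ball x0 \<rho> \<Longrightarrow> \<eta> x = 1"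
    "\<And>x. x \<notin> cball x0 (3 / 2 * \<rho>) \<Longrightarrow> \<eta> x = 0"
proof
  let ?\<eta> = "\<lambda>x. smooth_step k (2 - (\<Sum>i\<in>UNIV. (x $ i - x0 $ i) ^ 2) * inverse (\<rho> ^ 2))"
  have sq: "(\<Sum>i\<in>UNIV. (x $ i - x0 $ i) ^ 2) = dist x0 x ^ 2" for x
    unfolding dist_norm power2_norm_eq_inner by (simp add: inner_vec_def power2_eq_square algebra_simps)
  show "ck k ?\<eta> UNIV"
    by (intro ck_smooth_step ck_diff ck_mult ck_sum ck_power ck_coord ck_const open_UNIV)
  show "?\<eta> x = 1" if "x \<in> ball x0 \<rho>" for x
  proof -
    have "dist x0 x ^ 2 \<le> \<rho> ^ 2" using that by (intro power_mono) auto
    then have "dist x0 x ^ 2 * inverse (\<rho> ^ 2) \<le> 1" using assms by (simp add: divide_le_eq flip: divide_inverse)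
    then show ?thesis unfolding sq by (intro smooth_step_1) simp
  qed
  show "?\<eta> x = 0" if "x \<notin> cball x0 (3 / 2 * \<rho>)" for x
  proof -
    have "(3 / 2 * \<rho>) ^ 2 \<le> dist x0 x ^ 2" using that assms by (intro power_mono) auto
    moreover have "(3 / 2 * \<rho>) ^ 2 = 9 / 4 * \<rho> ^ 2" by (simp add: power_mult_distrib power_divide)
    ultimately have "2 * \<rho> ^ 2 \<le> dist x0 x ^ 2" using zero_le_power2 [of \<rho>] by linarith
    then have "2 \<le> dist x0 x ^ 2 * inverse (\<rho> ^ 2)" using assms by (simp add: le_divide_eq flip: divide_inverse)
    then show ?thesis unfolding sq by (intro smooth_step_0) simp
  qed
qed

lemma ck_extend_by_zero:
  fixes f :: "real ^ 'm::finite \<Rightarrow> 'b::real_normed_vector"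
  assumes "open U" "ck k f U" "closed C" "C \<subseteq> U" "\<And>x. x \<notin> C \<Longrightarrow> f x = 0"
  shows "ck k f UNIV"
proof (rule ck_local)
  fix x
  show "\<exists>V. open V \<and> x \<in> V \<and> ck k f V"
  proof (cases "x \<in> U")
    case False
    have "ck k f (- C) \<longleftrightarrow> ck k (\<lambda>_. 0 :: 'b) (- C)"
      by (rule ck_cong_open) (use assms in auto)
    with False assms show ?thesis by (intro exI [of _ "- C"]) (auto simp: ck_const)
  qed (use assms in blast)
qed

text \<open>
  Near a point where the density is smooth, a cutoff splits it into a smooth part \<open>g\<close> of compact
  support and a part \<open>w\<close> that vanishes near the point. Derivatives of the potential then fall on \<open>g\<close>
  in the first part and on the kernel in the second one.
\<close>

lemma localize_density:
  fixes h :: "'n::{finite,linorder} point \<Rightarrow> 'n clifford"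
  assumes h: "integrable lborel h" "\<And>x. norm x > R \<Longrightarrow> h x = 0" and U: "open U" "ck k h U" "x0 \<in> U"
  obtains \<rho> g w R' where "\<rho> > 0" "ball x0 \<rho> \<subseteq> U" "ck k g UNIV" "\<And>x. norm x > R' \<Longrightarrow> g x = 0"
    "integrable lborel w" "\<And>x. norm x > R' \<Longrightarrow> w x = 0" "\<And>x. x \<in> ball x0 \<rho> \<Longrightarrow> w x = 0"
    "\<And>x. h x = g x + w x"
proof -
  obtain e where e: "e > 0" "ball x0 e \<subseteq> U" using U(1,3) openE by blast
  define \<rho> where "\<rho> = e / 2"
  have \<rho>: "\<rho> > 0" using e by (simp add: \<rho>_def)
  obtain \<eta> :: "'n point \<Rightarrow> real" where \<eta>: "ck k \<eta> UNIV" "\<And>x. x \<in> ball x0 \<rho> \<Longrightarrow> \<eta> x = 1"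
    "\<And>x. x \<notin> cball x0 (3 / 2 * \<rho>) \<Longrightarrow> \<eta> x = 0"
    using ex_plateau [OF \<rho>] by metis
  define g where "g = (\<lambda>x. \<eta> x *\<^sub>R h x)"
  define R' where "R' = max R (norm x0 + 3 / 2 * \<rho>)"
  have "cball x0 (3 / 2 * \<rho>) \<subseteq> ball x0 e" using e(1) by (auto simp: \<rho>_def)
  then have sub: "cball x0 (3 / 2 * \<rho>) \<subseteq> U" using e(2) by blast
  have "ck k g U" unfolding g_def by (intro ck_scaleR U ck_subset [OF \<eta>(1)]) auto
  then have g: "ck k g UNIV"
    by (rule ck_extend_by_zero [OF U(1) _ closed_cball sub]) (simp add: g_def \<eta>(3))
  have g0: "g x = 0" if "norm x > R'" for x
  proof -
    have "dist x0 x > 3 / 2 * \<rho>" using that norm_triangle_ineq2 [of x x0] by (simp add: R'_def dist_norm norm_minus_commute)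
    then show ?thesis by (simp add: g_def \<eta>(3))
  qed
  show ?thesis
  proof (rule that [of \<rho> g R' "\<lambda>x. h x - g x"])
    show "ball x0 \<rho> \<subseteq> U" using sub by (rule subset_trans [rotated]) (use \<rho> in auto)
    show "integrable lborel (\<lambda>x. h x - g x)"
      by (intro Bochner_Integration.integrable_diff h integrable_compact_support [OF ck_imp_continuous [OF g] g0])
    show "h x - g x = 0" if "norm x > R'" for x
    proof -
      have "norm x > R" using that by (simp add: R'_def)
      then show ?thesis using h(2) g0 [OF that] by simp
    qed
    show "h x - g x = 0" if "x \<in> ball x0 \<rho>" for x using \<eta>(2) [OF that] by (simp add: g_def)
  qed (use \<rho> g g0 in auto)
qed

lemma potential_split:
  assumes E: "locally_integrable E" "continuous_on (- {0}) E" and \<rho>: "\<rho> > 0"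
    and g: "continuous_on UNIV g" "\<And>x. norm x > R \<Longrightarrow> g x = 0"
    and w: "integrable lborel w" "\<And>x. norm x > R \<Longrightarrow> w x = 0" "\<And>x. x \<in> ball x0 \<rho> \<Longrightarrow> w x = 0"
    and h: "\<And>x. h x = g x + w x" and x: "x \<in> ball x0 (\<rho> / 2)"
  shows "potential E h x = potential E g x + potential E w x"
  unfolding potential_def h cl.add_right
  by (intro Bochner_Integration.integral_add integrable_near [OF E(1) g] integrable_far [OF w \<rho> E(2) x])

proposition ck_potential:
  assumes E: "locally_integrable E" "ck k E (- {0})"
    and h: "integrable lborel h" "\<And>x. norm x > R \<Longrightarrow> h x = 0" and U: "open U" "ck k h U"
  shows "ck k (potential E h) U"
proof (rule ck_local)
  fix x0 assume "x0 \<in> U"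
  from localize_density [OF h U this] obtain \<rho> g w R' where \<rho>: "\<rho> > 0" "ball x0 \<rho> \<subseteq> U"
    and g: "ck k g UNIV" "\<And>x. norm x > R' \<Longrightarrow> g x = 0"
    and w: "integrable lborel w" "\<And>x. norm x > R' \<Longrightarrow> w x = 0" "\<And>x. x \<in> ball x0 \<rho> \<Longrightarrow> w x = 0"
    and hgw: "\<And>x. h x = g x + w x" by metis
  let ?B = "ball x0 (\<rho> / 2)"
  have "ck k (\<lambda>x. potential E g x + potential E w x) ?B"
    by (intro ck_add open_ball ck_potential_far [OF w \<rho>(1) E(2)] ck_subset [OF ck_potential_near [OF E(1) g]]) auto
  then have "ck k (potential E h) ?B"
    using ck_cong_open [OF open_ball, of x0 "\<rho> / 2" "potential E h" "\<lambda>x. potential E g x + potential E w x" k]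
      potential_split [OF E(1) ck_imp_continuous [OF E(2)] \<rho>(1) ck_imp_continuous [OF g(1)] g(2) w hgw] by simp
  then show "\<exists>V. open V \<and> x0 \<in> V \<and> ck k (potential E h) V"
    using \<rho>(1) by (intro exI [of _ ?B]) auto
qed

text \<open>
  In the sense of distributions \<open>E\<close> solves \<open>\<D> E = E' + c \<delta>\<close>, tested with smooth densities, and the
  equation also holds pointwise away from the origin.
\<close>

definition kernel_step ::
  "('n::{finite,linorder} point \<Rightarrow> 'n clifford) \<Rightarrow> ('n point \<Rightarrow> 'n clifford) \<Rightarrow> real \<Rightarrow> bool" where
  "kernel_step E E' c \<longleftrightarrow> locally_integrable E \<and> locally_integrable E' \<and>
     ck 1 E (- {0}) \<and> continuous_on (- {0}) E' \<and> (\<forall>x. x \<noteq> 0 \<longrightarrow> cauchy_riemann E x = E' x) \<and>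
     (\<forall>g R x. ck 1 g UNIV \<longrightarrow> (\<forall>x. norm x > R \<longrightarrow> g x = 0) \<longrightarrow>
        (\<Sum>j\<in>UNIV. cl_e j \<star> potential E (pd j g) x) = potential E' g x + c *\<^sub>R g x)"

text \<open>
  For \<open>g\<close> this is the tested equation, for \<open>w\<close> the pointwise one.
\<close>

proposition cauchy_riemann_potential:
  fixes h :: "'n::{finite,linorder} point \<Rightarrow> 'n clifford"
  assumes E: "kernel_step E E' c"
    and h: "integrable lborel h" "\<And>x. norm x > R \<Longrightarrow> h x = 0" and U: "open U" "ck 1 h U" "x0 \<in> U"
  shows "cauchy_riemann (potential E h) x0 = potential E' h x0 + c *\<^sub>R h x0"
proof -
  from localize_density [OF h U] obtain \<rho> g w R' where \<rho>: "\<rho> > 0" "ball x0 \<rho> \<subseteq> U"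
    and g: "ck 1 g UNIV" "\<And>x. norm x > R' \<Longrightarrow> g x = 0"
    and w: "integrable lborel w" "\<And>x. norm x > R' \<Longrightarrow> w x = 0" "\<And>x. x \<in> ball x0 \<rho> \<Longrightarrow> w x = 0"
    and hgw: "\<And>x. h x = g x + w x" by metis
  from E have li: "locally_integrable E" "locally_integrable E'" and ckE: "ck 1 E (- {0})"
    and cont: "continuous_on (- {0}) E'" and D: "\<And>x. x \<noteq> 0 \<Longrightarrow> cauchy_riemann E x = E' x"
    by (auto simp: kernel_step_def simp del: ck.simps)
  have x0: "x0 \<in> ball x0 (\<rho> / 2)" using \<rho> by simp
  have contg: "continuous_on UNIV g" by (rule ck_imp_continuous [OF g(1)])
  note split = potential_split [OF li(1) ck_imp_continuous [OF ckE] \<rho>(1) contg g(2) w hgw]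
  have "pd j (potential E h) x0 = potential E (pd j g) x0 + potential (pd j E) w x0" for j
  proof -
    have "pd j (potential E h) x0 = pd j (\<lambda>x. potential E g x + potential E w x) x0"
      by (rule pd_cong_open [OF open_ball x0 split])
    also have "\<dots> = potential E (pd j g) x0 + potential (pd j E) w x0"
      by (intro has_pd_imp_pd has_pd_add has_pd_potential_near [OF li(1) g]
          has_pd_potential_far [OF w \<rho>(1) ckE x0])
    finally show ?thesis .
  qed
  then have "cauchy_riemann (potential E h) x0
      = (\<Sum>j\<in>UNIV. cl_e j \<star> potential E (pd j g) x0) + (\<Sum>j\<in>UNIV. cl_e j \<star> potential (pd j E) w x0)"
    by (simp add: cauchy_riemann_def partial_deriv_eq_pd cl.add_right sum.distrib)
  also have "(\<Sum>j\<in>UNIV. cl_e j \<star> potential E (pd j g) x0) = potential E' g x0 + c *\<^sub>R g x0"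
    using E g unfolding kernel_step_def by blast
  also have "(\<Sum>j\<in>UNIV. cl_e j \<star> potential (pd j E) w x0) = potential E' w x0"
  proof -
    have int: "integrable lborel (\<lambda>y. pd j E (x0 - y) \<star> w y)" for j
      by (rule integrable_far [OF w \<rho>(1) ck_imp_continuous [OF ck_SucE(2) [OF ckE [unfolded One_nat_def]]] x0])
    have "(\<Sum>j\<in>UNIV. cl_e j \<star> potential (pd j E) w x0) = (\<Sum>j\<in>UNIV. \<integral>y. cl_e j \<star> (pd j E (x0 - y) \<star> w y) \<partial>lborel)"
      unfolding potential_def by (intro sum.cong refl integral_bounded_linear [symmetric] cl.bounded_linear_right int)
    also have "\<dots> = (\<integral>y. (\<Sum>j\<in>UNIV. cl_e j \<star> (pd j E (x0 - y) \<star> w y)) \<partial>lborel)"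
      by (intro Bochner_Integration.integral_sum [symmetric] integrable_bounded_linear [OF cl.bounded_linear_right int])
    also have "\<dots> = (\<integral>y. E' (x0 - y) \<star> w y \<partial>lborel)"
    proof (rule Bochner_Integration.integral_cong [OF refl])
      fix y
      show "(\<Sum>j\<in>UNIV. cl_e j \<star> (pd j E (x0 - y) \<star> w y)) = E' (x0 - y) \<star> w y"
      proof (cases "w y = 0")
        case False
        then have "y \<notin> ball x0 \<rho>" using w(3) by blast
        then have "x0 - y \<noteq> 0" using \<rho>(1) by auto
        from D [OF this] have eq: "E' (x0 - y) = (\<Sum>j\<in>UNIV. cl_e j \<star> pd j E (x0 - y))"
          by (simp add: cauchy_riemann_def partial_deriv_eq_pd)
        show ?thesis unfolding eq cl.sum_left cl_mult_assoc ..
      qed (simp add: cl.zero_right)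
    qed
    finally show ?thesis by (simp add: potential_def)
  qed
  also have "potential E' g x0 + c *\<^sub>R g x0 + potential E' w x0 = potential E' h x0 + c *\<^sub>R g x0"
    using potential_split [OF li(2) cont \<rho>(1) contg g(2) w hgw x0] by simp
  also have "g x0 = h x0" using hgw w(3) \<rho>(1) by simp
  finally show ?thesis .
qed

section \<open>Fundamental solutions of the powers of the Cauchy-Riemann operator\<close>

subsection \<open>Conjugation\<close>

fun cl_e_bar :: "'n::{finite,linorder} option \<Rightarrow> 'n clifford" where
  "cl_e_bar None = cl_one"
| "cl_e_bar (Some i) = - cl_e (Some i)"

definition cl_conj :: "'n::{finite,linorder} point \<Rightarrow> 'n clifford" where
  "cl_conj x = (\<Sum>j\<in>UNIV. x $ j *\<^sub>R cl_e_bar j)"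

lemma cl_e_cl_e_bar:
  "cl_e i \<star> cl_e_bar j + cl_e j \<star> cl_e_bar i = (if i = j then 2 else 0) *\<^sub>R cl_one"
proof (cases i)
  case i: None
  show ?thesis
    by (cases j) (simp_all add: i cl_one_left cl_one_right cl.minus_right scaleR_2 del: cl_e.simps(2))
next
  case i: (Some a)
  show ?thesis
  proof (cases j)
    case None
    then show ?thesis by (simp add: i cl_one_left cl_one_right cl.minus_right del: cl_e.simps(2))
  next
    case (Some b)
    have "cl_e i \<star> cl_e_bar j + cl_e j \<star> cl_e_bar i = - (cl_e (Some a) \<star> cl_e (Some b) + cl_e (Some b) \<star> cl_e (Some a))"
      by (simp add: i Some cl.minus_right del: cl_e.simps(2))
    then show ?thesis unfolding cl_e_anticommute by (simp add: i Some)
  qed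
qed

lemma cl_e_self_bar: "cl_e i \<star> cl_e_bar i = cl_one"
proof -
  have "2 *\<^sub>R (cl_e i \<star> cl_e_bar i) = 2 *\<^sub>R cl_one"
    using cl_e_cl_e_bar [of i i] by (simp add: scaleR_2)
  then show ?thesis by simp
qed

text \<open>
  Symmetrize the double sum: \<open>e\<^sub>i conj e\<^sub>j + e\<^sub>j conj e\<^sub>i\<close> is \<open>2\<close> on the diagonal and \<open>0\<close> off it.
\<close>

lemma sum_cl_e_cl_conj: "(\<Sum>i\<in>UNIV. x $ i *\<^sub>R (cl_e i \<star> cl_conj x)) = (x \<bullet> x) *\<^sub>R cl_one"
proof -
  let ?T = "\<Sum>i\<in>UNIV. \<Sum>j\<in>UNIV. (x $ i * x $ j) *\<^sub>R (cl_e i \<star> cl_e_bar j)"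
  have T: "(\<Sum>i\<in>UNIV. x $ i *\<^sub>R (cl_e i \<star> cl_conj x)) = ?T"
    by (simp add: cl_conj_def cl.sum_right cl.scaleR_right scaleR_sum_right)
  let ?T' = "\<Sum>i\<in>UNIV. \<Sum>j\<in>UNIV. (x $ i * x $ j) *\<^sub>R (cl_e j \<star> cl_e_bar i)"
  have swap: "?T = ?T'"
    by (subst sum.swap) (simp add: mult.commute)
  have "2 *\<^sub>R ?T = ?T + ?T'" by (simp only: scaleR_2 swap [symmetric])
  also have "\<dots> = (\<Sum>i\<in>UNIV. \<Sum>j\<in>UNIV. (x $ i * x $ j) *\<^sub>R (cl_e i \<star> cl_e_bar j + cl_e j \<star> cl_e_bar i))"
    by (simp only: sum.distrib scaleR_add_right)
  also have "\<dots> = (\<Sum>i\<in>UNIV. \<Sum>j\<in>UNIV. if i = j then (2 * (x $ i * x $ i)) *\<^sub>R cl_one else 0)"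
    unfolding cl_e_cl_e_bar by (intro sum.cong refl) auto
  also have "\<dots> = (2 * (x \<bullet> x)) *\<^sub>R cl_one"
    by (simp add: inner_vec_def scaleR_sum_left sum_distrib_left)
  finally have "(1 / 2) *\<^sub>R (2 *\<^sub>R ?T) = (1 / 2) *\<^sub>R ((2 * (x \<bullet> x)) *\<^sub>R cl_one)"
    by (rule arg_cong)
  then show ?thesis unfolding T scaleR_scaleR by simp
qed

lemma norm_cl_e_bar: "norm (cl_e_bar j) = 1"
  by (cases j) (simp_all add: cl_one_def norm_axis_1)

lemma norm_cl_conj_le:
  fixes x :: "'n::{finite,linorder} point"
  shows "norm (cl_conj x) \<le> real CARD('n option) * norm x"
proof -
  have "norm (cl_conj x) \<le> (\<Sum>j\<in>(UNIV :: 'n option set). norm x)"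
    unfolding cl_conj_def by (rule sum_norm_le) (simp add: norm_cl_e_bar component_le_norm_cart)
  then show ?thesis by simp
qed

lemma has_pd_cl_conj: "has_pd cl_conj (cl_e_bar i) i x"
proof -
  have "has_pd (\<lambda>x. \<Sum>j\<in>UNIV. x $ j *\<^sub>R cl_e_bar j) (\<Sum>j\<in>UNIV. (if j = i then 1 else 0) *\<^sub>R cl_e_bar j) i x"
    by (intro has_pd_sum has_pd_bounded_linear [OF bounded_linear_scaleR_left] has_pd_coord)
  moreover have "(\<Sum>j\<in>UNIV. (if j = i then 1 else 0) *\<^sub>R cl_e_bar j) = cl_e_bar i"
    by (simp add: if_distrib [where f = "\<lambda>c. c *\<^sub>R _"] cong: if_cong)
  ultimately show ?thesis by (simp add: cl_conj_def [abs_def])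
qed

lemma ck_cl_conj: "open U \<Longrightarrow> ck k cl_conj U"
  unfolding cl_conj_def [abs_def] by (intro ck_sum ck_scaleR ck_coord ck_const)

lemma has_pd_inner_self:
  fixes x :: "real ^ 'm::finite"
  shows "has_pd (\<lambda>x. x \<bullet> x) (2 * x $ i) i x"
proof -
  have "has_pd (\<lambda>x :: real ^ 'm. x) (axis i 1) i x"
    by (auto simp: has_pd_def intro!: derivative_eq_intros)
  from has_pd_bilinear [OF bounded_bilinear_inner this this]
  show ?thesis by (simp add: inner_axis inner_axis' mult.commute)
qed

subsection \<open>Kernels built from a radial profile\<close>

text \<open>
  The factor \<open>x\<^sub>0\<^sup>l / l!\<close> raises the order: \<open>x\<^sub>0\<close> is real and \<open>\<D> x\<^sub>0 = 1\<close>, so it contributes the kernel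
  with \<open>l - 1\<close>, while the radial part contributes a scalar which vanishes for the profile
  \<open>s powr - (N / 2)\<close> of \<open>s = \<bar>x\<bar>\<^sup>2\<close>.
\<close>

definition radial_kernel :: "nat \<Rightarrow> (real \<Rightarrow> real) \<Rightarrow> 'n::{finite,linorder} point \<Rightarrow> 'n clifford" where
  "radial_kernel l \<psi> x = (x $ None ^ l / fact l * \<psi> (x \<bullet> x)) *\<^sub>R cl_conj x"

definition radial_kernel_pd ::
  "nat \<Rightarrow> (real \<Rightarrow> real) \<Rightarrow> (real \<Rightarrow> real) \<Rightarrow> 'n option \<Rightarrow> 'n::{finite,linorder} point \<Rightarrow> 'n clifford" where
  "radial_kernel_pd l \<psi> \<psi>' i x =
     (x $ None ^ l / fact l * (\<psi>' (x \<bullet> x) * (2 * x $ i))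
       + (if i = None then real l * x $ None ^ (l - 1) / fact l else 0) * \<psi> (x \<bullet> x)) *\<^sub>R cl_conj x
     + (x $ None ^ l / fact l * \<psi> (x \<bullet> x)) *\<^sub>R cl_e_bar i"

fun prev_kernel :: "nat \<Rightarrow> (real \<Rightarrow> real) \<Rightarrow> 'n::{finite,linorder} point \<Rightarrow> 'n clifford" where
  "prev_kernel 0 \<psi> x = 0"
| "prev_kernel (Suc l) \<psi> x = radial_kernel l \<psi> x"

lemma has_pd_radial_kernel:
  assumes "(\<psi> has_real_derivative \<psi>' (x \<bullet> x)) (at (x \<bullet> x))"
  shows "has_pd (radial_kernel l \<psi>) (radial_kernel_pd l \<psi> \<psi>' i x) i x"
proof -
  have "has_pd (\<lambda>x. x $ None ^ l / fact l) ((real l * x $ None ^ (l - 1) / fact l) * (if None = i then 1 else 0)) i x"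
    by (rule has_pd_compose_real [OF has_pd_coord, of "\<lambda>t. t ^ l / fact l"])
       (auto intro!: derivative_eq_intros)
  moreover have "has_pd (\<lambda>x. \<psi> (x \<bullet> x)) (\<psi>' (x \<bullet> x) * (2 * x $ i)) i x"
    by (rule has_pd_compose_real [OF has_pd_inner_self assms])
  ultimately have "has_pd (\<lambda>x. x $ None ^ l / fact l * \<psi> (x \<bullet> x))
      (x $ None ^ l / fact l * (\<psi>' (x \<bullet> x) * (2 * x $ i))
       + ((real l * x $ None ^ (l - 1) / fact l) * (if None = i then 1 else 0)) * \<psi> (x \<bullet> x)) i x"
    by (rule has_pd_bilinear [OF bounded_bilinear_mult])
  from has_pd_bilinear [OF bounded_bilinear_scaleR this has_pd_cl_conj]
  show ?thesis
    unfolding radial_kernel_def [abs_def] radial_kernel_pd_def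
    by (rule back_subst [of "\<lambda>D. has_pd _ D i x"]) (cases i; simp add: add.commute)
qed

lemma sum_radial_kernel_pd:
  fixes x :: "'n::{finite,linorder} point"
  shows "(\<Sum>i\<in>UNIV. cl_e i \<star> radial_kernel_pd l \<psi> \<psi>' i x) = prev_kernel l \<psi> x
    + (x $ None ^ l / fact l * (2 * \<psi>' (x \<bullet> x) * (x \<bullet> x) + real CARD('n option) * \<psi> (x \<bullet> x))) *\<^sub>R cl_one"
proof -
  define a where "a = x $ None ^ l / fact l"
  define s where "s = x \<bullet> x"
  define b where "b = real l * x $ None ^ (l - 1) / fact l"
  have "(\<Sum>i\<in>UNIV. cl_e i \<star> radial_kernel_pd l \<psi> \<psi>' i x)
      = (\<Sum>i\<in>UNIV. (a * \<psi>' s * 2) *\<^sub>R (x $ i *\<^sub>R (cl_e i \<star> cl_conj x)))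
        + (\<Sum>i\<in>UNIV. if i = None then (b * \<psi> s) *\<^sub>R (cl_e i \<star> cl_conj x) else 0)
        + (\<Sum>i\<in>UNIV. (a * \<psi> s) *\<^sub>R (cl_e i \<star> cl_e_bar i))"
    unfolding sum.distrib [symmetric]
    by (intro sum.cong refl)
       (auto simp: radial_kernel_pd_def a_def s_def b_def cl.add_right cl.scaleR_right scaleR_add_left mult_ac)
  also have "(\<Sum>i\<in>UNIV. (a * \<psi>' s * 2) *\<^sub>R (x $ i *\<^sub>R (cl_e i \<star> cl_conj x))) = (a * \<psi>' s * 2 * s) *\<^sub>R cl_one"
    unfolding scaleR_sum_right [symmetric] sum_cl_e_cl_conj s_def by simp
  also have "(\<Sum>i\<in>UNIV. if i = None then (b * \<psi> s) *\<^sub>R (cl_e i \<star> cl_conj x) else 0) = prev_kernel l \<psi> x"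
    by (cases l) (simp_all add: cl_one_left radial_kernel_def b_def s_def divide_simps del: of_nat_Suc)
  also have "(\<Sum>i\<in>(UNIV :: 'n option set). (a * \<psi> s) *\<^sub>R (cl_e i \<star> cl_e_bar i)) = (a * (real CARD('n option) * \<psi> s)) *\<^sub>R cl_one"
    by (simp only: cl_e_self_bar sum_constant_scaleR scaleR_scaleR mult_ac)
  finally show ?thesis by (simp add: a_def s_def algebra_simps flip: scaleR_add_left)
qed

subsection \<open>The kernels\<close>

text \<open>
  Up to a constant factor, \<open>cr_kernel l\<close> is a fundamental solution of \<open>\<D>\<^sup>l\<^sup>+\<^sup>1\<close>, and \<open>cr_prev l\<close> is its image
  under \<open>\<D>\<close> away from the origin.
\<close>

definition cr_kernel :: "nat \<Rightarrow> 'n::{finite,linorder} point \<Rightarrow> 'n clifford" where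
  "cr_kernel l = radial_kernel l (\<lambda>s. s powr (- (real CARD('n option) / 2)))"

definition cr_prev :: "nat \<Rightarrow> 'n::{finite,linorder} point \<Rightarrow> 'n clifford" where
  "cr_prev l = prev_kernel l (\<lambda>s. s powr (- (real CARD('n option) / 2)))"

lemma cr_prev_simps: "cr_prev 0 = (\<lambda>_. 0)" "cr_prev (Suc l) = cr_kernel l"
  by (auto simp: cr_prev_def cr_kernel_def)

lemma ck_cr_kernel: "ck k (cr_kernel l) (- {0})"
proof -
  have "open (- {0 :: 'a point})" by auto
  moreover have "(\<lambda>x :: 'a point. x \<bullet> x) = (\<lambda>x. \<Sum>i\<in>UNIV. x $ i * x $ i)" by (simp add: inner_vec_def)
  then have "ck k (\<lambda>x :: 'a point. x \<bullet> x) (- {0})"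
    using \<open>open (- {0})\<close> by (simp only:) (intro ck_sum ck_mult ck_coord)
  ultimately show ?thesis
    unfolding cr_kernel_def radial_kernel_def [abs_def] divide_inverse
    by (intro ck_scaleR ck_mult ck_power ck_coord ck_const ck_powr ck_cl_conj) auto
qed

lemma cauchy_riemann_cr_kernel:
  fixes x :: "'n::{finite,linorder} point"
  assumes "x \<noteq> 0"
  shows "cauchy_riemann (cr_kernel l) x = cr_prev l x"
proof -
  define b where "b = real CARD('n option) / 2"
  have N: "real CARD('n option) = 2 * b" by (simp add: b_def)
  let ?\<psi>' = "\<lambda>s. - b * s powr (- b - 1)"
  have s: "x \<bullet> x > 0" using assms by simp
  have "pd i (cr_kernel l) x = radial_kernel_pd l (\<lambda>s. s powr - b) ?\<psi>' i x" for i
    unfolding cr_kernel_def b_def [symmetric]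
    by (rule has_pd_imp_pd [OF has_pd_radial_kernel]) (rule has_real_derivative_powr [OF s])
  moreover have cr_prev: "cr_prev l x = prev_kernel l (\<lambda>s. s powr - b) x"
    by (simp only: cr_prev_def b_def)
  ultimately have "cauchy_riemann (cr_kernel l) x = cr_prev l x
    + (x $ None ^ l / fact l * (2 * ?\<psi>' (x \<bullet> x) * (x \<bullet> x) + 2 * b * (x \<bullet> x) powr - b)) *\<^sub>R cl_one"
    by (simp only: cauchy_riemann_def partial_deriv_eq_pd sum_radial_kernel_pd cr_prev N)
  moreover have "(x \<bullet> x) powr (- b) = (x \<bullet> x) powr (- b - 1) * (x \<bullet> x)"
    using s by (simp add: powr_diff)
  then have "2 * ?\<psi>' (x \<bullet> x) * (x \<bullet> x) + 2 * b * (x \<bullet> x) powr - b = 0"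
    by (simp add: algebra_simps)
  ultimately show ?thesis by (simp only: mult_zero_right scaleR_zero_left add_0_right)
qed

lemma norm_radial_kernel_le:
  fixes x :: "'n::{finite,linorder} point"
  assumes "x \<noteq> 0 \<Longrightarrow> \<bar>\<psi> (x \<bullet> x)\<bar> \<le> C * (x \<bullet> x) powr (- (real CARD('n option) / 2))" "C \<ge> 0"
  shows "norm (radial_kernel l \<psi> x) \<le> C * real CARD('n option) * norm x powr (real l + 1 - real CARD('n option))"
proof (cases "x = 0")
  case True
  then show ?thesis using assms(2) by (simp add: radial_kernel_def cl_conj_def)
next
  case False
  let ?N = "real CARD('n option)"
  have x: "norm x > 0" using False by simp
  have e: "x \<bullet> x = norm x powr 2" using x by (simp add: dot_square_norm powr_numeral)
  have p: "(x \<bullet> x) powr (- (?N / 2)) = norm x powr (- ?N)" unfolding e powr_powr by (intro arg_cong2 [where f = "(powr)"] refl) linarith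
  have "\<bar>x $ None ^ l / fact l\<bar> \<le> norm x ^ l / 1"
    unfolding abs_divide power_abs
    by (intro frac_le power_mono component_le_norm_cart) (auto simp: fact_ge_1)
  then have a: "\<bar>x $ None ^ l / fact l\<bar> \<le> norm x powr real l" using x by (simp add: powr_realpow)
  have "norm (radial_kernel l \<psi> x) = \<bar>x $ None ^ l / fact l\<bar> * \<bar>\<psi> (x \<bullet> x)\<bar> * norm (cl_conj x)"
    by (simp add: radial_kernel_def abs_mult)
  also have "\<dots> \<le> norm x powr real l * (C * norm x powr (- ?N)) * (?N * norm x)"
    using a assms False p norm_cl_conj_le [of x] by (intro mult_mono) auto
  also have "\<dots> = C * ?N * (norm x powr real l * norm x powr (- ?N) * norm x powr 1)"
    using x by simp
  also have "norm x powr real l * norm x powr (- ?N) * norm x powr 1 = norm x powr (real l + 1 - ?N)"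
    by (simp only: powr_add [symmetric]) (simp add: algebra_simps)
  finally show ?thesis .
qed

lemma norm_cr_kernel_le:
  fixes x :: "'n::{finite,linorder} point"
  shows "norm (cr_kernel l x) \<le> real CARD('n option) * norm x powr (real l + 1 - real CARD('n option))"
  using norm_radial_kernel_le [of x "\<lambda>s. s powr (- (real CARD('n option) / 2))" 1 l] by (simp add: cr_kernel_def)

lemma borel_measurable_cr_kernel [measurable]: "cr_kernel l \<in> borel_measurable borel"
  using borel_measurable_continuous_countable_exceptions [OF _ ck_imp_continuous [OF ck_cr_kernel]] by simp

subsection \<open>Integrability of powers of the distance\<close>

text \<open>
  On the shell between two consecutive balls of radius \<open>R / 2 ^ i\<close> the function is at most its value on
  the inner sphere, so the integral is dominated by a geometric series with ratio \<open>2 powr (a - DIM('a))\<close>.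
\<close>

lemma integrable_norm_powr:
  fixes a R :: real
  assumes a: "0 \<le> a" "a < real DIM('a)" and R: "R > 0"
  shows "integrable lborel (\<lambda>y :: 'a::euclidean_space. indicator (cball 0 R) y * norm y powr (- a))"
proof (rule integrableI_nonneg)
  define c where "c i = (R / 2 ^ Suc i) powr (- a)" for i :: nat
  define V where "V = unit_ball_vol (real DIM('a))"
  let ?B = "\<lambda>i. cball (0 :: 'a) (R / 2 ^ i)"
  have "(\<integral>\<^sup>+ y. ennreal (indicator (cball 0 R) y * norm y powr (- a)) \<partial>(lborel :: 'a measure))
      \<le> (\<integral>\<^sup>+ y. (\<Sum>i. ennreal (c i) * indicator (?B i) y) \<partial>lborel)"
  proof (rule nn_integral_mono)
    fix y :: 'a
    show "ennreal (indicator (cball 0 R) y * norm y powr (- a)) \<le> (\<Sum>i. ennreal (c i) * indicator (?B i) y)"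
    proof (cases "y = 0 \<or> norm y > R")
      case False
      then have y: "norm y > 0" "norm y \<le> R" by auto
      have "(\<lambda>i. R * (1 / 2) ^ i) \<longlonglongrightarrow> 0"
        by (rule tendsto_mult_right_zero, rule LIMSEQ_power_zero) simp
      from order_tendstoD(2) [OF this y(1)] have "\<forall>\<^sub>F i in sequentially. R * (1 / 2) ^ i < norm y" .
      then obtain i0 where "R / 2 ^ i0 < norm y" by (auto simp: eventually_sequentially power_divide)
      moreover have "R / 2 ^ Suc i0 \<le> R / 2 ^ i0" using R by (simp add: divide_simps)
      ultimately have ex: "\<exists>i. R / 2 ^ Suc i \<le> norm y" by (intro exI [of _ i0]) linarith
      define i where "i = (LEAST i. R / 2 ^ Suc i \<le> norm y)"
      have i1: "R / 2 ^ Suc i \<le> norm y" unfolding i_def by (rule LeastI_ex [OF ex])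
      have i2: "norm y \<le> R / 2 ^ i"
      proof (cases i)
        case (Suc k)
        then show ?thesis using not_less_Least [of k "\<lambda>i. R / 2 ^ Suc i \<le> norm y"] by (simp add: i_def not_le)
      qed (use y in simp)
      have "norm y powr (- a) \<le> c i" unfolding c_def using i1 a R by (intro powr_mono2') auto
      then have "ennreal (indicator (cball 0 R) y * norm y powr (- a)) \<le> ennreal (c i) * indicator (?B i) y"
        using i2 y by (simp add: ennreal_leI)
      also have "\<dots> \<le> (\<Sum>i. ennreal (c i) * indicator (?B i) y)"
      proof -
        define F where "F j = ennreal (c j) * indicator (?B j) y" for j
        have "sum F {i} \<le> suminf F" by (rule sum_le_suminf) auto
        then show ?thesis by (simp only: sum.insert sum.empty F_def [abs_def] finite.emptyI empty_iff not_False_eq_True add_0_right)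
      qed
      finally show ?thesis .
    qed auto
  qed
  also have "\<dots> = (\<Sum>i. \<integral>\<^sup>+ y. ennreal (c i) * indicator (?B i) y \<partial>lborel)"
  proof (rule nn_integral_suminf)
    have [measurable]: "?B i \<in> sets borel" for i by (rule borel_closed) simp
    show "(\<lambda>y. ennreal (c i) * indicator (?B i) y) \<in> borel_measurable lborel" for i by measurable
  qed
  also have "\<dots> = (\<Sum>i. ennreal ((R powr (- a) * 2 powr a * V * R ^ DIM('a)) * (2 powr (a - real DIM('a))) ^ i))"
  proof (rule suminf_cong)
    fix i
    have "(\<integral>\<^sup>+ y. ennreal (c i) * indicator (?B i) y \<partial>lborel) = ennreal (c i) * emeasure lborel (?B i)"
      by (rule nn_integral_cmult_indicator) simp
    also have "\<dots> = ennreal (c i * (V * (R / 2 ^ i) ^ DIM('a)))"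
      using R by (subst emeasure_cball) (simp_all add: V_def c_def ennreal_mult)
    also have "c i * (V * (R / 2 ^ i) ^ DIM('a)) = (R powr (- a) * 2 powr a * V * R ^ DIM('a)) * (2 powr (a - real DIM('a))) ^ i"
    proof -
      have p2: "(2 ^ n) powr a = (2 powr a) ^ n" for n :: nat
        by (induction n) (simp_all add: powr_mult)
      have "c i = R powr (- a) / (2 ^ Suc i) powr (- a)"
        unfolding c_def by (rule powr_divide)
      also have "\<dots> = R powr (- a) * (2 powr a) ^ Suc i"
        unfolding powr_minus [of _ a] p2 by (simp add: divide_inverse)
      finally have "c i = R powr (- a) * (2 powr a) ^ Suc i" .
      moreover have "(R / 2 ^ i) ^ DIM('a) = R ^ DIM('a) / (2 ^ DIM('a)) ^ i"
        unfolding power_divide power_mult [symmetric] by (simp only: mult.commute)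
      moreover have "2 powr (a - real DIM('a)) = 2 powr a / 2 ^ DIM('a)"
        by (simp add: powr_diff powr_realpow)
      ultimately show ?thesis by (simp only: power_divide power_Suc) (simp add: field_simps)
    qed
    finally show "(\<integral>\<^sup>+ y. ennreal (c i) * indicator (?B i) y \<partial>lborel)
      = ennreal ((R powr (- a) * 2 powr a * V * R ^ DIM('a)) * (2 powr (a - real DIM('a))) ^ i)" .
  qed
  also have "\<dots> < \<infinity>"
  proof -
    have "2 powr (a - real DIM('a)) < 1" using a by (subst powr_less_one) auto
    then have "summable (\<lambda>i. (R powr (- a) * 2 powr a * V * R ^ DIM('a)) * (2 powr (a - real DIM('a))) ^ i)"
      by (intro summable_mult summable_geometric) simp
    then show ?thesis
      using R by (subst suminf_ennreal2) (auto simp: V_def intro!: mult_nonneg_nonneg)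
  qed
  finally show "(\<integral>\<^sup>+ y. ennreal (indicator (cball 0 R) y * norm y powr (- a)) \<partial>(lborel :: 'a measure)) < \<infinity>" .
  show "(\<lambda>y :: 'a. indicator (cball 0 R) y * norm y powr (- a)) \<in> borel_measurable lborel"
    unfolding measurable_lborel2
    by (intro borel_measurable_times borel_measurable_indicator borel_closed closed_cball
        powr_real_measurable borel_measurable_norm borel_measurable_const measurable_ident)
qed auto

lemma integrable_kernel_bound:
  "integrable lborel (\<lambda>y :: 'n::{finite,linorder} point.
     indicator (cball 0 R) y * norm y powr (real l + 1 - real CARD('n option)))"
proof -
  let ?N = "real CARD('n option)"
  define Q where "Q = max R 1"
  have N: "?N \<ge> 1" by simp
  have "integrable lborel (\<lambda>y :: 'n point. Q ^ l * (indicator (cball 0 Q) y * norm y powr (- (?N - 1))))"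
    by (intro integrable_mult_right integrable_norm_powr) (auto simp: Q_def)
  then show ?thesis
  proof (rule Bochner_Integration.integrable_bound)
    show "AE y :: 'n point in lborel. norm (indicator (cball 0 R) y * norm y powr (real l + 1 - ?N))
        \<le> norm (Q ^ l * (indicator (cball 0 Q) y * norm y powr (- (?N - 1))))"
    proof (rule AE_I2)
      fix y :: "'n point"
      show "norm (indicator (cball 0 R) y * norm y powr (real l + 1 - ?N))
        \<le> norm (Q ^ l * (indicator (cball 0 Q) y * norm y powr (- (?N - 1))))"
      proof (cases "y = 0 \<or> norm y > R")
        case False
        then have y: "norm y > 0" "norm y \<le> R" "norm y \<le> Q" by (auto simp: Q_def)
        have "norm y powr (real l + 1 - ?N) = norm y powr (real l + (- (?N - 1)))" by (simp add: algebra_simps)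
        also have "\<dots> = norm y ^ l * norm y powr (- (?N - 1))" using y by (subst powr_add) (simp add: powr_realpow)
        also have "\<dots> \<le> Q ^ l * norm y powr (- (?N - 1))"
          using y by (intro mult_right_mono power_mono) auto
        finally show ?thesis using y by (simp add: abs_mult Q_def)
      qed auto
    qed
    show "(\<lambda>y :: 'n point. indicator (cball 0 R) y * norm y powr (real l + 1 - ?N)) \<in> borel_measurable lborel"
      unfolding measurable_lborel2
      by (intro borel_measurable_times borel_measurable_indicator borel_closed closed_cball
          powr_real_measurable borel_measurable_norm borel_measurable_const measurable_ident)
  qed
qed

lemma locally_integrable_cr_kernel: "locally_integrable (cr_kernel l :: 'n::{finite,linorder} point \<Rightarrow> 'n clifford)"
  unfolding locally_integrable_def
proof (intro conjI allI)
  fix R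
  show "integrable lborel (\<lambda>y. indicator (cball 0 R) y * norm (cr_kernel l y :: 'n clifford))"
  proof (rule Bochner_Integration.integrable_bound)
    show "integrable lborel (\<lambda>y :: 'n point. real CARD('n option) * (indicator (cball 0 R) y * norm y powr (real l + 1 - real CARD('n option))))"
      by (intro integrable_mult_right integrable_kernel_bound)
    show "AE y in lborel. norm (indicator (cball 0 R) y * norm (cr_kernel l y :: 'n clifford))
      \<le> norm (real CARD('n option) * (indicator (cball 0 R) y * norm y powr (real l + 1 - real CARD('n option))))"
      using norm_cr_kernel_le by (intro AE_I2) (auto simp: indicator_def abs_mult)
    show "(\<lambda>y. indicator (cball 0 R) y * norm (cr_kernel l y :: 'n clifford)) \<in> borel_measurable lborel"
      unfolding measurable_lborel2
      by (intro borel_measurable_times borel_measurable_indicator borel_closed closed_cball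
          measurable_compose [OF borel_measurable_cr_kernel borel_measurable_norm])
  qed
qed (rule borel_measurable_cr_kernel)

lemma locally_integrable_cr_prev: "locally_integrable (cr_prev l)"
  by (cases l) (simp_all add: cr_prev_simps locally_integrable_cr_kernel, simp add: locally_integrable_def)

subsection \<open>Regularization at the origin\<close>

text \<open>
  Below \<open>q\<close> the profile \<open>s powr - \<beta>\<close> is replaced by its tangent line at \<open>q\<close>. For
  \<open>\<beta> = (n + 1) / 2\<close> and \<open>l = 0\<close> this makes \<open>\<D>\<close> of the kernel a positive multiple of
  \<open>max 0 (1 - \<bar>x\<bar>\<^sup>2 / q)\<close>, an approximate identity of compact support.
\<close>

definition tangent_profile :: "real \<Rightarrow> real \<Rightarrow> real \<Rightarrow> real" where
  "tangent_profile \<beta> q s = max s q powr (- \<beta>) + \<beta> * q powr (- \<beta> - 1) * max 0 (q - s)"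

definition tangent_profile_deriv :: "real \<Rightarrow> real \<Rightarrow> real \<Rightarrow> real" where
  "tangent_profile_deriv \<beta> q s = - \<beta> * max s q powr (- \<beta> - 1)"

text \<open>
  At \<open>q\<close> itself the profile is everywhere one of two functions with the same value and derivative there.
\<close>

lemma DERIV_glue:
  fixes F G H :: "real \<Rightarrow> real"
  assumes F: "(F has_real_derivative D) (at x)" and G: "(G has_real_derivative D) (at x)"
    and eq: "F x = G x" "\<And>y. H y = F y \<or> H y = G y"
  shows "(H has_real_derivative D) (at x)"
  unfolding DERIV_def
proof (rule tendstoI)
  fix e :: real assume e: "e > 0"
  have "\<forall>\<^sub>F h in at 0. dist ((F (x + h) - F x) / h) D < e" "\<forall>\<^sub>F h in at 0. dist ((G (x + h) - G x) / h) D < e"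
    using F G e unfolding DERIV_def by (auto dest: tendstoD)
  then show "\<forall>\<^sub>F h in at 0. dist ((H (x + h) - H x) / h) D < e"
  proof eventually_elim
    case (elim h)
    have "H x = F x" using eq by metis
    with eq(2) [of "x + h"] eq(1) elim show ?case by metis
  qed
qed

context
  fixes \<beta> q :: real
  assumes q: "q > 0" and \<beta>: "\<beta> > 0"
begin

lemma DERIV_tangent_profile:
  "(tangent_profile \<beta> q has_real_derivative tangent_profile_deriv \<beta> q s) (at s)"
proof -
  let ?F = "\<lambda>s. s powr (- \<beta>)" and ?G = "\<lambda>s. q powr (- \<beta>) + \<beta> * q powr (- \<beta> - 1) * (q - s)"
  have F: "(?F has_real_derivative - \<beta> * s powr (- \<beta> - 1)) (at s)" if "s > 0" for s
    by (rule has_real_derivative_powr [OF that])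
  have G: "(?G has_real_derivative - \<beta> * q powr (- \<beta> - 1)) (at s)" for s
    by (auto intro!: derivative_eq_intros)
  have eqF: "tangent_profile \<beta> q y = ?F y" if "y \<ge> q" for y
    using that by (simp add: tangent_profile_def max_def)
  have eqG: "tangent_profile \<beta> q y = ?G y" if "y \<le> q" for y
    using that by (simp add: tangent_profile_def max_def)
  consider "s < q" | "s = q" | "s > q" by linarith
  then show ?thesis
  proof cases
    case 1
    have "(tangent_profile \<beta> q has_real_derivative - \<beta> * q powr (- \<beta> - 1)) (at s)"
    proof (rule DERIV_cong_ev [OF refl _ refl, THEN iffD2, OF _ G])
      show "\<forall>\<^sub>F y in nhds s. tangent_profile \<beta> q y = ?G y"
        using eventually_nhds_in_open [of "{..<q}" s] 1 eqG by (auto elim!: eventually_mono)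
    qed
    with 1 show ?thesis by (simp add: tangent_profile_deriv_def max_def)
  next
    case 2
    have "tangent_profile \<beta> q y = ?F y \<or> tangent_profile \<beta> q y = ?G y" for y
      using eqF [of y] eqG [of y] by linarith
    from DERIV_glue [OF F [OF q] G _ this] show ?thesis
      unfolding 2 by (simp add: tangent_profile_deriv_def)
  next
    case 3
    have "(tangent_profile \<beta> q has_real_derivative - \<beta> * s powr (- \<beta> - 1)) (at s)"
    proof (rule DERIV_cong_ev [OF refl _ refl, THEN iffD2, OF _ F])
      show "\<forall>\<^sub>F y in nhds s. tangent_profile \<beta> q y = ?F y"
        using eventually_nhds_in_open [of "{q<..}" s] 3 eqF by (auto elim!: eventually_mono)
    qed (use 3 q in simp)
    with 3 show ?thesis by (simp add: tangent_profile_deriv_def max_def)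
  qed
qed

lemma continuous_tangent_profile:
  "continuous_on UNIV (tangent_profile \<beta> q)" "continuous_on UNIV (tangent_profile_deriv \<beta> q)"
proof -
  have m: "max s q \<noteq> 0" for s using q by (simp add: max_def)
  show "continuous_on UNIV (tangent_profile \<beta> q)" "continuous_on UNIV (tangent_profile_deriv \<beta> q)"
    unfolding tangent_profile_def [abs_def] tangent_profile_deriv_def [abs_def]
    using m by (auto intro!: continuous_intros)
qed

lemma tangent_profile_eq: "q \<le> s \<Longrightarrow> tangent_profile \<beta> q s = s powr (- \<beta>)"
  by (simp add: tangent_profile_def max_def)

lemma tangent_profile_below: "s \<le> q \<Longrightarrow> tangent_profile \<beta> q s = q powr (- \<beta>) * (1 + \<beta> - \<beta> * s / q)"
  using q by (simp add: tangent_profile_def max_def powr_diff field_simps)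

lemma abs_tangent_profile_le:
  assumes "s > 0"
  shows "\<bar>tangent_profile \<beta> q s\<bar> \<le> (1 + \<beta>) * s powr (- \<beta>)"
proof (cases "q \<le> s")
  case True
  then show ?thesis using \<beta> by (simp add: tangent_profile_eq algebra_simps)
next
  case False
  then have "0 \<le> \<beta> * s / q" "\<beta> * s / q \<le> \<beta>" using assms \<beta> q by (auto simp: divide_le_eq)
  then have "\<bar>1 + \<beta> - \<beta> * s / q\<bar> \<le> 1 + \<beta>" by linarith
  moreover have "q powr (- \<beta>) \<le> s powr (- \<beta>)" using assms False \<beta> by (intro powr_mono2') auto
  ultimately have "q powr (- \<beta>) * \<bar>1 + \<beta> - \<beta> * s / q\<bar> \<le> s powr (- \<beta>) * (1 + \<beta>)"
    using \<beta> by (intro mult_mono) auto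
  then show ?thesis using False by (simp add: tangent_profile_below abs_mult mult.commute)
qed

lemma tangent_profile_density:
  "2 * tangent_profile_deriv \<beta> q s * s + 2 * \<beta> * tangent_profile \<beta> q s
    = 2 * \<beta> * (1 + \<beta>) * q powr (- \<beta>) * max 0 (1 - s / q)"
proof (cases "q \<le> s")
  case True
  then have "s powr (- \<beta> - 1) * s = s powr (- \<beta>)" "max 0 (1 - s / q) = 0"
    using q by (auto simp: powr_diff)
  then show ?thesis using True by (simp add: tangent_profile_eq tangent_profile_deriv_def)
next
  case False
  then have s: "s \<le> q" "max s q = q" by auto
  have "max 0 (1 - s / q) = 1 - s / q" using False q by (auto simp: max_def divide_le_eq)
  moreover have "q powr (- \<beta> - 1) = q powr (- \<beta>) / q" using q by (simp add: powr_diff)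
  ultimately show ?thesis
    unfolding tangent_profile_below [OF s(1)] tangent_profile_deriv_def s(2) by (simp add: algebra_simps)
qed

lemma regular_kernel:
  fixes y :: "'n::{finite,linorder} point"
  shows "has_pd (radial_kernel l (tangent_profile \<beta> q)) (radial_kernel_pd l (tangent_profile \<beta> q) (tangent_profile_deriv \<beta> q) j y) j y"
    and "ck 1 (radial_kernel l (tangent_profile \<beta> q) :: 'n point \<Rightarrow> _) UNIV"
proof -
  show 1: "has_pd (radial_kernel l (tangent_profile \<beta> q)) (radial_kernel_pd l (tangent_profile \<beta> q) (tangent_profile_deriv \<beta> q) j y) j y"
    for j and y :: "'n point"
    by (rule has_pd_radial_kernel, rule DERIV_tangent_profile)
  have c: "continuous_on UNIV (\<lambda>y :: 'n point. tangent_profile \<beta> q (y \<bullet> y))"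
    by (rule continuous_on_compose2 [OF continuous_tangent_profile(1)]) (auto intro!: continuous_intros)
  have c': "continuous_on UNIV (\<lambda>y :: 'n point. tangent_profile_deriv \<beta> q (y \<bullet> y))"
    by (rule continuous_on_compose2 [OF continuous_tangent_profile(2)]) (auto intro!: continuous_intros)
  have conj: "continuous_on UNIV (cl_conj :: 'n point \<Rightarrow> _)"
    by (rule ck_imp_continuous [OF ck_cl_conj [OF open_UNIV]])
  have "ck (Suc 0) (radial_kernel l (tangent_profile \<beta> q) :: 'n point \<Rightarrow> _) UNIV"
  proof (rule ck_SucI_open [OF open_UNIV _ 1])
    show "continuous_on UNIV (radial_kernel l (tangent_profile \<beta> q) :: 'n point \<Rightarrow> _)"
      unfolding radial_kernel_def [abs_def] divide_inverse by (intro continuous_intros c conj)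
    show "ck 0 (\<lambda>y :: 'n point. radial_kernel_pd l (tangent_profile \<beta> q) (tangent_profile_deriv \<beta> q) j y) UNIV" for j
    proof -
      have ci: "continuous_on UNIV (\<lambda>y :: 'n point. if j = None then real l * y $ None ^ (l - 1) * inverse (fact l) else 0)"
        by (cases "j = None") (auto intro!: continuous_intros)
      show ?thesis
        unfolding radial_kernel_pd_def ck.simps(1) divide_inverse
        by (intro ci continuous_on_add continuous_on_mult continuous_on_scaleR continuous_on_const
            continuous_on_power continuous_on_component continuous_on_id c c' conj)
    qed
  qed
  then show "ck 1 (radial_kernel l (tangent_profile \<beta> q) :: 'n point \<Rightarrow> _) UNIV" by simp
qed

end

subsection \<open>Passage to the limit\<close>

lemma integral_dilation:
  fixes f :: "'a::euclidean_space \<Rightarrow> 'b::{banach, second_countable_topology}"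
  assumes "f \<in> borel_measurable borel" "\<epsilon> > 0"
  shows "(\<integral>y. f y \<partial>lborel) = (\<integral>z. \<epsilon> ^ DIM('a) *\<^sub>R f (\<epsilon> *\<^sub>R z) \<partial>lborel)"
proof -
  have "(\<integral>y. f y \<partial>lborel) = (\<integral>y. f y \<partial>density (distr lborel borel (\<lambda>z. 0 + \<epsilon> *\<^sub>R z)) (\<lambda>_. ennreal (\<bar>\<epsilon>\<bar> ^ DIM('a))))"
    using lborel_affine [of \<epsilon> "0 :: 'a"] assms(2) by simp
  also have "\<dots> = (\<integral>y. \<bar>\<epsilon>\<bar> ^ DIM('a) *\<^sub>R f y \<partial>distr lborel borel (\<lambda>z. 0 + \<epsilon> *\<^sub>R z))"
    using assms by (intro integral_density) auto
  also have "\<dots> = (\<integral>z. \<bar>\<epsilon>\<bar> ^ DIM('a) *\<^sub>R f (0 + \<epsilon> *\<^sub>R z) \<partial>lborel)"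
    using assms by (intro integral_distr) auto
  finally show ?thesis using assms(2) by simp
qed

text \<open>
  The sign from integrating by parts cancels the sign from differentiating \<open>g (x - y)\<close> in \<open>y\<close>. The
  coefficients \<open>e\<^sub>j\<close> stay on the left, and associativity lets them act on the kernel.
\<close>

lemma integral_by_parts:
  fixes E g :: "'n::{finite,linorder} point \<Rightarrow> 'n clifford"
  assumes E: "ck 1 E UNIV" and g: "ck 1 g UNIV" "\<And>x. norm x > R \<Longrightarrow> g x = 0"
  shows "(\<Sum>j\<in>UNIV. cl_e j \<star> (\<integral>y. E y \<star> pd j g (x - y) \<partial>lborel))
    = (\<integral>y. (\<Sum>j\<in>UNIV. cl_e j \<star> pd j E y) \<star> g (x - y) \<partial>lborel)"
proof -
  have cont: "continuous_on UNIV E" "continuous_on UNIV (pd j E)" "continuous_on UNIV g" "continuous_on UNIV (pd j g)"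
    and d: "has_pd E (pd j E y) j y" "has_pd g (pd j g y) j y" for j y
    using E g(1) by auto
  have far: "norm (x - y) > R" if "norm y > R + norm x" for y
    using that norm_triangle_ineq2 [of y x] by (simp add: norm_minus_commute)
  have pd0: "pd j g z = 0" if "norm z > R" for j z
    by (rule pd_eq_0_outside [of "cball 0 R"]) (use g(2) that in \<open>auto simp: not_le\<close>)
  have g_refl: "continuous_on UNIV (\<lambda>y. g (x - y))"
    by (rule continuous_on_compose2 [OF cont(3)]) (auto intro!: continuous_intros)
  have g_refl': "continuous_on UNIV (\<lambda>y. pd j g (x - y))" for j
    by (rule continuous_on_compose2 [OF cont(4)]) (auto intro!: continuous_intros)
  have int: "integrable lborel (\<lambda>y. E y \<star> pd j g (x - y))" "integrable lborel (\<lambda>y. pd j E y \<star> g (x - y))" for j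
  proof -
    show "integrable lborel (\<lambda>y. E y \<star> pd j g (x - y))"
      by (rule integrable_compact_support [of _ "R + norm x"])
         (use cont g_refl' far pd0 in \<open>auto intro!: cl.continuous_on simp: cl.zero_right\<close>)
    show "integrable lborel (\<lambda>y. pd j E y \<star> g (x - y))"
      by (rule integrable_compact_support [of _ "R + norm x"])
         (use cont g_refl far g(2) in \<open>auto intro!: cl.continuous_on simp: cl.zero_right\<close>)
  qed
  have parts: "(\<integral>y. E y \<star> pd j g (x - y) \<partial>lborel) = (\<integral>y. pd j E y \<star> g (x - y) \<partial>lborel)" for j
  proof -
    let ?H = "\<lambda>y. E y \<star> g ((-1) *\<^sub>R y + x)"
    have "ck 1 ?H UNIV"
      by (rule ck_bilinear [OF open_UNIV bounded_bilinear_cl_mult E ck_affine [OF g(1)]])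
    moreover have "?H y = 0" if "norm y > R + norm x" for y
      using g(2) [OF far [OF that]] by (simp add: cl.zero_right)
    ultimately have "(\<integral>y. pd j ?H y \<partial>lborel) = 0" by (rule integral_pd_eq_0)
    moreover have "pd j ?H y = pd j E y \<star> g (x - y) - E y \<star> pd j g (x - y)" for y
    proof -
      have h: "has_pd ?H (E y \<star> ((-1) *\<^sub>R pd j g ((-1) *\<^sub>R y + x)) + pd j E y \<star> g ((-1) *\<^sub>R y + x)) j y"
        by (rule has_pd_bilinear [OF bounded_bilinear_cl_mult d(1) has_pd_affine [OF d(2)]])
      show ?thesis unfolding has_pd_imp_pd [OF h] by (simp add: cl.minus_right)
    qed
    ultimately show ?thesis using int by simp
  qed
  have "(\<Sum>j\<in>UNIV. cl_e j \<star> (\<integral>y. E y \<star> pd j g (x - y) \<partial>lborel))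
      = (\<Sum>j\<in>UNIV. \<integral>y. cl_e j \<star> (pd j E y \<star> g (x - y)) \<partial>lborel)"
    unfolding parts by (intro sum.cong refl integral_bounded_linear [symmetric] cl.bounded_linear_right int)
  also have "\<dots> = (\<integral>y. (\<Sum>j\<in>UNIV. cl_e j \<star> (pd j E y \<star> g (x - y))) \<partial>lborel)"
    by (intro Bochner_Integration.integral_sum [symmetric] integrable_bounded_linear [OF cl.bounded_linear_right int(2)])
  also have "\<dots> = (\<integral>y. (\<Sum>j\<in>UNIV. cl_e j \<star> pd j E y) \<star> g (x - y) \<partial>lborel)"
    unfolding cl.sum_left cl_mult_assoc ..
  finally show ?thesis .
qed

text \<open>
  The radii of regularization; the profiles are functions of \<open>\<bar>x\<bar>\<^sup>2\<close>, hence the squares below.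
\<close>

definition shrink :: "nat \<Rightarrow> real" where
  "shrink i = inverse (real (Suc i))"

lemma shrink: "shrink i > 0" "shrink i \<le> 1" "shrink \<longlonglongrightarrow> 0"
proof -
  show "shrink i > 0" "shrink i \<le> 1" by (simp_all add: shrink_def inverse_le_1_iff)
  show "shrink \<longlonglongrightarrow> 0" unfolding shrink_def [abs_def] by (rule LIMSEQ_inverse_real_of_nat)
qed

abbreviation regularized :: "nat \<Rightarrow> nat \<Rightarrow> 'n::{finite,linorder} point \<Rightarrow> 'n clifford" where
  "regularized l i \<equiv> radial_kernel l (tangent_profile (real CARD('n option) / 2) (shrink i ^ 2))"

lemma convolution_regularized_tendsto:
  fixes \<phi> :: "'n::{finite,linorder} point \<Rightarrow> 'n clifford"
  assumes \<phi>: "continuous_on UNIV \<phi>" "\<And>x. norm x > R \<Longrightarrow> \<phi> x = 0"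
  shows "(\<lambda>i. \<integral>y. regularized l i y \<star> \<phi> (x - y) \<partial>lborel) \<longlonglongrightarrow> (\<integral>y. cr_kernel l y \<star> \<phi> (x - y) \<partial>lborel)"
proof -
  let ?N = "real CARD('n option)"
  define b where "b = ?N / 2"
  have b: "b > 0" by (simp add: b_def)
  obtain c where c: "c > 0" "\<And>a b :: 'n clifford. norm (a \<star> b) \<le> norm a * norm b * c"
    using norm_cl_mult_bound by blast
  have \<phi>0: "\<phi> x = 0" if "x \<notin> cball 0 R" for x using that \<phi>(2) by (simp add: not_le)
  obtain B where B: "B > 0" "\<And>x. norm (\<phi> x) \<le> B"
    using bounded_if_compact_support [OF compact_cball \<phi>0 continuous_on_subset [OF \<phi>(1) subset_UNIV]] by metis
  have q: "shrink i ^ 2 > 0" for i using shrink(1) [of i] by simp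
  have cont: "continuous_on UNIV (regularized l i :: 'n point \<Rightarrow> _)" for i
    by (rule ck_imp_continuous [OF regular_kernel(2) [OF q]]) simp
  have g_refl: "continuous_on UNIV (\<lambda>y. \<phi> (x - y))"
    by (rule continuous_on_compose2 [OF \<phi>(1)]) (auto intro!: continuous_intros)
  have bound: "norm (regularized l i y) \<le> (1 + b) * ?N * norm y powr (real l + 1 - ?N)" for i and y :: "'n point"
    using abs_tangent_profile_le [OF q [of i] b, of "y \<bullet> y"] b
    by (intro norm_radial_kernel_le) (auto simp: b_def)
  show ?thesis
  proof (rule integral_dominated_convergence)
    show "integrable lborel (\<lambda>y :: 'n point. (indicator (cball 0 (R + norm x)) y * norm y powr (real l + 1 - ?N)) * ((1 + b) * ?N * B * c))"
      by (intro integrable_mult_left integrable_kernel_bound)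
    show "AE y in lborel. norm (regularized l i y \<star> \<phi> (x - y))
        \<le> (indicator (cball 0 (R + norm x)) y * norm y powr (real l + 1 - ?N)) * ((1 + b) * ?N * B * c)" for i
    proof (rule AE_I2)
      fix y :: "'n point"
      show "norm (regularized l i y \<star> \<phi> (x - y))
        \<le> (indicator (cball 0 (R + norm x)) y * norm y powr (real l + 1 - ?N)) * ((1 + b) * ?N * B * c)"
      proof (cases "norm y > R + norm x")
        case True
        then have "norm (x - y) > R" using norm_triangle_ineq2 [of y x] by (simp add: norm_minus_commute)
        then show ?thesis using True \<phi>(2) by (simp add: cl.zero_right)
      next
        case False
        have "norm (regularized l i y \<star> \<phi> (x - y)) \<le> norm (regularized l i y :: 'n clifford) * norm (\<phi> (x - y)) * c"
          by (rule c(2))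
        also have "\<dots> \<le> ((1 + b) * ?N * norm y powr (real l + 1 - ?N)) * B * c"
          using bound B c(1) b by (intro mult_right_mono mult_mono) auto
        finally show ?thesis using False by (simp add: mult_ac)
      qed
    qed
    show "AE y in lborel. (\<lambda>i. regularized l i y \<star> \<phi> (x - y)) \<longlonglongrightarrow> cr_kernel l y \<star> \<phi> (x - y)"
    proof (rule AE_I2, rule tendsto_eventually)
      fix y :: "'n point"
      have "\<forall>\<^sub>F i in sequentially. regularized l i y = cr_kernel l y"
      proof (cases "y = 0")
        case True
        then show ?thesis by (simp add: cr_kernel_def radial_kernel_def cl_conj_def)
      next
        case False
        have "(\<lambda>i. shrink i ^ 2) \<longlonglongrightarrow> 0 ^ 2" by (intro tendsto_power shrink)
        moreover have "0 ^ 2 < y \<bullet> y" using False by simp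
        ultimately have "\<forall>\<^sub>F i in sequentially. shrink i ^ 2 < y \<bullet> y" by (rule order_tendstoD(2))
        then show ?thesis
        proof (rule eventually_mono)
          fix i assume "shrink i ^ 2 < y \<bullet> y"
          from tangent_profile_eq [OF q b less_imp_le [OF this]]
          show "regularized l i y = cr_kernel l y"
            unfolding cr_kernel_def radial_kernel_def b_def by (simp only:)
        qed
      qed
      then show "\<forall>\<^sub>F i in sequentially. regularized l i y \<star> \<phi> (x - y) = cr_kernel l y \<star> \<phi> (x - y)"
        by (rule eventually_mono) simp
    qed
    have m: "(\<lambda>y. \<phi> (x - y)) \<in> borel_measurable borel" using g_refl by (rule borel_measurable_continuous_onI)
    show "(\<lambda>y. cr_kernel l y \<star> \<phi> (x - y)) \<in> borel_measurable lborel"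
      unfolding measurable_lborel2 by (intro borel_measurable_cl_mult borel_measurable_cr_kernel m)
    show "(\<lambda>y. regularized l i y \<star> \<phi> (x - y)) \<in> borel_measurable lborel" for i
      unfolding measurable_lborel2
      by (intro borel_measurable_cl_mult m borel_measurable_continuous_onI [OF cont])
  qed
qed

lemma integrable_approximate_identity:
  "integrable lborel (\<lambda>z :: 'a::euclidean_space. C * max 0 (1 - z \<bullet> z))"
proof (rule integrable_compact_support [of _ 1])
  show "C * max 0 (1 - z \<bullet> z) = 0" if "norm z > 1" for z :: 'a
  proof -
    have "z \<bullet> z \<ge> 1" using that by (simp add: dot_square_norm one_le_power)
    then show ?thesis by (simp add: max_def)
  qed
qed (auto intro!: continuous_intros)

text \<open>
  After the dilation \<open>y = \<epsilon> z\<close> the powers of \<open>\<epsilon>\<close> from the volume and from the profile cancel. For \<open>l > 0\<close>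
  the factor \<open>y\<^sub>0\<^sup>l\<close> leaves \<open>\<epsilon>\<^sup>l\<close>, so only the kernel with \<open>l = 0\<close> sees the Dirac measure.
\<close>

lemma approximate_identity_tendsto:
  fixes g :: "'n::{finite,linorder} point \<Rightarrow> 'n clifford" and C :: real
  assumes g: "continuous_on UNIV g" "\<And>x. norm x > R \<Longrightarrow> g x = 0" and C: "C \<ge> 0"
  shows "(\<lambda>i. \<integral>y. (y $ None ^ l / fact l * (C * (shrink i ^ 2) powr (- (real CARD('n option) / 2)) * max 0 (1 - y \<bullet> y / shrink i ^ 2))) *\<^sub>R g (x - y) \<partial>lborel)
    \<longlonglongrightarrow> (if l = 0 then (\<integral>z. C * max 0 (1 - z \<bullet> z) \<partial>(lborel :: 'n point measure)) else 0) *\<^sub>R g x"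
proof -
  let ?f = "\<lambda>i y. (y $ None ^ l / fact l * (C * (shrink i ^ 2) powr (- (real CARD('n option) / 2)) * max 0 (1 - y \<bullet> y / shrink i ^ 2))) *\<^sub>R g (x - y)"
  let ?h = "\<lambda>i (z :: 'n point). ((shrink i * z $ None) ^ l / fact l * (C * max 0 (1 - z \<bullet> z))) *\<^sub>R g (x - shrink i *\<^sub>R z)"
  let ?k = "\<lambda>z :: 'n point. ((0 * z $ None) ^ l / fact l * (C * max 0 (1 - z \<bullet> z))) *\<^sub>R g x"
  have g0: "g x = 0" if "x \<notin> cball 0 R" for x using that g(2) by (simp add: not_le)
  obtain B where B: "B > 0" "\<And>x. norm (g x) \<le> B"
    using bounded_if_compact_support [OF compact_cball g0 continuous_on_subset [OF g(1) subset_UNIV]] by metis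
  have cont: "continuous_on UNIV (\<lambda>y. g (x - a *\<^sub>R y))" for a
    by (rule continuous_on_compose2 [OF g(1)]) (auto intro!: continuous_intros)
  have scaled: "(\<integral>y. ?f i y \<partial>lborel) = (\<integral>z. ?h i z \<partial>lborel)" for i
  proof -
    let ?\<epsilon> = "shrink i"
    have \<epsilon>: "?\<epsilon> > 0" by (rule shrink)
    have "continuous_on UNIV (?f i)"
      using cont [of 1] shrink(1) [of i] by (auto intro!: continuous_intros)
    then have "(\<integral>y. ?f i y \<partial>lborel) = (\<integral>z. ?\<epsilon> ^ DIM('n point) *\<^sub>R ?f i (?\<epsilon> *\<^sub>R z) \<partial>lborel)"
      by (intro integral_dilation \<epsilon> borel_measurable_continuous_onI)
    moreover have "?\<epsilon> ^ DIM('n point) *\<^sub>R ?f i (?\<epsilon> *\<^sub>R z) = ?h i z" for z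
    proof -
      have p: "(?\<epsilon> ^ 2) powr (- (real CARD('n option) / 2)) = ?\<epsilon> powr (- real CARD('n option))"
      proof -
        have e: "?\<epsilon> ^ 2 = ?\<epsilon> powr 2" using \<epsilon> by (simp add: powr_numeral)
        show ?thesis unfolding e powr_powr by (intro arg_cong2 [where f = "(powr)"] refl) linarith
      qed
      have "?\<epsilon> ^ DIM('n point) * ?\<epsilon> powr (- real CARD('n option)) = 1"
        using \<epsilon> by (simp only: DIM_cart DIM_real mult_1_right powr_minus powr_realpow) (simp del: card_option add: field_simps)
      then have "?\<epsilon> ^ DIM('n point) * (w * (C * ?\<epsilon> powr (- real CARD('n option)) * v)) = w * (C * v)" for w v
        by (metis mult.assoc mult.commute mult.left_commute mult_1_left)
      moreover have "(?\<epsilon> *\<^sub>R z) \<bullet> (?\<epsilon> *\<^sub>R z) / ?\<epsilon> ^ 2 = z \<bullet> z"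
        using \<epsilon> by (simp add: power2_eq_square)
      ultimately show ?thesis unfolding p scaleR_scaleR by (simp only: vector_scaleR_component real_scaleR_def)
    qed
    ultimately show ?thesis by (simp only:)
  qed
  have "(\<lambda>i. \<integral>z. ?h i z \<partial>lborel) \<longlonglongrightarrow> (\<integral>z. ?k z \<partial>lborel)"
  proof (rule integral_dominated_convergence)
    show "integrable lborel (\<lambda>z :: 'n point. indicator (cball 0 1) z * (C * B))"
      using borel_integrable_compact [of "cball (0 :: 'n point) 1" "\<lambda>_. C * B"] by simp
    show "?k \<in> borel_measurable lborel" "?h i \<in> borel_measurable lborel" for i
      using cont [of "shrink i"] by (auto intro!: borel_measurable_continuous_onI continuous_intros)
    show "AE z in lborel. (\<lambda>i. ?h i z) \<longlonglongrightarrow> ?k z"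
    proof (rule AE_I2)
      fix z :: "'n point"
      have "(\<lambda>i. x - shrink i *\<^sub>R z) \<longlonglongrightarrow> x - 0 *\<^sub>R z" by (intro tendsto_intros shrink)
      moreover have "isCont g (x - 0 *\<^sub>R z)" using g(1) by (simp add: continuous_on_eq_continuous_at)
      ultimately have "(\<lambda>i. g (x - shrink i *\<^sub>R z)) \<longlonglongrightarrow> g (x - 0 *\<^sub>R z)" by (rule isCont_tendsto_compose [rotated])
      then show "(\<lambda>i. ?h i z) \<longlonglongrightarrow> ?k z" unfolding divide_inverse by (intro tendsto_intros shrink) simp
    qed
    show "AE z in lborel. norm (?h i z) \<le> indicator (cball 0 1) z * (C * B)" for i
    proof (rule AE_I2)
      fix z :: "'n point"
      show "norm (?h i z) \<le> indicator (cball 0 1) z * (C * B)"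
      proof (cases "norm z \<le> 1")
        case True
        then have z: "z \<bullet> z \<le> 1" "z \<bullet> z \<ge> 0" by (auto simp: dot_square_norm power_le_one)
        have "\<bar>shrink i * z $ None\<bar> \<le> 1 * 1"
          unfolding abs_mult using True component_le_norm_cart [of z None] shrink(1,2) [of i] by (intro mult_mono) auto
        then have "\<bar>shrink i * z $ None\<bar> ^ l / fact l \<le> 1 / 1"
          by (intro frac_le power_le_one) (auto simp: fact_ge_1)
        then have P: "\<bar>(shrink i * z $ None) ^ l / fact l\<bar> * \<bar>C * max 0 (1 - z \<bullet> z)\<bar> \<le> 1 * (C * 1)"
          using z C by (intro mult_mono) (auto simp: abs_mult power_abs intro!: mult_left_le)
        then have "\<bar>(shrink i * z $ None) ^ l / fact l\<bar> * \<bar>C * max 0 (1 - z \<bullet> z)\<bar> * norm (g (x - shrink i *\<^sub>R z)) \<le> (1 * (C * 1)) * B"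
          by (intro mult_mono [OF P B(2)]) (use C in auto)
        then show ?thesis using True by (simp add: abs_mult)
      next
        case False
        then have "z \<bullet> z \<ge> 1" by (simp add: dot_square_norm one_le_power)
        then show ?thesis using False by (simp add: max_def)
      qed
    qed
  qed
  moreover have "(\<integral>z. ?k z \<partial>lborel) = (if l = 0 then (\<integral>z. C * max 0 (1 - z \<bullet> z) \<partial>(lborel :: 'n point measure)) else 0) *\<^sub>R g x"
  proof -
    have "(\<integral>z. (C * max 0 (1 - z \<bullet> z)) *\<^sub>R g x \<partial>(lborel :: 'n point measure))
        = (\<integral>z. C * max 0 (1 - z \<bullet> z) \<partial>(lborel :: 'n point measure)) *\<^sub>R g x"
      by (rule integral_scaleR_left) (rule integrable_approximate_identity)
    then show ?thesis
      by (cases "l = 0") (simp_all del: integral_mult_right_zero add: zero_power)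
  qed
  ultimately show ?thesis unfolding scaled by simp
qed

text \<open>
  Integrate by parts with the regularized kernel, where everything is of class \<open>C\<^sup>1\<close>, and let the
  regularization shrink on both sides.
\<close>

lemma kernel_step_cr_kernel:
  defines "C \<equiv> real CARD('n option) * (1 + real CARD('n option) / 2)"
  defines "c \<equiv> \<integral>z. C * max 0 (1 - z \<bullet> z) \<partial>(lborel :: 'n::{finite,linorder} point measure)"
  shows "kernel_step (cr_kernel l :: 'n point \<Rightarrow> 'n clifford) (cr_prev l) (if l = 0 then c else 0)"
proof -
  have main: "(\<Sum>j\<in>UNIV. cl_e j \<star> potential (cr_kernel l) (pd j g) x) = potential (cr_prev l) g x + (if l = 0 then c else 0) *\<^sub>R g x"
    if g: "ck 1 g UNIV" "\<And>x. norm x > R \<Longrightarrow> g x = 0" for g :: "'n point \<Rightarrow> 'n clifford" and R x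
  proof -
    define b where "b = real CARD('n option) / 2"
    have b: "b > 0" by (simp add: b_def)
    have C: "C = 2 * b * (1 + b)" "2 * b = real CARD('n option)" "C \<ge> 0" by (simp_all add: C_def b_def)
    have q: "shrink i ^ 2 > 0" for i using shrink(1) [of i] by simp
    have cont: "continuous_on UNIV g" "continuous_on UNIV (pd j g)" for j using g(1) by auto
    have pd0: "pd j g z = 0" if "norm z > R" for j z
      by (rule pd_eq_0_outside [of "cball 0 R"]) (use g(2) that in \<open>auto simp: not_le\<close>)
    have m: "g \<in> borel_measurable borel" "pd j g \<in> borel_measurable borel" for j
      using cont by (auto intro: borel_measurable_continuous_onI)
    let ?A = "\<lambda>i. \<Sum>j\<in>UNIV. cl_e j \<star> (\<integral>y. regularized l i y \<star> pd j g (x - y) \<partial>lborel)"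
    let ?d = "\<lambda>i y. (y $ None ^ l / fact l * (C * (shrink i ^ 2) powr (- (real CARD('n option) / 2)) * max 0 (1 - y \<bullet> y / shrink i ^ 2)))"
    let ?P = "\<lambda>i. prev_kernel l (tangent_profile (real CARD('n option) / 2) (shrink i ^ 2)) :: 'n point \<Rightarrow> 'n clifford"
    have "?A \<longlonglongrightarrow> (\<Sum>j\<in>UNIV. cl_e j \<star> (\<integral>y. cr_kernel l y \<star> pd j g (x - y) \<partial>lborel))"
      by (intro tendsto_sum cl.tendsto tendsto_const convolution_regularized_tendsto [OF cont(2) pd0])
    then have lim1: "?A \<longlonglongrightarrow> (\<Sum>j\<in>UNIV. cl_e j \<star> potential (cr_kernel l) (pd j g) x)"
      by (simp only: potential_commute [OF borel_measurable_cr_kernel m(2)])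
    have A: "?A i = (\<integral>y. ?P i y \<star> g (x - y) \<partial>lborel) + (\<integral>y. ?d i y *\<^sub>R g (x - y) \<partial>lborel)" for i
    proof -
      have div: "(\<Sum>j\<in>UNIV. cl_e j \<star> pd j (regularized l i) y) = ?P i y + ?d i y *\<^sub>R cl_one" for y :: "'n point"
        unfolding has_pd_imp_pd [OF regular_kernel(1) [OF q b [unfolded b_def]]] sum_radial_kernel_pd
        using tangent_profile_density [OF q [of i] b, of "y \<bullet> y"] by (simp only: C b_def [symmetric])
      have g_refl: "continuous_on UNIV (\<lambda>y. g (x - y))"
        by (rule continuous_on_compose2 [OF cont(1)]) (auto intro!: continuous_intros)
      have far: "g (x - y) = 0" if "norm y > R + norm x" for y
        using that norm_triangle_ineq2 [of y x] by (intro g(2)) (simp add: norm_minus_commute)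
      have contP: "continuous_on UNIV (?P i)"
      proof (cases l)
        case 0
        then show ?thesis by simp
      next
        case (Suc k)
        have "?P i = regularized k i" by (rule ext) (simp only: Suc prev_kernel.simps)
        then show ?thesis using ck_imp_continuous [OF regular_kernel(2) [OF q b [unfolded b_def]]] by simp
      qed
      have "?A i = (\<integral>y. (\<Sum>j\<in>UNIV. cl_e j \<star> pd j (regularized l i) y) \<star> g (x - y) \<partial>lborel)"
        by (rule integral_by_parts [OF regular_kernel(2) [OF q b [unfolded b_def]] g])
      also have "\<dots> = (\<integral>y. ?P i y \<star> g (x - y) + ?d i y *\<^sub>R g (x - y) \<partial>lborel)"
        unfolding div cl.add_left cl.scaleR_left cl_one_left ..
      also have "\<dots> = (\<integral>y. ?P i y \<star> g (x - y) \<partial>lborel) + (\<integral>y. ?d i y *\<^sub>R g (x - y) \<partial>lborel)"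
      proof (rule Bochner_Integration.integral_add)
        show "integrable lborel (\<lambda>y. ?P i y \<star> g (x - y))"
          by (rule integrable_compact_support [OF cl.continuous_on [OF contP g_refl], of "R + norm x"])
             (simp add: far cl.zero_right)
        show "integrable lborel (\<lambda>y. ?d i y *\<^sub>R g (x - y))"
          by (rule integrable_compact_support [of _ "R + norm x"])
             (use far q [of i] in \<open>auto intro!: continuous_intros g_refl\<close>)
      qed
      finally show ?thesis .
    qed
    have "(\<lambda>i. \<integral>y. ?P i y \<star> g (x - y) \<partial>lborel) \<longlonglongrightarrow> potential (cr_prev l) g x"
    proof (cases l)
      case 0
      then show ?thesis by (simp add: cr_prev_simps potential_def cl.zero_left)
    next
      case (Suc k)
      then show ?thesis
        using convolution_regularized_tendsto [OF cont(1) g(2), of R k x]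
        by (simp only: cr_prev_simps prev_kernel.simps potential_commute [OF borel_measurable_cr_kernel m(1)])
    qed
    from tendsto_add [OF this approximate_identity_tendsto [OF cont(1) g(2) C(3)]]
    have lim2: "?A \<longlonglongrightarrow> potential (cr_prev l) g x + (if l = 0 then c else 0) *\<^sub>R g x"
      unfolding A c_def .
    show ?thesis by (rule LIMSEQ_unique [OF lim1 lim2])
  qed
  show ?thesis
    unfolding kernel_step_def
  proof (intro conjI allI impI)
    show "continuous_on (- {0}) (cr_prev l :: 'n point \<Rightarrow> 'n clifford)"
      using ck_imp_continuous [OF ck_cr_kernel] by (cases l) (simp_all add: cr_prev_simps)
    fix g :: "'n point \<Rightarrow> 'n clifford" and R x
    assume "ck 1 g UNIV" "\<forall>x. norm x > R \<longrightarrow> g x = 0"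
    then show "(\<Sum>j\<in>UNIV. cl_e j \<star> potential (cr_kernel l) (pd j g) x)
        = potential (cr_prev l) g x + (if l = 0 then c else 0) *\<^sub>R g x"
      by (intro main [of g R]) (simp_all del: ck.simps)
  qed (rule locally_integrable_cr_kernel locally_integrable_cr_prev ck_cr_kernel cauchy_riemann_cr_kernel, assumption?)+
qed

lemma approximate_identity_mass_pos:
  assumes "C > 0"
  shows "(\<integral>z. C * max 0 (1 - z \<bullet> z) \<partial>(lborel :: 'a::euclidean_space measure)) > 0"
proof -
  have "(\<integral>z. indicator (cball 0 (1 / 2)) z *\<^sub>R (C * (3 / 4)) \<partial>(lborel :: 'a measure)) \<le> (\<integral>z. C * max 0 (1 - z \<bullet> z) \<partial>(lborel :: 'a measure))"
  proof (rule integral_mono)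
    show "integrable lborel (\<lambda>z :: 'a. indicator (cball 0 (1 / 2)) z *\<^sub>R (C * (3 / 4)))"
      by (intro borel_integrable_compact) auto
    show "integrable lborel (\<lambda>z :: 'a. C * max 0 (1 - z \<bullet> z))" by (rule integrable_approximate_identity)
    fix z :: 'a
    show "indicator (cball 0 (1 / 2)) z *\<^sub>R (C * (3 / 4)) \<le> C * max 0 (1 - z \<bullet> z)"
    proof (cases "norm z \<le> 1 / 2")
      case True
      then have "norm z ^ 2 \<le> (1 / 2) ^ 2" by (intro power_mono) auto
      then have "3 / 4 \<le> max 0 (1 - z \<bullet> z)" by (simp add: dot_square_norm power2_eq_square)
      from mult_left_mono [OF this less_imp_le [OF assms]] have "C * (3 / 4) \<le> C * max 0 (1 - z \<bullet> z)" .
      moreover have "indicator (cball 0 (1 / 2)) z = (1 :: real)" using True by simp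
      ultimately show ?thesis by (simp only: scaleR_one)
    qed (use assms in auto)
  qed
  moreover have "(\<integral>z. indicator (cball 0 (1 / 2)) z *\<^sub>R (C * (3 / 4)) \<partial>(lborel :: 'a measure)) = measure lborel (cball (0 :: 'a) (1 / 2)) * (C * (3 / 4))"
    by simp
  moreover have "measure lborel (cball (0 :: 'a) (1 / 2)) > 0" by (rule content_cball_pos) simp
  ultimately show ?thesis using assms by (smt (verit) mult_pos_pos divide_pos_pos)
qed

subsection \<open>Continuity and decay of potentials\<close>

text \<open>
  Young's inequality with a parameter, up to constants: compare \<open>b\<close> with \<open>t a\<^sup>q\<^sup>-\<^sup>1\<close>.
\<close>

lemma mult_le_powr_sum:
  fixes a b t p :: real
  assumes "a \<ge> 0" "b \<ge> 0" "t > 0" "p > 1"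
  shows "a * b \<le> t * a powr (p / (p - 1)) + t powr (1 - p) * b powr p"
proof (cases "a = 0 \<or> b = 0")
  case True
  then show ?thesis using assms(3) by auto
next
  case False
  then have ab: "a > 0" "b > 0" using assms by auto
  define s where "s = 1 / (p - 1)"
  have s: "p / (p - 1) = 1 + s" "s * (p - 1) = 1" using assms(4) by (simp_all add: s_def field_simps)
  show ?thesis
  proof (cases "b \<le> t * a powr s")
    case True
    then have "a * b \<le> a * (t * a powr s)" using ab by (intro mult_left_mono) auto
    also have "\<dots> = t * a powr (p / (p - 1))" using ab by (simp add: s powr_add)
    finally show ?thesis by (rule add_increasing2 [rotated]) simp
  next
    case F: False
    then have "a powr s \<le> b / t" using assms(3) by (simp add: le_divide_eq mult.commute)
    then have "(a powr s) powr (p - 1) \<le> (b / t) powr (p - 1)" using assms(4) by (intro powr_mono2) auto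
    then have "a \<le> (b / t) powr (p - 1)" using ab s by (simp add: powr_powr)
    then have "a * b \<le> (b / t) powr (p - 1) * b" using ab by (intro mult_right_mono) auto
    also have "\<dots> = t powr (1 - p) * b powr p"
    proof -
      have "t powr (1 - p) = inverse (t powr (p - 1))" by (simp add: powr_minus [symmetric])
      moreover have "b powr p = b powr (p - 1) * b" using ab by (simp add: powr_diff)
      ultimately show ?thesis unfolding powr_divide by (simp add: divide_inverse mult_ac)
    qed
    finally show ?thesis by (rule add_increasing [rotated]) (use assms(3) in simp)
  qed
qed

lemma norm_integral_le:
  fixes f :: "'a \<Rightarrow> 'b::{banach, second_countable_topology}"
  assumes "integrable Q f" "integrable Q g" "\<And>x. norm (f x) \<le> g x"
  shows "norm (\<integral>x. f x \<partial>Q) \<le> (\<integral>x. g x \<partial>Q)"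
  by (rule order_trans [OF integral_norm_bound]) (intro integral_mono integrable_norm assms)

text \<open>
  The kernels are \<open>O(\<bar>z\<bar>\<^sup>1\<^sup>-\<^sup>N)\<close> near \<open>0\<close>. With the conjugate exponent \<open>q = p / (p - 1)\<close> the power
  \<open>(\<bar>z\<bar>\<^sup>1\<^sup>-\<^sup>N)\<^sup>q = \<bar>z\<bar> powr - \<alpha>\<close> is locally integrable since \<open>p > N\<close>.
\<close>

locale powr_integrable_density =
  fixes h :: "'n::{finite,linorder} point \<Rightarrow> 'n clifford" and p R N :: real
  assumes N_def: "N = real CARD('n option)" and p: "p > N"
    and h_integrable: "integrable lborel h" and h_support: "\<And>x. norm x > R \<Longrightarrow> h x = 0"
    and h_powr: "integrable lborel (\<lambda>y. norm (h y) powr p)"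
begin

definition \<alpha> :: real where
  "\<alpha> = (N - 1) * (p / (p - 1))"

lemma N_ge_1: "N \<ge> 1"
  by (simp add: N_def)

lemma p_gt_1: "p > 1"
  using p N_ge_1 by linarith

lemma \<alpha>: "0 \<le> \<alpha>" "\<alpha> < N"
proof -
  show "0 \<le> \<alpha>" using N_ge_1 p_gt_1 by (simp add: \<alpha>_def)
  have "(N - 1) * p < N * (p - 1)" using p by (simp add: algebra_simps)
  then show "\<alpha> < N" using p_gt_1 by (simp add: \<alpha>_def divide_less_eq)
qed

definition truncated :: "real \<Rightarrow> 'n point \<Rightarrow> real" where
  "truncated \<epsilon> z = indicator (cball 0 \<epsilon>) z * norm z powr (- \<alpha>)"

lemma integrable_truncated: "integrable lborel (truncated \<epsilon>)"
proof (cases "\<epsilon> > 0")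
  case True
  have "\<alpha> < real DIM('n point)" using \<alpha>(2) by (simp add: N_def)
  then show ?thesis unfolding truncated_def [abs_def] by (rule integrable_norm_powr [OF \<alpha>(1) _ True])
next
  case False
  then have "truncated \<epsilon> = (\<lambda>_. 0)"
  proof (intro ext)
    fix z :: "'n point"
    show "truncated \<epsilon> z = 0"
    proof (cases "norm z \<le> \<epsilon>")
      case True
      with False have "norm z \<le> 0" by linarith
      then show ?thesis by (simp add: truncated_def)
    qed (simp add: truncated_def)
  qed
  then show ?thesis by simp
qed

lemma truncated_measurable: "truncated \<epsilon> \<in> borel_measurable borel"
  using borel_measurable_integrable [OF integrable_truncated] by simp

lemma kernel_times_density_le:
  assumes "norm z \<le> \<epsilon>" "t > 0"
  shows "norm z powr (real l + 1 - N) * norm (h y)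
    \<le> max 1 \<epsilon> ^ l * (t * truncated \<epsilon> z + t powr (1 - p) * norm (h y) powr p)"
proof (cases "z = 0")
  case True
  then show ?thesis using assms by (simp add: truncated_def)
next
  case False
  let ?a = "norm z powr (1 - N)"
  have "norm z powr (real l + 1 - N) = norm z powr real l * ?a"
    by (simp add: powr_add [symmetric] algebra_simps)
  also have "norm z powr real l = norm z ^ l" using False by (simp add: powr_realpow)
  also have "norm z ^ l * ?a \<le> max 1 \<epsilon> ^ l * ?a"
    using assms(1) by (intro mult_right_mono power_mono) auto
  finally have "norm z powr (real l + 1 - N) * norm (h y) \<le> max 1 \<epsilon> ^ l * (?a * norm (h y))"
    by (simp add: mult.assoc [symmetric] mult_right_mono)
  also have "?a * norm (h y) \<le> t * ?a powr (p / (p - 1)) + t powr (1 - p) * norm (h y) powr p"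
    using assms(2) p_gt_1 by (intro mult_le_powr_sum) auto
  also have "?a powr (p / (p - 1)) = truncated \<epsilon> z"
  proof -
    have "?a powr (p / (p - 1)) = norm z powr ((1 - N) * (p / (p - 1)))" by (rule powr_powr)
    also have "(1 - N) * (p / (p - 1)) = - \<alpha>" by (simp add: \<alpha>_def algebra_simps minus_divide_left)
    finally show ?thesis using assms(1) by (simp add: truncated_def)
  qed
  finally show ?thesis by (simp add: mult_left_mono)
qed

lemma integrable_cr_kernel_density: "integrable lborel (\<lambda>y. cr_kernel l (x - y) \<star> h y)"
proof -
  obtain c where c: "c > 0" "\<And>a b :: 'n clifford. norm (a \<star> b) \<le> norm a * norm b * c"
    using norm_cl_mult_bound by blast
  define \<epsilon> where "\<epsilon> = norm x + R"
  have m: "h \<in> borel_measurable borel" using borel_measurable_integrable [OF h_integrable] by simp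
  let ?G = "\<lambda>y. N * c * (max 1 \<epsilon> ^ l * (1 * truncated \<epsilon> (x - y) + 1 powr (1 - p) * norm (h y) powr p))"
  have "integrable lborel ?G"
    using integral_reflect(2) [OF truncated_measurable] integrable_truncated h_powr
    by (intro integrable_mult_right Bochner_Integration.integrable_add) auto
  then show ?thesis
  proof (rule Bochner_Integration.integrable_bound)
    show "(\<lambda>y. cr_kernel l (x - y) \<star> h y) \<in> borel_measurable lborel"
      unfolding measurable_lborel2
      by (intro borel_measurable_cl_mult m measurable_compose [OF _ borel_measurable_cr_kernel]) measurable
    show "AE y in lborel. norm (cr_kernel l (x - y) \<star> h y) \<le> norm (?G y)"
    proof (rule AE_I2)
      fix y
      show "norm (cr_kernel l (x - y) \<star> h y) \<le> norm (?G y)"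
      proof (cases "norm y > R")
        case True
        then show ?thesis using h_support by (simp add: cl.zero_right)
      next
        case False
        then have z: "norm (x - y) \<le> \<epsilon>" using norm_triangle_ineq4 [of x y] by (simp add: \<epsilon>_def)
        have "norm (cr_kernel l (x - y) \<star> h y) \<le> norm (cr_kernel l (x - y) :: 'n clifford) * norm (h y) * c" by (rule c(2))
        also have "\<dots> \<le> N * norm (x - y) powr (real l + 1 - N) * norm (h y) * c"
          using norm_cr_kernel_le [of l "x - y"] c(1) by (intro mult_right_mono) (auto simp: N_def)
        also have "\<dots> = N * c * (norm (x - y) powr (real l + 1 - N) * norm (h y))" by (simp only: mult_ac)
        also have "\<dots> \<le> ?G y"
          using kernel_times_density_le [OF z, of 1 l y] c(1) N_ge_1 by (intro mult_left_mono) auto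
        finally show ?thesis by (rule order_trans) (simp only: real_norm_def abs_ge_self)
      qed
    qed
  qed
qed

lemma convolution_regularized:
  "integrable lborel (\<lambda>y. regularized l i (x - y) \<star> h y)"
  "continuous_on UNIV (\<lambda>x. \<integral>y. regularized l i (x - y) \<star> h y \<partial>lborel)"
proof -
  let ?b = "real CARD('n option) / 2"
  have q: "shrink i ^ 2 > 0" "?b > 0" using shrink(1) [of i] by simp_all
  have cont: "continuous_on UNIV (regularized l i :: 'n point \<Rightarrow> _)"
    by (rule ck_imp_continuous [OF regular_kernel(2) [OF q]])
  have m: "h \<in> borel_measurable borel" using borel_measurable_integrable [OF h_integrable] by simp
  have meas: "(\<lambda>y. regularized l i (x - y) \<star> h y) \<in> borel_measurable lborel" for x
    unfolding measurable_lborel2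
    by (intro borel_measurable_cl_mult m measurable_compose [OF _ borel_measurable_continuous_onI [OF cont]]) measurable
  obtain c where c: "c > 0" "\<And>a b :: 'n clifford. norm (a \<star> b) \<le> norm a * norm b * c"
    using norm_cl_mult_bound by blast
  have bound: "\<exists>B>0. \<forall>x y. norm x \<le> \<rho> \<longrightarrow> norm (regularized l i (x - y) \<star> h y) \<le> B * norm (h y)" for \<rho>
  proof -
    have "bounded (regularized l i ` cball (0 :: 'n point) (\<rho> + R))"
      by (intro compact_imp_bounded compact_continuous_image continuous_on_subset [OF cont]) auto
    then obtain B where B: "B > 0" "\<And>z :: 'n point. norm z \<le> \<rho> + R \<Longrightarrow> norm (regularized l i z) \<le> B"
      by (force simp: bounded_pos)
    have "norm (regularized l i (x - y) \<star> h y) \<le> (B * c) * norm (h y)" if "norm x \<le> \<rho>" for x y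
    proof (cases "norm y > R")
      case True
      then show ?thesis using h_support by (simp add: cl.zero_right)
    next
      case False
      then have "norm (regularized l i (x - y) :: 'n clifford) \<le> B"
        using that norm_triangle_ineq4 [of x y] by (intro B) linarith
      then have "norm (regularized l i (x - y) :: 'n clifford) * norm (h y) * c \<le> B * norm (h y) * c"
        using c(1) by (intro mult_right_mono) auto
      then show ?thesis using c(2) [of "regularized l i (x - y)" "h y"] by (simp add: mult_ac)
    qed
    with B c show ?thesis by (intro exI [of _ "B * c"]) auto
  qed
  show "integrable lborel (\<lambda>y. regularized l i (x - y) \<star> h y)"
  proof -
    obtain B where "B > 0" and B: "\<And>x' y. norm x' \<le> norm x \<Longrightarrow> norm (regularized l i (x' - y) \<star> h y) \<le> B * norm (h y)"
      using bound by metis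
    then have "AE y in lborel. norm (regularized l i (x - y) \<star> h y) \<le> norm (B * norm (h y))"
      by (intro AE_I2) (simp add: order_trans [OF B])
    then show ?thesis
      by (rule Bochner_Integration.integrable_bound [OF _ meas, rotated]) (use h_integrable in simp)
  qed
  show "continuous_on UNIV (\<lambda>x. \<integral>y. regularized l i (x - y) \<star> h y \<partial>lborel)"
  proof (rule continuous_at_imp_continuous_on, rule ballI)
    fix x0 :: "'n point"
    let ?U = "ball 0 (norm x0 + 1) :: 'n point set"
    obtain B where "B > 0" and B: "\<And>x' y. norm x' \<le> norm x0 + 1 \<Longrightarrow> norm (regularized l i (x' - y) \<star> h y) \<le> B * norm (h y)"
      using bound by metis
    have "continuous_on ?U (\<lambda>x. \<integral>y. regularized l i (x - y) \<star> h y \<partial>lborel)"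
    proof (rule continuous_on_integral_dominated [OF _ meas])
      show "continuous_on ?U (\<lambda>x. regularized l i (x - y) \<star> h y)" for y
        by (intro cl.continuous_on continuous_on_const continuous_on_compose2 [OF cont] continuous_intros) auto
      show "integrable lborel (\<lambda>y. B * norm (h y))" using h_integrable by simp
    qed (use B in auto)
    then show "isCont (\<lambda>x. \<integral>y. regularized l i (x - y) \<star> h y \<partial>lborel) x0"
      by (simp add: continuous_on_eq_continuous_at)
  qed
qed

lemma integral_truncated_tendsto_0: "(\<lambda>i. \<integral>z. truncated (shrink i) z \<partial>lborel) \<longlonglongrightarrow> 0"
proof -
  have "(\<lambda>i. \<integral>z. truncated (shrink i) z \<partial>lborel) \<longlonglongrightarrow> (\<integral>z. 0 \<partial>(lborel :: 'n point measure))"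
  proof (rule integral_dominated_convergence [OF _ _ integrable_truncated [of 1]])
    show "AE z in lborel. norm (truncated (shrink i) z) \<le> truncated 1 z" for i
      using shrink(2) [of i] by (intro AE_I2) (auto simp: truncated_def indicator_def)
    show "AE z in lborel. (\<lambda>i. truncated (shrink i) z) \<longlonglongrightarrow> 0"
    proof (rule AE_I2, rule tendsto_eventually)
      fix z :: "'n point"
      show "\<forall>\<^sub>F i in sequentially. truncated (shrink i) z = 0"
      proof (cases "z = 0")
        case False
        then have "\<forall>\<^sub>F i in sequentially. shrink i < norm z" using order_tendstoD(2) [OF shrink(3), of "norm z"] by simp
        then show ?thesis by (rule eventually_mono) (simp add: truncated_def)
      qed (simp add: truncated_def)
    qed
  qed (use borel_measurable_integrable [OF integrable_truncated] in auto)
  then show ?thesis by simp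
qed

text \<open>
  Regularized and true kernel differ only on a ball of radius \<open>shrink i\<close>. There the weighted Young
  inequality bounds the error, uniformly in \<open>x\<close>, by \<open>t\<close> times an integral that tends to \<open>0\<close> with the
  radius plus a term that is small for large \<open>t\<close>; so first \<open>t\<close> is chosen and then \<open>i\<close>.
\<close>

lemma uniform_limit_potential:
  "uniform_limit UNIV (\<lambda>i x. \<integral>y. regularized l i (x - y) \<star> h y \<partial>lborel) (potential (cr_kernel l) h) sequentially"
proof -
  let ?b = "N / 2"
  let ?H = "\<integral>y. norm (h y) powr p \<partial>lborel"
  let ?I = "\<lambda>i. \<integral>z. truncated (shrink i) z \<partial>lborel"
  obtain c where c: "c > 0" "\<And>a b :: 'n clifford. norm (a \<star> b) \<le> norm a * norm b * c"
    using norm_cl_mult_bound by blast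
  define C where "C = (2 + ?b) * N * c"
  have C: "C > 0" using N_ge_1 c by (simp add: C_def)
  have q: "shrink i ^ 2 > 0" for i using shrink(1) [of i] by simp
  have b: "real CARD('n option) / 2 > 0" by simp
  have diff: "norm ((regularized l i z - cr_kernel l z) \<star> h y)
      \<le> C * (t * truncated (shrink i) z + t powr (1 - p) * norm (h y) powr p)"
    if t: "t > 0" for i t and y z :: "'n point"
  proof (cases "norm z \<le> shrink i")
    case True
    have "norm (regularized l i z :: 'n clifford) \<le> (1 + ?b) * N * norm z powr (real l + 1 - N)"
      using abs_tangent_profile_le [OF q [of i] b, of "z \<bullet> z"] norm_radial_kernel_le [of z _ "1 + ?b" l] N_ge_1
      unfolding N_def by auto
    moreover have "norm (cr_kernel l z :: 'n clifford) \<le> N * norm z powr (real l + 1 - N)"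
      unfolding N_def by (rule norm_cr_kernel_le)
    ultimately have "norm (regularized l i z - cr_kernel l z :: 'n clifford) \<le> (2 + ?b) * N * norm z powr (real l + 1 - N)"
      using norm_triangle_ineq4 [of "regularized l i z :: 'n clifford" "cr_kernel l z"] by (simp add: algebra_simps)
    then have "norm ((regularized l i z - cr_kernel l z) \<star> h y)
        \<le> (2 + ?b) * N * norm z powr (real l + 1 - N) * norm (h y) * c"
      using c by (intro order_trans [OF c(2)] mult_right_mono) auto
    also have "\<dots> = C * (norm z powr (real l + 1 - N) * norm (h y))" by (simp only: C_def mult_ac)
    also have "\<dots> \<le> C * (max 1 (shrink i) ^ l * (t * truncated (shrink i) z + t powr (1 - p) * norm (h y) powr p))"
      using C by (intro mult_left_mono kernel_times_density_le True t) auto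
    also have "max 1 (shrink i) ^ l = 1" using shrink(2) [of i] by simp
    finally show ?thesis by simp
  next
    case False
    then have "shrink i ^ 2 \<le> z \<bullet> z" using shrink(1) [of i] by (simp add: dot_square_norm power_mono)
    from tangent_profile_eq [OF q b this] have "regularized l i z = cr_kernel l z"
      unfolding cr_kernel_def radial_kernel_def by (simp only:)
    then show ?thesis using C t by (simp add: cl.zero_left truncated_def)
  qed
  have est: "norm ((\<integral>y. regularized l i (x - y) \<star> h y \<partial>lborel) - potential (cr_kernel l) h x)
      \<le> C * (t * ?I i + t powr (1 - p) * ?H)" if t: "t > 0" for i x t
  proof -
    have refl: "integrable lborel (\<lambda>y. truncated (shrink i) (x - y))"
      using integral_reflect(2) [OF truncated_measurable] integrable_truncated by simp
    have "(\<integral>y. regularized l i (x - y) \<star> h y \<partial>lborel) - potential (cr_kernel l) h x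
        = (\<integral>y. (regularized l i (x - y) - cr_kernel l (x - y)) \<star> h y \<partial>lborel)"
      unfolding potential_def cl.diff_left
      by (rule Bochner_Integration.integral_diff [symmetric, OF convolution_regularized(1) integrable_cr_kernel_density])
    also have "norm \<dots> \<le> (\<integral>y. C * (t * truncated (shrink i) (x - y) + t powr (1 - p) * norm (h y) powr p) \<partial>lborel)"
    proof (rule norm_integral_le)
      show "integrable lborel (\<lambda>y. (regularized l i (x - y) - cr_kernel l (x - y)) \<star> h y)"
        unfolding cl.diff_left
        by (rule Bochner_Integration.integrable_diff [OF convolution_regularized(1) integrable_cr_kernel_density])
      show "integrable lborel (\<lambda>y. C * (t * truncated (shrink i) (x - y) + t powr (1 - p) * norm (h y) powr p))"
        by (intro integrable_mult_right Bochner_Integration.integrable_add refl h_powr)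
    qed (rule diff [OF t])
    also have "\<dots> = C * (t * (\<integral>y. truncated (shrink i) (x - y) \<partial>lborel) + t powr (1 - p) * ?H)"
      using refl h_powr by (simp add: Bochner_Integration.integral_add)
    also have "(\<integral>y. truncated (shrink i) (x - y) \<partial>lborel) = ?I i"
      by (rule integral_reflect(1) [OF truncated_measurable])
    finally show ?thesis .
  qed
  have H: "?H \<ge> 0" by (rule Bochner_Integration.integral_nonneg) simp
  show ?thesis
  proof (rule uniform_limitI)
    fix e :: real assume e: "e > 0"
    have "((\<lambda>t. C * (t powr (1 - p) * ?H)) \<longlongrightarrow> C * (0 * ?H)) at_top"
      using p_gt_1 by (intro tendsto_intros tendsto_neg_powr filterlim_ident) auto
    then have "\<forall>\<^sub>F t in at_top. C * (t powr (1 - p) * ?H) < e / 2"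
      using e by (intro order_tendstoD(2)) auto
    then obtain t where t: "t > 0" "C * (t powr (1 - p) * ?H) < e / 2"
      using eventually_gt_at_top [of "0 :: real"] by (metis (mono_tags, lifting) eventually_happens eventually_conj trivial_limit_at_top_linorder)
    have "(\<lambda>i. C * (t * ?I i)) \<longlonglongrightarrow> C * (t * 0)"
      by (intro tendsto_intros integral_truncated_tendsto_0)
    then have "\<forall>\<^sub>F i in sequentially. C * (t * ?I i) < e / 2"
      using e by (intro order_tendstoD(2)) auto
    then show "\<forall>\<^sub>F i in sequentially. \<forall>x\<in>UNIV. dist (\<integral>y. regularized l i (x - y) \<star> h y \<partial>lborel) (potential (cr_kernel l) h x) < e"
    proof (rule eventually_mono, intro ballI)
      fix i and x :: "'n point" assume i: "C * (t * ?I i) < e / 2"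
      have "dist (\<integral>y. regularized l i (x - y) \<star> h y \<partial>lborel) (potential (cr_kernel l) h x) \<le> C * (t * ?I i + t powr (1 - p) * ?H)"
        unfolding dist_norm by (rule est [OF t(1)])
      also have "\<dots> = C * (t * ?I i) + C * (t powr (1 - p) * ?H)" by (rule distrib_left)
      also have "\<dots> < e" using i t(2) by linarith
      finally show "dist (\<integral>y. regularized l i (x - y) \<star> h y \<partial>lborel) (potential (cr_kernel l) h x) < e" .
    qed
  qed
qed

proposition continuous_potential: "continuous_on UNIV (potential (cr_kernel l) h)"
proof (rule uniform_limit_theorem [OF _ uniform_limit_potential])
  show "\<forall>\<^sub>F i in sequentially. continuous_on UNIV (\<lambda>x. \<integral>y. regularized l i (x - y) \<star> h y \<partial>lborel)"
    by (rule always_eventually, rule allI, rule convolution_regularized(2))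
qed simp

proposition potential_tendsto_0_at_infinity:
  assumes l: "real l + 1 < N"
  shows "(potential (cr_kernel l) h \<longlongrightarrow> 0) at_infinity"
proof -
  obtain c where c: "c > 0" "\<And>a b :: 'n clifford. norm (a \<star> b) \<le> norm a * norm b * c"
    using norm_cl_mult_bound by blast
  let ?e = "real l + 1 - N"
  let ?H = "\<integral>y. norm (h y) \<partial>lborel"
  have bound: "norm (potential (cr_kernel l) h x) \<le> N * c * (norm x - R) powr ?e * ?H" if x: "norm x > R" for x
  proof -
    have "norm (potential (cr_kernel l) h x) \<le> (\<integral>y. N * c * (norm x - R) powr ?e * norm (h y) \<partial>lborel)"
      unfolding potential_def
    proof (rule norm_integral_le [OF integrable_cr_kernel_density])
      show "integrable lborel (\<lambda>y. N * c * (norm x - R) powr ?e * norm (h y))" using h_integrable by simp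
      fix y
      show "norm (cr_kernel l (x - y) \<star> h y) \<le> N * c * (norm x - R) powr ?e * norm (h y)"
      proof (cases "norm y > R")
        case True
        then show ?thesis using h_support by (simp add: cl.zero_right)
      next
        case False
        then have "norm x - R \<le> norm (x - y)" using norm_triangle_ineq2 [of x y] by linarith
        then have "norm (x - y) powr ?e \<le> (norm x - R) powr ?e" using x l by (intro powr_mono2') auto
        moreover have "norm (cr_kernel l (x - y) :: 'n clifford) \<le> N * norm (x - y) powr ?e"
          unfolding N_def by (rule norm_cr_kernel_le)
        ultimately have "norm (cr_kernel l (x - y) :: 'n clifford) \<le> N * (norm x - R) powr ?e"
          using N_ge_1 by (meson mult_left_mono order_trans less_le_trans less_imp_le zero_less_one)
        then have "norm (cr_kernel l (x - y) \<star> h y) \<le> N * (norm x - R) powr ?e * norm (h y) * c"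
          using c by (intro order_trans [OF c(2)] mult_right_mono) auto
        then show ?thesis by (simp only: mult_ac)
      qed
    qed
    then show ?thesis by simp
  qed
  show ?thesis
  proof (rule Lim_null_comparison)
    have "\<forall>\<^sub>F x in at_infinity. norm (x :: 'n point) \<ge> R + 1" by (auto simp: eventually_at_infinity)
    then show "\<forall>\<^sub>F x in at_infinity. norm (potential (cr_kernel l) h x) \<le> N * c * (norm x - R) powr ?e * ?H"
      by (rule eventually_mono) (rule bound, simp)
    have "filterlim (\<lambda>x :: 'n point. - R + norm x) at_top at_infinity"
      by (rule filterlim_tendsto_add_at_top [OF tendsto_const filterlim_norm_at_top])
    then have "filterlim (\<lambda>x :: 'n point. norm x - R) at_top at_infinity" by simp
    then have "((\<lambda>x :: 'n point. (norm x - R) powr ?e) \<longlongrightarrow> 0) at_infinity"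
      using l by (intro tendsto_neg_powr) auto
    then show "((\<lambda>x :: 'n point. N * c * (norm x - R) powr ?e * ?H) \<longlongrightarrow> 0) at_infinity"
      by (intro tendsto_mult_left_zero tendsto_mult_right_zero)
  qed
qed

end

section \<open>The jump problem\<close>

subsection \<open>Iterated Cauchy-Riemann operators\<close>

lemma cr_pow_Suc: "(cauchy_riemann ^^ Suc i) f = cauchy_riemann ((cauchy_riemann ^^ i) f)"
  by simp

lemma ck_cauchy_riemann:
  assumes "open U" "ck (Suc k) f U"
  shows "ck k (cauchy_riemann f) U"
  unfolding cauchy_riemann_def [abs_def] partial_deriv_eq_pd
  by (intro ck_sum assms(1) ck_bounded_linear [OF assms(1) cl.bounded_linear_right] ck_SucE(2) [OF assms(2)])

lemma ck_cr_pow: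
  assumes "open U" "ck (k + i) f U"
  shows "ck k ((cauchy_riemann ^^ i) f) U"
  using assms(2)
proof (induction i arbitrary: k)
  case (Suc i)
  then have "ck (Suc k) ((cauchy_riemann ^^ i) f) U" by (intro Suc.IH) (simp del: ck.simps)
  then show ?case unfolding cr_pow_Suc by (rule ck_cauchy_riemann [OF assms(1)])
qed simp

lemma cr_cong_open:
  assumes "open U" "\<And>x. x \<in> U \<Longrightarrow> f x = g x" "x \<in> U"
  shows "cauchy_riemann f x = cauchy_riemann g x"
  unfolding cauchy_riemann_def partial_deriv_eq_pd using pd_cong_open [OF assms(1,3,2)] by (intro sum.cong) auto

lemma cr_pow_cong_open:
  assumes "open U" "\<And>x. x \<in> U \<Longrightarrow> f x = g x" "x \<in> U"
  shows "(cauchy_riemann ^^ i) f x = (cauchy_riemann ^^ i) g x"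
  using assms(3)
proof (induction i arbitrary: x)
  case (Suc i)
  show ?case unfolding cr_pow_Suc by (rule cr_cong_open [OF assms(1) Suc.IH Suc.prems])
qed (simp add: assms(2))

lemma cr_pow_0: "(cauchy_riemann ^^ i) (\<lambda>_. 0) = (\<lambda>_. 0)"
proof (induction i)
  case (Suc i)
  show ?case unfolding cr_pow_Suc Suc
    by (intro ext) (simp add: cauchy_riemann_def partial_deriv_eq_pd pd_const cl.zero_right)
qed simp

lemma cr_pow_add_scaleR:
  assumes U: "open U" and fg: "ck i f U" "ck i g U" and x: "x \<in> U"
  shows "(cauchy_riemann ^^ i) (\<lambda>x. f x + a *\<^sub>R g x) x = (cauchy_riemann ^^ i) f x + a *\<^sub>R (cauchy_riemann ^^ i) g x"
  using fg x
proof (induction i arbitrary: x)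
  case (Suc i)
  let ?F = "(cauchy_riemann ^^ i) f" and ?G = "(cauchy_riemann ^^ i) g"
  have c: "ck (Suc 0) ?F U" "ck (Suc 0) ?G U"
    using Suc.prems by (auto intro!: ck_cr_pow [OF U] simp del: ck.simps)
  have c': "ck i f U" "ck i g U" by (rule ck_SucD [OF Suc.prems(1)], rule ck_SucD [OF Suc.prems(2)])
  have "cauchy_riemann ((cauchy_riemann ^^ i) (\<lambda>x. f x + a *\<^sub>R g x)) x = cauchy_riemann (\<lambda>x. ?F x + a *\<^sub>R ?G x) x"
    by (rule cr_cong_open [OF U Suc.IH [OF c'] Suc.prems(3)])
  also have "\<dots> = (\<Sum>j\<in>UNIV. cl_e j \<star> (pd j ?F x + a *\<^sub>R pd j ?G x))"
  proof -
    have "pd j (\<lambda>x. ?F x + a *\<^sub>R ?G x) x = pd j ?F x + a *\<^sub>R pd j ?G x" for j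
      by (rule has_pd_imp_pd [OF has_pd_add [OF ck_SucE(1) [OF c(1) Suc.prems(3)]
            has_pd_bounded_linear [OF bounded_linear_scaleR_right ck_SucE(1) [OF c(2) Suc.prems(3)]]]])
    then show ?thesis by (simp only: cauchy_riemann_def partial_deriv_eq_pd)
  qed
  also have "\<dots> = cauchy_riemann ?F x + a *\<^sub>R cauchy_riemann ?G x"
    by (simp add: cauchy_riemann_def partial_deriv_eq_pd cl.add_right cl.scaleR_right sum.distrib scaleR_sum_right)
  finally show ?case by simp
qed simp

lemma sum_words_Suc:
  "(\<Sum>rs | length rs = Suc i. F rs) = (\<Sum>r\<in>UNIV. \<Sum>rs | length rs = i. F (r # rs))"
  for F :: "'a::finite list \<Rightarrow> 'b::comm_monoid_add"
proof -
  have "{rs :: 'a list. length rs = Suc i} = (\<lambda>(r, rs). r # rs) ` (UNIV \<times> {rs. length rs = i})"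
    by (auto simp: length_Suc_conv image_iff)
  then have "(\<Sum>rs | length rs = Suc i. F rs) = sum F ((\<lambda>(r, rs). r # rs) ` (UNIV \<times> {rs. length rs = i}))"
    by (simp only:)
  also have "\<dots> = sum (F \<circ> (\<lambda>(r, rs). r # rs)) (UNIV \<times> {rs. length rs = i})"
    by (rule sum.reindex) (auto simp: inj_on_def)
  also have "\<dots> = (\<Sum>(r, rs)\<in>UNIV \<times> {rs. length rs = i}. F (r # rs))"
    by (rule sum.cong) auto
  also have "\<dots> = (\<Sum>r\<in>UNIV. \<Sum>rs | length rs = i. F (r # rs))"
    by (rule sum.cartesian_product [symmetric])
  finally show ?thesis .
qed

lemma cr_pow_eq_words:
  assumes U: "open U" and f: "ck i f U" and x: "x \<in> U"
  shows "(cauchy_riemann ^^ i) f x = (\<Sum>rs | length rs = i. cl_prod_list (map cl_e rs) \<star> pd_word rs f x)"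
  using f x
proof (induction i arbitrary: x)
  case 0
  then show ?case by (simp add: cl_prod_list_def cl_one_left)
next
  case (Suc i)
  let ?c = "\<lambda>rs. cl_prod_list (map cl_e rs)"
  have d: "has_pd (pd_word rs f) (pd r (pd_word rs f) x) r x" if "length rs = i" for rs r
    using ck_pd_word [of "Suc 0" rs f U] Suc.prems that by (intro ck_SucE(1)) (auto simp del: ck.simps)
  have "(cauchy_riemann ^^ Suc i) f x = cauchy_riemann (\<lambda>x. \<Sum>rs | length rs = i. ?c rs \<star> pd_word rs f x) x"
    unfolding cr_pow_Suc by (rule cr_cong_open [OF U Suc.IH [OF ck_SucD [OF Suc.prems(1)]] Suc.prems(2)])
  also have "\<dots> = (\<Sum>r\<in>UNIV. cl_e r \<star> (\<Sum>rs | length rs = i. ?c rs \<star> pd r (pd_word rs f) x))"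
  proof -
    have "pd r (\<lambda>x. \<Sum>rs | length rs = i. ?c rs \<star> pd_word rs f x) x = (\<Sum>rs | length rs = i. ?c rs \<star> pd r (pd_word rs f) x)" for r
      by (rule has_pd_imp_pd [OF has_pd_sum], rule has_pd_bounded_linear [OF cl.bounded_linear_right d]) simp
    then show ?thesis by (simp only: cauchy_riemann_def partial_deriv_eq_pd)
  qed
  also have "\<dots> = (\<Sum>rs | length rs = Suc i. ?c rs \<star> pd_word rs f x)"
    unfolding sum_words_Suc by (simp add: cl.sum_right cl_prod_list_def cl_mult_assoc)
  finally show ?case .
qed

subsection \<open>Continuity of the data\<close>

text \<open>
  The Taylor polynomial at \<open>q\<close> links the values of the jet entry at \<open>x\<close> and at \<open>q\<close>.
\<close>

lemma continuous_on_whitney_jet: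
  fixes f :: "'n::finite multiindex \<Rightarrow> 'n point \<Rightarrow> 'b::real_normed_vector"
  assumes jet: "whitney_jet S m \<nu> M f" and \<nu>: "\<nu> > 0" and j: "mi_abs j \<le> m"
  shows "continuous_on S (f j)"
  unfolding continuous_on_def
proof
  fix q assume q: "q \<in> S"
  define c where "c = real (card {l :: 'n multiindex. mi_abs l \<le> m - mi_abs j}) * M"
  let ?a = "real m + \<nu> - real (mi_abs j)"
  have a: "?a > 0" using j \<nu> by linarith
  show "(f j \<longlongrightarrow> f j q) (at q within S)"
  proof (rule LIM_zero_cancel, rule Lim_null_comparison)
    let ?h = "\<lambda>x. M * dist x q powr ?a + c * dist x q"
    have "\<forall>\<^sub>F x in at q within S. dist x q < 1"
      using tendstoD [OF tendsto_ident_at, of 1 q S] by simp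
    moreover have "\<forall>\<^sub>F x in at q within S. x \<in> S" by (auto simp: eventually_at_filter)
    ultimately show "\<forall>\<^sub>F x in at q within S. norm (f j x - f j q) \<le> ?h x"
    proof eventually_elim
      case (elim x)
      have "norm (f j x - taylor (m - mi_abs j) (mi_shift j f) q x) \<le> M * dist x q powr ?a"
        using jet j elim(2) q by (simp add: whitney_jet_def dist_norm)
      moreover have "norm (taylor (m - mi_abs j) (mi_shift j f) q x - mi_shift j f (\<lambda>_. 0) q) \<le> c * norm (x - q)"
        unfolding c_def
      proof (rule norm_taylor_diff_center_le)
        show "norm (mi_shift j f l q) \<le> M" if "mi_abs l \<le> m - mi_abs j" for l
          using jet that j q by (simp add: whitney_jet_def mi_shift_def mi_abs_plus)
      qed (use elim in \<open>simp add: dist_norm\<close>)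
      moreover have "mi_shift j f (\<lambda>_. 0) q = f j q" by (simp add: mi_shift_def mi_plus_def)
      ultimately show ?case
        using norm_triangle_ineq [of "f j x - taylor (m - mi_abs j) (mi_shift j f) q x" "taylor (m - mi_abs j) (mi_shift j f) q x - f j q"]
        by (simp add: dist_norm)
    qed
    have "((\<lambda>x. dist x q) \<longlongrightarrow> dist q q) (at q within S)" by (intro tendsto_intros)
    then have t: "((\<lambda>x. dist x q) \<longlongrightarrow> 0) (at q within S)" by simp
    have "(?h \<longlongrightarrow> M * 0 powr ?a + c * 0) (at q within S)"
      using a by (intro tendsto_intros t tendsto_powr' disjI2 conjI) auto
    then show "(?h \<longlongrightarrow> 0) (at q within S)" using a by simp
  qed
qed

lemma continuous_on_jump_datum:
  assumes "whitney_jet S m \<nu> M f" "\<nu> > 0" "i \<le> m"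
  shows "continuous_on S (jump_datum f i)"
  unfolding jump_datum_def [abs_def]
  by (intro continuous_on_sum cl.continuous_on continuous_on_const continuous_on_whitney_jet [OF assms(1,2)])
     (use assms(3) in \<open>simp add: mi_abs_of_list\<close>)

lemma whitney_jet_minus:
  assumes "whitney_jet S m \<nu> M f"
  shows "whitney_jet S m \<nu> M (\<lambda>j x. - f j x)"
proof -
  have "- f j x - taylor i (mi_shift j (\<lambda>j x. - f j x)) y x = - (f j x - taylor i (mi_shift j f) y x)" for i j x y
    by (simp add: taylor_def mi_shift_def sum_negf)
  then show ?thesis using assms unfolding whitney_jet_def by (simp only: norm_minus_cancel)
qed

lemma jump_datum_minus: "jump_datum (\<lambda>j x. - f j x) i x = - jump_datum f i x"
  by (simp add: jump_datum_def cl.minus_right sum_negf)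

text \<open>
  The limits along \<open>U\<close> alone do not control the extension along \<open>S\<close>, hence the continuity of \<open>J\<close> there.
\<close>

lemma continuous_extension_glue:
  assumes U: "open U" "U \<inter> S = {}" and g: "continuous_on U g" and J: "continuous_on S J"
    and lim: "\<And>q. q \<in> S \<Longrightarrow> (g \<longlongrightarrow> J q) (at q within U)"
  shows "continuous_extension g U S (\<lambda>x. if x \<in> U then g x else J x)"
  unfolding continuous_extension_def
proof (intro conjI ballI)
  let ?G = "\<lambda>x. if x \<in> U then g x else J x"
  show "continuous_on (U \<union> S) ?G"
    unfolding continuous_on_def
  proof
    fix x assume x: "x \<in> U \<union> S"
    have evU: "\<forall>\<^sub>F y in at x within U. g y = ?G y"
      unfolding eventually_at_filter by (rule always_eventually) auto
    have evS: "\<forall>\<^sub>F y in at x within S. J y = ?G y"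
      unfolding eventually_at_filter by (rule always_eventually) (use U(2) in auto)
    show "(?G \<longlongrightarrow> ?G x) (at x within U \<union> S)"
    proof (cases "x \<in> U")
      case True
      have "(g \<longlongrightarrow> g x) (at x within U)" using g True by (auto simp: continuous_on_def)
      then have "(?G \<longlongrightarrow> ?G x) (at x within U)" using evU True by (simp add: Lim_transform_eventually)
      moreover have "at x within U = at x within U \<union> S"
        by (rule at_within_nhd [OF True U(1)]) auto
      ultimately show ?thesis by simp
    next
      case False
      then have xS: "x \<in> S" using x by blast
      have "(?G \<longlongrightarrow> J x) (at x within U)" using lim [OF xS] evU by (rule Lim_transform_eventually)
      moreover have "(?G \<longlongrightarrow> J x) (at x within S)"
        using J xS evS by (auto simp: continuous_on_def intro: Lim_transform_eventually)
      ultimately show ?thesis using False unfolding at_within_union by (simp add: filterlim_sup)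
    qed
  qed
qed simp

subsection \<open>Solution with the correction supported on one side\<close>

lemma integrable_powr_density:
  fixes h :: "'a::euclidean_space \<Rightarrow> 'b::euclidean_space"
  assumes m: "h \<in> borel_measurable borel" and D: "D \<in> sets borel" "dist_integral S p0 D < \<infinity>" and a: "a \<ge> 0"
    and le: "\<And>x. norm (h x) powr p \<le> a * (indicator D x / infdist x S powr p0 + indicator (cball 0 R) x)"
  shows "integrable lborel (\<lambda>x. norm (h x) powr p)"
proof (rule integrableI_bounded)
  show "(\<lambda>x. norm (h x) powr p) \<in> borel_measurable lborel"
    unfolding measurable_lborel2
    by (intro powr_real_measurable borel_measurable_const measurable_compose [OF m borel_measurable_norm])
  have infd: "(\<lambda>x :: 'a. infdist x S) \<in> borel_measurable borel"
    by (intro borel_measurable_continuous_onI continuous_intros)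
  have meas: "(\<lambda>x. ennreal (1 / infdist x S powr p0) * indicator D x) \<in> borel_measurable lborel"
    unfolding measurable_lborel2 using infd D(1) by measurable
  have "(\<integral>\<^sup>+ x. ennreal (norm (norm (h x) powr p)) \<partial>lborel)
      \<le> (\<integral>\<^sup>+ x. ennreal a * (ennreal (1 / infdist x S powr p0) * indicator D x + indicator (cball 0 R) x) \<partial>lborel)"
  proof (rule nn_integral_mono)
    fix x
    have "ennreal (norm (h x) powr p) \<le> ennreal (a * (indicator D x / infdist x S powr p0 + indicator (cball 0 R) x))"
      by (rule ennreal_leI [OF le])
    also have "\<dots> = ennreal a * (ennreal (indicator D x / infdist x S powr p0) + ennreal (indicator (cball 0 R) x))"
      using a by (simp add: ennreal_mult ennreal_plus)
    also have "ennreal (indicator D x / infdist x S powr p0) = ennreal (1 / infdist x S powr p0) * indicator D x"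
      by (simp add: indicator_def)
    also have "ennreal (indicator (cball 0 R) x) = indicator (cball 0 R) x" by (simp add: indicator_def)
    finally show "ennreal (norm (norm (h x) powr p)) \<le> ennreal a * (ennreal (1 / infdist x S powr p0) * indicator D x + indicator (cball 0 R) x)"
      by simp
  qed
  also have "\<dots> = ennreal a * (dist_integral S p0 D + emeasure lborel (cball (0 :: 'a) R))"
  proof -
    have "(\<lambda>x :: 'a. indicator (cball 0 R) x :: ennreal) \<in> borel_measurable lborel"
      unfolding measurable_lborel2 by (intro borel_measurable_indicator borel_closed closed_cball)
    then show ?thesis
      using meas unfolding dist_integral_def
      by (subst nn_integral_cmult) (auto simp: nn_integral_add borel_measurable_add)
  qed
  also have "\<dots> < \<infinity>"
    using D(2) emeasure_lborel_cball_finite [of "0 :: 'a" R] by (simp add: ennreal_mult_less_top)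
  finally show "(\<integral>\<^sup>+ x. ennreal (norm (norm (h x) powr p)) \<partial>lborel) < \<infinity>" .
qed

text \<open>
  The solution \<open>\<Psi>\<close> is the extension cut off to \<open>U\<close> plus the potential that repairs \<open>\<D>\<^sup>k \<Psi> = 0\<close>. Its
  derivatives are those of the extension on \<open>U\<close> plus functions \<open>W i\<close> which are continuous everywhere, so
  that only the extension jumps. On \<open>U\<close> the formulation uses limits at \<open>S\<close>, on the other side an
  identity; this treats both choices of \<open>U\<close> alike, although only one of the two domains is known to
  have all of \<open>S\<close> in its boundary.
\<close>

theorem one_sided_solution:
  fixes S U :: "'n::{finite,linorder} point set" and f :: "'n multiindex \<Rightarrow> 'n point \<Rightarrow> 'n clifford"
  assumes S: "compact S" "S \<noteq> {}" and U: "open U" "U \<subseteq> - S" "open (- S - U)"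
    and r: "S \<subseteq> ball 0 r"
    and jet: "whitney_jet S (k - 1) \<nu> M f" "M > 0" and \<nu>: "0 < \<nu>" "\<nu> \<le> 1"
    and k: "k \<ge> 1" "k < CARD('n option)"
    and p0: "p0 > real CARD('n option) * (1 - \<nu>)" "dist_integral S p0 (U \<inter> ball 0 r) < \<infinity>"
  obtains \<Psi> W where "polymonogenic_on k \<Psi> (- S)"
    "\<And>i. i < k \<Longrightarrow> continuous_on UNIV (W i)"
    "\<And>i q. i < k \<Longrightarrow> q \<in> S \<Longrightarrow> ((cauchy_riemann ^^ i) \<Psi> \<longlongrightarrow> jump_datum f i q + W i q) (at q within U)"
    "\<And>i x. i < k \<Longrightarrow> x \<in> - S - U \<Longrightarrow> (cauchy_riemann ^^ i) \<Psi> x = W i x"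
    "\<And>i. i < k \<Longrightarrow> ((cauchy_riemann ^^ i) \<Psi> \<longlongrightarrow> 0) at_infinity"
proof -
  define N where "N = real CARD('n option)"
  have N: "N \<ge> 1" "real k < N" using k by (simp_all add: N_def del: card_option)
  \<comment> \<open>order 2 k: the density is a derivative of order k and has to be of class \<open>C\<^sup>k\<close> for the potential to be so\<close>
  interpret we: whitney_extension S "k - 1" \<nu> M f "2 * k" N
    by unfold_locales (use S jet \<nu> N_def in auto)
  define V where "V = - S - U"
  have openS: "open (- S)" using S(1) by (simp add: compact_imp_closed open_Compl)
  have V: "open V" "V \<subseteq> - S" "- S = U \<union> V" "U \<inter> V = {}" using U by (auto simp: V_def)
  define F where "F = we.extension"
  have ckF: "ck (2 * k) F (- S)" unfolding F_def by (rule we.ck_extension)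
  define H where "H = (cauchy_riemann ^^ k) F"
  have ckH: "ck k H (- S)" unfolding H_def by (rule ck_cr_pow [OF openS]) (use ckF in \<open>simp add: mult_2\<close>)
  obtain R0 where R0: "\<And>q. q \<in> S \<Longrightarrow> norm q \<le> R0"
    using compact_imp_bounded [OF S(1)] by (auto simp: bounded_iff)
  define R where "R = R0 + 3 * N"
  have far: "x \<in> - S" "F x = 0" if "norm x > R" for x
  proof -
    have "infdist x S > 3 * N"
    proof -
      have "norm x \<le> norm (we.nearest x) + dist x (we.nearest x)"
        using norm_triangle_ineq2 [of x "we.nearest x"] by (simp add: dist_norm)
      then show ?thesis using that R0 [OF we.nearest(1), of x] we.nearest(2) [of x] by (simp add: R_def)
    qed
    then show "F x = 0" unfolding F_def by (rule we.extension_eq_0)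
    show "x \<in> - S" using that R0 [of x] N by (auto simp: R_def)
  qed
  have open_far: "open {x :: 'n point. norm x > R}" by (intro open_Collect_less continuous_intros)
  have far_pow: "(cauchy_riemann ^^ i) F x = 0" if "norm x > R" for i x
    using cr_pow_cong_open [OF open_far, of F "\<lambda>_. 0" x i] far(2) that by (simp add: cr_pow_0)

  define h where "h = (\<lambda>x. if x \<in> U then H x else 0)"
  define G where "G = (\<lambda>x. if x \<in> U then F x else 0)"
  have cut: "ck l (\<lambda>x. if x \<in> U then g x else 0) (- S)" if "ck l g (- S)" for l and g :: "'n point \<Rightarrow> 'n clifford"
  proof (rule ck_local)
    fix x assume "x \<in> - S"
    then consider "x \<in> U" | "x \<in> V" using V(3) by blast
    then show "\<exists>W. open W \<and> x \<in> W \<and> ck l (\<lambda>x. if x \<in> U then g x else 0) W"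
    proof cases
      case 1
      have "ck l (\<lambda>x. if x \<in> U then g x else 0) U"
        using ck_cong_open [OF U(1), of "\<lambda>x. if x \<in> U then g x else 0" g l] ck_subset [OF that U(2)] by simp
      with 1 U(1) show ?thesis by blast
    next
      case 2
      have "ck l (\<lambda>x. if x \<in> U then g x else 0) V"
        by (rule ck_cong_open [OF V(1), THEN iffD2, OF _ ck_const [of l 0 V]]) (use V(4) in auto)
      with 2 V(1) show ?thesis by blast
    qed
  qed
  have ckh: "ck k h (- S)" unfolding h_def by (rule cut [OF ckH])
  have ckG: "ck (2 * k) G (- S)" unfolding G_def by (rule cut [OF ckF])
  have h_support: "h x = 0" if "norm x > R" for x
    using far_pow [OF that, of k] by (simp add: h_def H_def)
  have h_meas: "h \<in> borel_measurable borel"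
  proof -
    have "(\<lambda>x. indicator (- S) x *\<^sub>R h x) \<in> borel_measurable borel"
      by (intro borel_measurable_continuous_on_indicator ck_imp_continuous [OF ckh]) (use openS in auto)
    moreover have "(\<lambda>x. indicator (- S) x *\<^sub>R h x) = h"
      by (intro ext) (use U(2) in \<open>auto simp: h_def indicator_def\<close>)
    ultimately show ?thesis by simp
  qed

  obtain C1 where C1: "C1 > 0" "\<And>x rs. x \<notin> S \<Longrightarrow> infdist x S < N \<Longrightarrow> length rs = k \<Longrightarrow>
      norm (pd_word rs F x) \<le> C1 * infdist x S powr (\<nu> - 1)"
    using we.norm_pd_word_extension_top_le k(1) unfolding F_def by fastforce
  have "\<exists>C>0. \<forall>x\<in>- S. infdist x S < N \<longrightarrow> norm (H x) \<le> C * infdist x S powr (\<nu> - 1)"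
  proof -
    obtain c where c: "c > 0" "\<And>a b :: 'n clifford. norm (a \<star> b) \<le> norm a * norm b * c"
      using norm_cl_mult_bound by blast
    let ?w = "\<lambda>rs :: 'n option list. cl_prod_list (map cl_e rs) :: 'n clifford"
    define C where "C = 1 + (\<Sum>rs | length rs = k. norm (?w rs) * C1 * c)"
    have "norm (H x) \<le> C * infdist x S powr (\<nu> - 1)" if x: "x \<in> - S" "infdist x S < N" for x
    proof -
      have "H x = (\<Sum>rs | length rs = k. ?w rs \<star> pd_word rs F x)"
        unfolding H_def by (rule cr_pow_eq_words [OF openS ck_mono [OF ckF] x(1)]) simp
      also have "norm \<dots> \<le> (\<Sum>rs | length rs = k. norm (?w rs) * C1 * c * infdist x S powr (\<nu> - 1))"
      proof (rule sum_norm_le)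
        fix rs :: "'n option list" assume "rs \<in> {rs. length rs = k}"
        then have "norm (pd_word rs F x) \<le> C1 * infdist x S powr (\<nu> - 1)" using x by (intro C1(2)) auto
        then have "norm (?w rs) * norm (pd_word rs F x) * c \<le> norm (?w rs) * (C1 * infdist x S powr (\<nu> - 1)) * c"
          using c by (intro mult_right_mono mult_left_mono) auto
        then show "norm (?w rs \<star> pd_word rs F x) \<le> norm (?w rs) * C1 * c * infdist x S powr (\<nu> - 1)"
          using c(2) [of "?w rs" "pd_word rs F x"] by (simp add: mult_ac)
      qed
      also have "\<dots> \<le> C * infdist x S powr (\<nu> - 1)"
        unfolding C_def sum_distrib_right [symmetric] by (intro mult_right_mono) auto
      finally show ?thesis .
    qed
    moreover have "C > 0"
      unfolding C_def using C1 c by (intro add_pos_nonneg sum_nonneg) auto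
    ultimately show ?thesis by blast
  qed
  then obtain C where C: "C > 0" "\<And>x. x \<in> - S \<Longrightarrow> infdist x S < N \<Longrightarrow> norm (H x) \<le> C * infdist x S powr (\<nu> - 1)"
    by blast
  obtain \<delta>1 where \<delta>1: "\<delta>1 > 0" "{x. infdist x S \<le> \<delta>1} \<subseteq> ball 0 r"
    using compact_in_open_separated [OF S(2,1) open_ball r] by metis
  define \<delta> where "\<delta> = min \<delta>1 (N / 2)"
  have \<delta>: "\<delta> > 0" "\<delta> \<le> \<delta>1" "\<delta> < N" using \<delta>1 N by (auto simp: \<delta>_def)
  obtain B where B: "B > 0" "\<And>x. norm x \<le> R \<Longrightarrow> infdist x S \<ge> \<delta> \<Longrightarrow> norm (H x) \<le> B"
  proof -
    let ?A = "cball 0 R \<inter> {x. infdist x S \<ge> \<delta>}"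
    have "compact ?A" by (intro compact_Int_closed compact_cball closed_Collect_le continuous_intros)
    moreover have "?A \<subseteq> - S" using \<delta>(1) by auto
    ultimately have "bounded (H ` ?A)"
      by (intro compact_imp_bounded compact_continuous_image continuous_on_subset [OF ck_imp_continuous [OF ckH]])
    then show ?thesis using that by (force simp: bounded_pos)
  qed
  let ?D = "U \<inter> ball 0 r"
  have near: "norm (h x) \<le> C * infdist x S powr (\<nu> - 1)" "x \<in> ?D" if "x \<in> U" "infdist x S < \<delta>" for x
  proof -
    show "norm (h x) \<le> C * infdist x S powr (\<nu> - 1)" using C(2) [of x] that U(2) \<delta> by (auto simp: h_def)
    show "x \<in> ?D" using that \<delta> \<delta>1 by force
  qed
  have away: "norm (h x) \<le> B * indicator (cball 0 R) x" if "\<not> (x \<in> U \<and> infdist x S < \<delta>)" for x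
    using that B h_support [of x] by (auto simp: h_def indicator_def not_less not_le)
  have "\<exists>p>N. integrable lborel (\<lambda>x. norm (h x) powr p)"
  proof -
    have D: "?D \<in> sets borel" using U(1) by auto
    have "\<exists>p>N. \<exists>a\<ge>0. \<forall>x. norm (h x) powr p \<le> a * (indicator ?D x / infdist x S powr p0 + indicator (cball 0 R) x)"
    proof (cases "\<nu> = 1")
      case True
      \<comment> \<open>for \<open>\<nu> = 1\<close> the density is bounded and any exponent above N will do\<close>
      have "norm (h x) powr (N + 1) \<le> (C + B) powr (N + 1) * (indicator ?D x / infdist x S powr p0 + indicator (cball 0 R) x)" for x
      proof (cases "norm x \<le> R")
        case xR: True
        have "norm (h x) \<le> C + B"
        proof (cases "x \<in> U \<and> infdist x S < \<delta>")
          case True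
          with near(1) [of x] \<open>\<nu> = 1\<close> B(1) C(1) show ?thesis by (auto split: if_splits simp: powr_def)
        next
          case False
          with away [OF this] C(1) xR show ?thesis by simp
        qed
        then have "norm (h x) powr (N + 1) \<le> (C + B) powr (N + 1) * 1"
          using N by (simp add: powr_mono2)
        also have "\<dots> \<le> (C + B) powr (N + 1) * (indicator ?D x / infdist x S powr p0 + indicator (cball 0 R) x)"
          using xR by (intro mult_left_mono) auto
        finally show ?thesis .
      qed (use h_support in auto)
      then show ?thesis by (intro exI [of _ "N + 1"] conjI exI [of _ "(C + B) powr (N + 1)"]) auto
    next
      case False
      then have \<nu>1: "\<nu> < 1" using \<nu> by simp
      \<comment> \<open>chosen so that the bound \<open>dist powr (\<nu> - 1)\<close> has p-th power \<open>1 / dist powr p0\<close>\<close>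
      define p where "p = p0 / (1 - \<nu>)"
      have p: "p > N" "(\<nu> - 1) * p = - p0"
        using p0(1) \<nu>1 by (simp_all add: p_def N_def field_simps)
      define a where "a = C powr p + B powr p"
      have "norm (h x) powr p \<le> a * (indicator ?D x / infdist x S powr p0 + indicator (cball 0 R) x)" for x
      proof (cases "x \<in> U \<and> infdist x S < \<delta>")
        case True
        then have x: "x \<in> ?D" "infdist x S > 0" using near(2) U(2) we.infdist_pos by auto
        have "norm (h x) powr p \<le> (C * infdist x S powr (\<nu> - 1)) powr p"
          using near(1) True p N by (intro powr_mono2) auto
        also have "\<dots> = C powr p * (1 / infdist x S powr p0)"
          using C(1) by (simp add: powr_mult powr_powr p powr_minus divide_inverse)
        also have "\<dots> \<le> a * (indicator ?D x / infdist x S powr p0 + indicator (cball 0 R) x)"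
          using x by (intro mult_mono) (auto simp: a_def)
        finally show ?thesis .
      next
        case False
        show ?thesis
        proof (cases "norm x \<le> R")
          case True
          with away [OF False] have "norm (h x) powr p \<le> B powr p * 1"
            using p N by (simp add: powr_mono2)
          also have "\<dots> \<le> a * (indicator ?D x / infdist x S powr p0 + indicator (cball 0 R) x)"
            using True by (intro mult_mono) (auto simp: a_def)
          finally show ?thesis .
        qed (use h_support in \<open>auto simp: a_def\<close>)
      qed
      moreover have "a \<ge> 0" by (simp add: a_def)
      ultimately show ?thesis using p(1) by blast
    qed
    then show ?thesis using integrable_powr_density [OF h_meas D p0(2)] by blast
  qed
  then obtain p where p: "p > N" "integrable lborel (\<lambda>x. norm (h x) powr p)" by blast
  have h_int: "integrable lborel h"
  proof (rule Bochner_Integration.integrable_bound)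
    show "integrable lborel (\<lambda>x. indicator (cball 0 R) x *\<^sub>R 1 + norm (h x) powr p)"
      by (intro Bochner_Integration.integrable_add p borel_integrable_compact) auto
    show "AE x in lborel. norm (h x) \<le> norm (indicator (cball 0 R) x *\<^sub>R 1 + norm (h x) powr p)"
    proof (rule AE_I2)
      fix x
      show "norm (h x) \<le> norm (indicator (cball 0 R) x *\<^sub>R 1 + norm (h x) powr p)"
      proof (cases "norm x \<le> R \<and> norm (h x) > 1")
        case True
        then have "norm (h x) powr 1 \<le> norm (h x) powr p" using p N by (intro powr_mono) auto
        with True show ?thesis by simp
      next
        case False
        then have "norm (h x) \<le> indicator (cball 0 R) x *\<^sub>R 1"
          using h_support [of x] by (cases "norm x \<le> R") auto
        then have "norm (h x) \<le> indicator (cball 0 R) x *\<^sub>R 1 + norm (h x) powr p"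
          by (rule add_increasing2 [rotated]) simp
        then show ?thesis by (rule order_trans) (simp only: real_norm_def abs_ge_self)
      qed
    qed
  qed (use h_meas in simp)
  interpret de: powr_integrable_density h p R N
    by unfold_locales (use N_def p h_int h_support in auto)

  define c where "c = (\<integral>z. real CARD('n option) * (1 + real CARD('n option) / 2) * max 0 (1 - z \<bullet> z) \<partial>(lborel :: 'n point measure))"
  have c: "c > 0" unfolding c_def by (rule approximate_identity_mass_pos) (simp add: add_pos_pos del: card_option)
  have step: "kernel_step (cr_kernel l :: 'n point \<Rightarrow> 'n clifford) (cr_prev l) (if l = 0 then c else 0)" for l
    unfolding c_def by (rule kernel_step_cr_kernel)
  define P where "P i = potential (cr_kernel (k - 1 - i)) h" for i
  have ckh1: "ck 1 h (- S)" by (rule ck_mono [OF ckh k(1)])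
  have crP: "(cauchy_riemann ^^ i) (P 0) x = P i x" if "i < k" "x \<in> - S" for i x
    using that
  proof (induction i arbitrary: x)
    case (Suc i)
    have "(cauchy_riemann ^^ Suc i) (P 0) x = cauchy_riemann (P i) x"
      unfolding cr_pow_Suc using Suc by (intro cr_cong_open [OF openS]) auto
    also have "\<dots> = potential (cr_prev (k - 1 - i)) h x + (if k - 1 - i = 0 then c else 0) *\<^sub>R h x"
      unfolding P_def by (rule cauchy_riemann_potential [OF step h_int h_support openS ckh1 Suc.prems(2)])
    also have "k - 1 - i = Suc (k - 1 - Suc i)" using Suc.prems(1) by simp
    finally show ?case by (simp add: cr_prev_simps P_def)
  qed simp
  have crPk: "(cauchy_riemann ^^ k) (P 0) x = c *\<^sub>R h x" if "x \<in> - S" for x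
  proof -
    obtain k' where k': "k = Suc k'" using k(1) by (cases k) auto
    have "(cauchy_riemann ^^ k) (P 0) x = cauchy_riemann (P k') x"
      unfolding k' cr_pow_Suc using crP that by (intro cr_cong_open [OF openS]) (auto simp: k')
    also have "\<dots> = potential (cr_prev (k - 1 - k')) h x + (if k - 1 - k' = 0 then c else 0) *\<^sub>R h x"
      unfolding P_def by (rule cauchy_riemann_potential [OF step h_int h_support openS ckh1 that])
    finally show ?thesis by (simp add: k' cr_prev_simps potential_def cl.zero_left)
  qed
  have ckP: "ck k (P 0) (- S)"
    unfolding P_def by (rule ck_potential [OF locally_integrable_cr_kernel ck_cr_kernel h_int h_support openS ckh])
  define \<Psi> where "\<Psi> = (\<lambda>x. G x + (- 1 / c) *\<^sub>R P 0 x)"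
  define W where "W i = (\<lambda>x. (- 1 / c) *\<^sub>R P i x)" for i
  have cr\<Psi>: "(cauchy_riemann ^^ i) \<Psi> x = (cauchy_riemann ^^ i) G x + (- 1 / c) *\<^sub>R (cauchy_riemann ^^ i) (P 0) x"
    if "i \<le> k" "x \<in> - S" for i x
    unfolding \<Psi>_def using that by (intro cr_pow_add_scaleR [OF openS]) (auto intro: ck_mono [OF ckG] ck_mono [OF ckP])
  have crG: "(cauchy_riemann ^^ i) G x = (if x \<in> U then (cauchy_riemann ^^ i) F x else 0)" if "x \<in> - S" for i x
  proof (cases "x \<in> U")
    case True
    then show ?thesis using cr_pow_cong_open [OF U(1), of G F x i] by (simp add: G_def)
  next
    case False
    then have "x \<in> V" using that V(3) by blast
    moreover have "G y = 0" if "y \<in> V" for y using V(4) that by (auto simp: G_def)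
    ultimately have "(cauchy_riemann ^^ i) G x = (cauchy_riemann ^^ i) (\<lambda>_. 0) x"
      by (intro cr_pow_cong_open [OF V(1)])
    then show ?thesis using False by (simp add: cr_pow_0)
  qed
  show ?thesis
  proof (rule that [of \<Psi> W])
    have "ck k \<Psi> (- S)"
      unfolding \<Psi>_def by (intro ck_add openS ck_cmult ckP ck_mono [OF ckG]) simp
    moreover have "(cauchy_riemann ^^ k) \<Psi> x = 0" if "x \<in> - S" for x
      using cr\<Psi> [OF order_refl that] crG [OF that, of k] crPk [OF that] c by (simp add: h_def H_def)
    ultimately show "polymonogenic_on k \<Psi> (- S)"
      using openS by (simp add: polymonogenic_on_def Ck_on_eq_ck)
  next
    fix i assume i: "i < k"
    show "continuous_on UNIV (W i)"
      unfolding W_def P_def by (intro continuous_intros de.continuous_potential)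
    show "(cauchy_riemann ^^ i) \<Psi> x = W i x" if "x \<in> - S - U" for x
      using cr\<Psi> [of i x] crG [of x i] crP [OF i, of x] that i by (simp add: W_def)
    show "((cauchy_riemann ^^ i) \<Psi> \<longlongrightarrow> 0) at_infinity"
    proof (rule Lim_transform_eventually)
      have "real (k - 1 - i) + 1 < N" using i N by linarith
      then have "(P i \<longlongrightarrow> 0) at_infinity" unfolding P_def by (rule de.potential_tendsto_0_at_infinity)
      from tendsto_scaleR [OF tendsto_const [of "- 1 / c"] this]
      show "(W i \<longlongrightarrow> 0) at_infinity" by (simp add: W_def)
      have "\<forall>\<^sub>F x in at_infinity. norm (x :: 'n point) \<ge> R + 1" by (auto simp: eventually_at_infinity)
      then show "\<forall>\<^sub>F x in at_infinity. W i x = (cauchy_riemann ^^ i) \<Psi> x"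
      proof (rule eventually_mono)
        fix x :: "'n point" assume "norm x \<ge> R + 1"
        then have x: "norm x > R" by simp
        show "W i x = (cauchy_riemann ^^ i) \<Psi> x"
          using cr\<Psi> [of i x] crG [of x i] crP [OF i, of x] far(1) [OF x] far_pow [OF x, of i] i by (simp add: W_def)
      qed
    qed
    fix q assume q: "q \<in> S"
    show "((cauchy_riemann ^^ i) \<Psi> \<longlongrightarrow> jump_datum f i q + W i q) (at q within U)"
    proof (rule Lim_transform_eventually)
      have "((\<lambda>x. \<Sum>rs | length rs = i. cl_prod_list (map cl_e rs) \<star> pd_word rs F x) \<longlongrightarrow> jump_datum f i q) (at q within - S)"
        unfolding jump_datum_def F_def using i q
        by (intro tendsto_sum cl.tendsto tendsto_const we.tendsto_pd_word_extension) auto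
      then have "((\<lambda>x. \<Sum>rs | length rs = i. cl_prod_list (map cl_e rs) \<star> pd_word rs F x) \<longlongrightarrow> jump_datum f i q) (at q within U)"
        by (rule tendsto_within_subset [OF _ U(2)])
      moreover have "(W i \<longlongrightarrow> W i q) (at q within U)"
        unfolding W_def P_def
        using de.continuous_potential
        by (intro tendsto_intros) (auto simp: continuous_on_def intro: tendsto_within_subset)
      ultimately show "((\<lambda>x. (\<Sum>rs | length rs = i. cl_prod_list (map cl_e rs) \<star> pd_word rs F x) + W i x) \<longlongrightarrow> jump_datum f i q + W i q) (at q within U)"
        by (rule tendsto_add)
      have "(\<Sum>rs | length rs = i. cl_prod_list (map cl_e rs) \<star> pd_word rs F x) + W i x = (cauchy_riemann ^^ i) \<Psi> x"
        if x: "x \<in> U" for x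
      proof -
        have xS: "x \<in> - S" using U(2) x by blast
        have "(cauchy_riemann ^^ i) F x = (\<Sum>rs | length rs = i. cl_prod_list (map cl_e rs) \<star> pd_word rs F x)"
          using i by (intro cr_pow_eq_words [OF openS ck_mono [OF ckF] xS]) simp
        then show ?thesis
          using cr\<Psi> [of i x] crG [OF xS, of i] crP [OF i xS] i xS x by (simp add: W_def)
      qed
      then show "\<forall>\<^sub>F x in at q within U. (\<Sum>rs | length rs = i. cl_prod_list (map cl_e rs) \<star> pd_word rs F x) + W i x = (cauchy_riemann ^^ i) \<Psi> x"
        unfolding eventually_at_filter by (intro always_eventually) auto
    qed
  qed
qed

subsection \<open>Choice of the side\<close>

text \<open>
  The exponents are extended reals and may be infinite, so the hypothesis is not simply rearranged.
\<close>

lemma exponent_gt_imp_finite_integral: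
  fixes \<nu> n :: real and a b :: ereal
  assumes "ereal \<nu> > 1 - max a b / ereal n" "n > 0"
  shows "a > ereal (n * (1 - \<nu>)) \<or> b > ereal (n * (1 - \<nu>))"
proof (rule ccontr)
  assume "\<not> ?thesis"
  then have "max a b \<le> ereal (n * (1 - \<nu>))" by (simp add: not_less)
  then have "max a b / ereal n \<le> ereal (n * (1 - \<nu>)) / ereal n" using assms(2) by (intro ereal_divide_right_mono) auto
  also have "\<dots> = ereal (1 - \<nu>)" using assms(2) by simp
  finally have "1 - ereal (1 - \<nu>) \<le> 1 - max a b / ereal n" by (intro ereal_minus_mono) auto
  then have "ereal \<nu> \<le> 1 - max a b / ereal n" by (simp add: one_ereal_def)
  with assms(1) show False by simp
qed

lemma one_sided_exponent_gt:
  assumes "one_sided_exponent S D > ereal t"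
  obtains p where "p > t" "dist_integral S p D < \<infinity>"
  using assms unfolding one_sided_exponent_def less_Sup_iff by auto

text \<open>
  The sign of the problem is reversed if the correction lives outside: with \<open>U = \<Omega>m\<close> the one-sided
  solution is taken for the datum \<open>- f\<close>, and its jump from \<open>\<Omega>m\<close> to \<open>\<Omega>p\<close> is \<open>f\<close>.
\<close>

theorem theorem8:
  fixes S \<Omega>p \<Omega>m :: "'n::{finite,linorder} point set"
    and r \<nu> :: real and k :: nat
    and f :: "'n multiindex \<Rightarrow> 'n point \<Rightarrow> 'n clifford"
  assumes "CARD('n) \<ge> 2"
    and "jordan_hypersurface S \<Omega>p \<Omega>m"
    and "fractal_hypersurface S"
    and "S \<subseteq> {x. norm x < r}"
    and "k \<ge> 1" and "0 < \<nu>" and "\<nu> \<le> 1"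
    and "f \<in> clifford_Lip S (k - 1) \<nu>"
    and "ereal \<nu> > 1 - marcinkiewicz_exponent S \<Omega>p \<Omega>m r / ereal (real (CARD('n) + 1))"
    and "k < CARD('n) + 1"
  shows "\<exists>\<Phi>. solves_bvp S \<Omega>p \<Omega>m k f \<Phi>"
proof -
  from assms(2) have S: "compact S" and comp: "\<Omega>p \<in> components (- S)" "\<Omega>m \<in> components (- S)"
    and bdd: "bounded \<Omega>p" "\<not> bounded \<Omega>m" and cover: "- S = \<Omega>p \<union> \<Omega>m" and fr: "frontier \<Omega>p = S"
    by (auto simp: jordan_hypersurface_def)
  have opn: "open \<Omega>p" "open \<Omega>m"
    using open_components [OF _ comp(1)] open_components [OF _ comp(2)] S
    by (simp_all add: compact_imp_closed open_Compl)
  have "\<Omega>p \<noteq> \<Omega>m" using bdd by blast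
  then have disj: "\<Omega>p \<inter> \<Omega>m = {}" using components_nonoverlap [OF comp] by blast
  have "\<Omega>p \<noteq> {}" using comp(1) in_components_nonempty by blast
  moreover have "\<Omega>p \<noteq> UNIV" using bdd(1) not_bounded_UNIV by blast
  ultimately have S_ne: "S \<noteq> {}" using fr frontier_eq_empty by blast
  have comps: "\<Omega>p \<subseteq> - S" "\<Omega>m \<subseteq> - S" "- S - \<Omega>p = \<Omega>m" "- S - \<Omega>m = \<Omega>p" using cover disj by auto
  have ball: "{x. norm x < r} = ball 0 r" by auto
  have card: "real (CARD('n) + 1) = real CARD('n option)" by simp
  have kN: "k < CARD('n option)" using assms(10) by simp
  obtain M where M: "M > 0" "whitney_jet S (k - 1) \<nu> M f" by (rule clifford_Lip_imp_whitney_jet [OF assms(8)])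
  have contJ: "continuous_on S (jump_datum f i)" if "i < k" for i
    using that by (intro continuous_on_jump_datum [OF M(2) assms(6)]) simp
  have cont: "continuous_on (- S) ((cauchy_riemann ^^ i) \<Phi>)" if "polymonogenic_on k \<Phi> (- S)" "i < k" for i \<Phi>
  proof -
    have "ck (0 + i) \<Phi> (- S)" using that by (auto simp: polymonogenic_on_def Ck_on_eq_ck intro: ck_mono)
    from ck_cr_pow [OF _ this] show ?thesis using that by (simp add: polymonogenic_on_def)
  qed
  have limV: "(g \<longlongrightarrow> J q) (at q within U)"
    if "continuous_on UNIV J" "\<And>x. x \<in> U \<Longrightarrow> g x = J x" for g J :: "'n point \<Rightarrow> 'n clifford" and U q
  proof (rule Lim_transform_eventually)
    show "(J \<longlongrightarrow> J q) (at q within U)"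
      using that(1) by (auto simp: continuous_on_def intro: tendsto_within_subset)
    show "\<forall>\<^sub>F x in at q within U. J x = g x"
      unfolding eventually_at_filter by (rule always_eventually) (use that(2) in auto)
  qed
  consider "one_sided_exponent S \<Omega>p > ereal (real CARD('n option) * (1 - \<nu>))"
    | "one_sided_exponent S (\<Omega>m \<inter> ball 0 r) > ereal (real CARD('n option) * (1 - \<nu>))"
    using exponent_gt_imp_finite_integral [OF assms(9) [unfolded marcinkiewicz_exponent_def card ball]] by auto
  then show ?thesis
  proof cases
    case 1
    then obtain p0 where p0: "p0 > real CARD('n option) * (1 - \<nu>)" "dist_integral S p0 \<Omega>p < \<infinity>"
      by (rule one_sided_exponent_gt)
    have "dist_integral S p0 (\<Omega>p \<inter> ball 0 r) \<le> dist_integral S p0 \<Omega>p"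
      unfolding dist_integral_def by (intro nn_integral_mono) (auto simp: indicator_def)
    then have p0': "dist_integral S p0 (\<Omega>p \<inter> ball 0 r) < \<infinity>" using p0(2) by (rule order_le_less_trans)
    obtain \<Psi> W where \<Psi>: "polymonogenic_on k \<Psi> (- S)"
      and W: "\<And>i. i < k \<Longrightarrow> continuous_on UNIV (W i)"
      and lim: "\<And>i q. i < k \<Longrightarrow> q \<in> S \<Longrightarrow> ((cauchy_riemann ^^ i) \<Psi> \<longlongrightarrow> jump_datum f i q + W i q) (at q within \<Omega>p)"
      and eq: "\<And>i x. i < k \<Longrightarrow> x \<in> - S - \<Omega>p \<Longrightarrow> (cauchy_riemann ^^ i) \<Psi> x = W i x"
      and inf: "\<And>i. i < k \<Longrightarrow> ((cauchy_riemann ^^ i) \<Psi> \<longlongrightarrow> 0) at_infinity"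
      by (rule one_sided_solution [OF S S_ne opn(1) comps(1) _ assms(4) [unfolded ball] M(2,1) assms(6,7,5) kN p0(1) p0'])
         (use comps opn in auto)
    have sol: "solves_bvp S \<Omega>p \<Omega>m k f \<Psi>"
      unfolding solves_bvp_def
    proof (intro conjI allI impI)
      fix i assume i: "i < k"
      let ?g = "(cauchy_riemann ^^ i) \<Psi>"
      let ?Gp = "\<lambda>x. if x \<in> \<Omega>p then ?g x else jump_datum f i x + W i x"
      let ?Gm = "\<lambda>x. if x \<in> \<Omega>m then ?g x else W i x"
      have cW: "continuous_on S (W i)" using W [OF i] by (rule continuous_on_subset) simp
      have "continuous_extension ?g \<Omega>p S ?Gp"
        by (rule continuous_extension_glue [OF opn(1) _ continuous_on_subset [OF cont [OF \<Psi> i] comps(1)]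
              continuous_on_add [OF contJ [OF i] cW] lim [OF i]]) (use comps in auto)
      moreover have "continuous_extension ?g \<Omega>m S ?Gm"
        by (rule continuous_extension_glue [OF opn(2) _ continuous_on_subset [OF cont [OF \<Psi> i] comps(2)]
              cW limV [OF W [OF i] eq [OF i]]]) (use comps in auto)
      moreover have "\<forall>x\<in>S. ?Gp x - ?Gm x = jump_datum f i x" using comps by auto
      ultimately show "\<exists>Gp Gm. continuous_extension ?g \<Omega>p S Gp \<and> continuous_extension ?g \<Omega>m S Gm \<and>
          (\<forall>x\<in>S. Gp x - Gm x = jump_datum f i x) \<and> (?g \<longlongrightarrow> 0) at_infinity"
        using inf [OF i] by blast
    qed (rule \<Psi>)
    show ?thesis by (rule exI [where x = \<Psi>], rule sol)
  next
    case 2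
    then obtain p0 where p0: "p0 > real CARD('n option) * (1 - \<nu>)" "dist_integral S p0 (\<Omega>m \<inter> ball 0 r) < \<infinity>"
      by (rule one_sided_exponent_gt)
    obtain \<Psi> W where \<Psi>: "polymonogenic_on k \<Psi> (- S)"
      and W: "\<And>i. i < k \<Longrightarrow> continuous_on UNIV (W i)"
      and lim: "\<And>i q. i < k \<Longrightarrow> q \<in> S \<Longrightarrow> ((cauchy_riemann ^^ i) \<Psi> \<longlongrightarrow> jump_datum (\<lambda>j x. - f j x) i q + W i q) (at q within \<Omega>m)"
      and eq: "\<And>i x. i < k \<Longrightarrow> x \<in> - S - \<Omega>m \<Longrightarrow> (cauchy_riemann ^^ i) \<Psi> x = W i x"
      and inf: "\<And>i. i < k \<Longrightarrow> ((cauchy_riemann ^^ i) \<Psi> \<longlongrightarrow> 0) at_infinity"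
      by (rule one_sided_solution [OF S S_ne opn(2) comps(2) _ assms(4) [unfolded ball] whitney_jet_minus [OF M(2)] M(1) assms(6,7,5) kN p0])
         (use comps opn in auto)
    have sol: "solves_bvp S \<Omega>p \<Omega>m k f \<Psi>"
      unfolding solves_bvp_def
    proof (intro conjI allI impI)
      fix i assume i: "i < k"
      let ?g = "(cauchy_riemann ^^ i) \<Psi>"
      let ?Gp = "\<lambda>x. if x \<in> \<Omega>p then ?g x else W i x"
      let ?Gm = "\<lambda>x. if x \<in> \<Omega>m then ?g x else - jump_datum f i x + W i x"
      have cW: "continuous_on S (W i)" using W [OF i] by (rule continuous_on_subset) simp
      have "continuous_extension ?g \<Omega>p S ?Gp"
        by (rule continuous_extension_glue [OF opn(1) _ continuous_on_subset [OF cont [OF \<Psi> i] comps(1)]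
              cW limV [OF W [OF i] eq [OF i]]]) (use comps in auto)
      moreover have "continuous_extension ?g \<Omega>m S ?Gm"
        by (rule continuous_extension_glue [OF opn(2) _ continuous_on_subset [OF cont [OF \<Psi> i] comps(2)]
              continuous_on_add [OF continuous_on_minus [OF contJ [OF i]] cW] lim [OF i, unfolded jump_datum_minus]])
           (use comps in auto)
      moreover have "\<forall>x\<in>S. ?Gp x - ?Gm x = jump_datum f i x" using comps by auto
      ultimately show "\<exists>Gp Gm. continuous_extension ?g \<Omega>p S Gp \<and> continuous_extension ?g \<Omega>m S Gm \<and>
          (\<forall>x\<in>S. Gp x - Gm x = jump_datum f i x) \<and> (?g \<longlongrightarrow> 0) at_infinity"
        using inf [OF i] by blast
    qed (rule \<Psi>)
    show ?thesis by (rule exI [where x = \<Psi>], rule sol)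
  qed
qed

end
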